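(* Let $\Gamma$ be a limit cycle of $\dot u=F(u)$ at a Chenciner (CH) bifurcation, with the critical center manifold near $\Gamma$ parametrized by $(\tau,\xi)$ as in the context, so that the restricted dynamics has the CH periodic normal form with coefficients $\alpha_1,\alpha_2,c,e$. Let $v,\varphi^*,v^*$ be as in the context. All equations below are on $[0,T]$, and all functions $h$ below satisfy $h(T)=h(0)$. Then $h_{20}$ is the unique $T$-periodic solution of $\dot h_{20}-Ah_{20}+2i\omega h_{20}-B(\tau;v,v)=0$; $$\alpha_1=\int_0^T\langle\varphi^*,B(\tau;v,\bar v)\rangle d\tau;$$ $h_{11}$ is the unique $T$-periodic solution of $\dot h_{11}-Ah_{11}-B(\tau;v,\bar v)+\alpha_1\dot u_0=0$ with $\int_0^T\langle\varphi^*,h_{11}\rangle d\tau=0$; $$c=-\frac i2\int_0^T\langle v^*,C(\tau;v,v,\bar v)+2B(\tau;v,h_{11})+B(\tau;\bar v,h_{20})-2\alpha_1Av\rangle d\tau+\alpha_1\omega;$$ $h_{21}$ is the unique $T$-periodic solution of $$\dot h_{21}-Ah_{21}+i\omega h_{21}-C(\tau;v,v,\bar v)-2B(\tau;v,h_{11})-B(\tau;\bar v,h_{20})+2icv+2\alpha_1(Av-i\omega v)=0$$ with $\int_0^T\langle v^*,h_{21}\rangle d\tau=0$; $h_{30}$ is the unique $T$-periodic solution of $$\dot h_{30}-Ah_{30}+3i\omega h_{30}-C(\tau;v,v,v)-3B(\tau;v,h_{20})=0;$$ $h_{31}$ is the unique $T$-periodic solution of $$\begin{aligned}&\dot h_{31}-Ah_{31}+2i\omega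 h_{31}-D(\tau;v,v,v,\bar v)-3C(\tau;v,v,h_{11})-3C(\tau;v,\bar v,h_{20})-3B(\tau;h_{11},h_{20})-3B(\tau;v,h_{21})\\&-B(\tau;\bar v,h_{30})+6ich_{20}+3\alpha_1\big(Ah_{20}-2i\omega h_{20}+B(\tau;v,v)\big)=0;\end{aligned}$$ $$\begin{aligned}\alpha_2=\frac14\int_0^T\langle\varphi^*,\;&D(\tau;v,v,\bar v,\bar v)+C(\tau;v,v,h_{02})+4C(\tau;v,\bar v,h_{11})+C(\tau;\bar v,\bar v,h_{20})+2B(\tau;h_{11},h_{11})\\&+2B(\tau;v,h_{12})+B(\tau;h_{02},h_{20})+2B(\tau;\bar v,h_{21})-4\alpha_1(Ah_{11}+B(\tau;v,\bar v))\rangle d\tau+\alpha_1^2;\end{aligned}$$ $h_{22}$ is the unique $T$-periodic solution of $$\begin{aligned}&\dot h_{22}-Ah_{22}-D(\tau;v,v,\bar v,\bar v)-C(\tau;v,v,h_{02})-4C(\tau;v,\bar v,h_{11})-C(\tau;\bar v,\bar v,h_{20})-2B(\tau;h_{11},h_{11})\\&-2B(\tau;v,h_{12})-B(\tau;h_{02},h_{20})-2B(\tau;\bar v,h_{21})+4\alpha_1\big(Ah_{11}+B(\tau;v,\bar v)-\alpha_1F(u_0)\big)+4\alpha_2F(u_0)=0\end{aligned}$$ with $\int_0^T\langle\varphi^*,h_{22}\rangle d\tau=0$; and $$\begin{aligned}e=\frac1{12}\int_0^T\langle v^*,\;&E(\tau;v,v,v,\bar v,\bar v)+D(\tau;v,v,v,h_{02})+6D(\tau;v,v,\bar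 v,h_{11})+3D(\tau;v,\bar v,\bar v,h_{20})\\&+6C(\tau;v,h_{11},h_{11})+3C(\tau;v,v,h_{12})+3C(\tau;v,h_{02},h_{20})+6C(\tau;\bar v,h_{11},h_{20})+6C(\tau;v,\bar v,h_{21})\\&+C(\tau;\bar v,\bar v,h_{30})+3B(\tau;h_{12},h_{20})+6B(\tau;h_{11},h_{21})+3B(\tau;v,h_{22})+B(\tau;h_{02},h_{30})\\&+2B(\tau;\bar v,h_{31})-12\alpha_2Av-6\alpha_1\big(Ah_{21}+2B(\tau;v,h_{11})+C(\tau;v,v,\bar v)+B(\tau;\bar v,h_{20})-2\alpha_1Av\big)\rangle d\tau\\&+i\omega\alpha_2+ic\alpha_1-i\omega\alpha_1^2 .\end{aligned}$$ Here $h_{ji}=\bar h_{ij}$. The coefficients $\alpha_1,\alpha_2,c,e$ do not change if $v$ is replaced by $\gamma v$ with $\gamma\in\mathbb C$, $|\gamma|=1$.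
   Context: Setting. $F:\mathbb R^n\to\mathbb R^n$ is sufficiently smooth and $u_0$ is a nonconstant periodic solution of $\dot u=F(u)$ with minimal period $T>0$; $\Gamma$ is its orbit. Write $F(u_0(\tau)+w)=F(u_0)+A(\tau)w+\frac12B(\tau;w,w)+\frac1{3!}C(\tau;w,w,w)+\frac1{4!}D(\tau;w,w,w,w)+\frac1{5!}E(\tau;w,w,w,w,w)+\dots$, where $A(\tau)=F_u(u_0(\tau))$ and $B,C,D,E$ are the symmetric multilinear forms of second to fifth derivatives of $F$ at $u_0(\tau)$, extended $\mathbb C$-multilinearly. Dots over functions of $\tau$ denote $d/d\tau$; $\langle a,b\rangle=a^{\rm H}b$ (conjugate-linear in the first argument). Let $Y$ solve $\dot Y=A(\tau)Y$, $Y(0)=I_n$; the eigenvalues of $Y(T)$ are the multipliers, critical if of modulus 1. CH bifurcation: the multiplier $1$ is simple, the only other critical multipliers are $e^{\pm i\theta}$, simple, with $\theta\ne2\pi/j$ for $j=1,\dots,6$, $\omega=\theta/T$, and the first Lyapunov coefficient vanishes, so that the following holds. The three-dimensional critical center manifold near $\Gamma$ is parametrized as $u=u_0(\tau)+\xi v(\tau)+\bar\xi\bar v(\tau)+H(\tau,\xi,\bar\xi)$, $\xi\in\mathbb C$ small, with $H$ real, smooth, $T$-periodic in $\tau$, $$H=\sum_{2\le i+j\le5}\frac1{i!\,j!}h_{ij}(\tau)\xi^i\bar\xi^j+O(|\xi|^6),\qquad h_{ij}(T)=h_{ij}(0),\ h_{ij}=\bar h_{ji},$$ where the remaining freedom is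 fixed by $\int_0^T\langle\varphi^*,h_{11}\rangle d\tau=\int_0^T\langle v^*,h_{21}\rangle d\tau=\int_0^T\langle\varphi^*,h_{22}\rangle d\tau=0$. The dynamics restricted to it is $$\frac{d\tau}{dt}=1+\alpha_1|\xi|^2+\alpha_2|\xi|^4+\dots,\qquad\frac{d\xi}{dt}=i\omega\xi+ic\,\xi|\xi|^2+e\,\xi|\xi|^4+\dots,$$ with $\alpha_1,\alpha_2,c\in\mathbb R$, $e\in\mathbb C$, and dots denoting $O(|\xi|^6)$ terms $T$-periodic in $\tau$; that is, if $(\tau(t),\xi(t))$ solves this system then $u(\tau(t),\xi(t),\bar\xi(t))$ solves $\dot u=F(u)$. Here $v$ satisfies $\dot v-A(\tau)v+i\omega v=0$ on $[0,T]$, $v(T)=v(0)$, $\int_0^T\langle v,v\rangle d\tau=1$; $\varphi^*$ (real) satisfies $\dot\varphi^*+A^{\rm T}(\tau)\varphi^*=0$, $\varphi^*(T)=\varphi^*(0)$, $\int_0^T\langle\varphi^*,F(u_0)\rangle d\tau=1$; $v^*$ satisfies $\dot v^*+A^{\rm T}(\tau)v^*+i\omega v^*=0$, $v^*(T)=v^*(0)$, $\int_0^T\langle v^*,v\rangle d\tau=1$.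
   Formalization: The angle θ of the critical pair e^{±iθ} is normalized to 0<θ<π; for arbitrary real θ the condition θ≠2π/j (j=1,…,6) admits θ=4π/3, a strong resonance where h_20 is not unique. *)

theory Defs
  imports "HOL-Analysis.Analysis"
begin

definition cvec :: "real^'n \<Rightarrow> complex^'n" where
  "cvec x = (\<chi> i. complex_of_real (x $ i))"

definition vRe :: "complex^'n \<Rightarrow> real^'n" where
  "vRe w = (\<chi> i. Re (w $ i))"

definition vIm :: "complex^'n \<Rightarrow> real^'n" where
  "vIm w = (\<chi> i. Im (w $ i))"

definition vcnj :: "complex^'n \<Rightarrow> complex^'n" where
  "vcnj w = (\<chi> i. cnj (w $ i))"

abbreviation cmat :: "real^'n^'n \<Rightarrow> complex^'n^'n" where
  "cmat \<equiv> map_matrix complex_of_real"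

definition herm :: "complex^'n \<Rightarrow> complex^'n \<Rightarrow> complex"  ("\<langle>_,/ _\<rangle>") where
  "\<langle>a, b\<rangle> = (\<Sum>i\<in>UNIV. cnj (a $ i) * b $ i)"

text \<open>On an open set of a finite-dimensional space this is the usual class of k times
  continuously (Frechet) differentiable maps.\<close>

fun Ck_on :: "nat \<Rightarrow> ('a::euclidean_space \<Rightarrow> 'b::real_normed_vector) \<Rightarrow> 'a set \<Rightarrow> bool" where
  "Ck_on 0 f S \<longleftrightarrow> continuous_on S f"
| "Ck_on (Suc k) f S \<longleftrightarrow>
     (\<forall>x\<in>S. f differentiable (at x)) \<and>
     (\<forall>w. Ck_on k (\<lambda>x. frechet_derivative f (at x) w) S)"

text \<open>The value at the given vectors of the derivative of f at x whose order is the length of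
  the list; the order of the vectors is immaterial when f is of that class.\<close>

fun dir_deriv ::
  "('a::real_normed_vector \<Rightarrow> 'b::real_normed_vector) \<Rightarrow> 'a list \<Rightarrow> 'a \<Rightarrow> 'b" where
  "dir_deriv f [] = f"
| "dir_deriv f (w # ws) = (\<lambda>x. frechet_derivative (dir_deriv f ws) (at x) w)"

text \<open>Complex multilinear extension of a real multilinear form, given as a function of the list
  of its arguments: each argument is split into real and imaginary part.\<close>

fun cmultilinear :: "((real^'n) list \<Rightarrow> real^'n) \<Rightarrow> (complex^'n) list \<Rightarrow> complex^'n" where
  "cmultilinear M [] = cvec (M [])"
| "cmultilinear M (w # ws) =
     cmultilinear (\<lambda>xs. M (vRe w # xs)) ws + \<i> *s cmultilinear (\<lambda>xs. M (vIm w # xs)) ws"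

definition cderiv :: "(real^'n \<Rightarrow> real^'n) \<Rightarrow> real^'n \<Rightarrow> (complex^'n) list \<Rightarrow> complex^'n" where
  "cderiv F x = cmultilinear (\<lambda>ws. dir_deriv F ws x)"

text \<open>\<open>solves T R h\<close>: on [0,T], h solves the equation R(t, h'(t), h(t)) = 0 together with the
  boundary condition h(T) = h(0).\<close>

definition solves ::
  "real \<Rightarrow> (real \<Rightarrow> 'a \<Rightarrow> 'a \<Rightarrow> 'a) \<Rightarrow> (real \<Rightarrow> 'a::real_normed_vector) \<Rightarrow> bool" where
  "solves T R h \<longleftrightarrow>
     (\<forall>t\<in>{0..T}. \<exists>d. (h has_vector_derivative d) (at t within {0..T}) \<and> R t d (h t) = 0) \<and>
     h T = h 0"

definition unique_solution ::
  "real \<Rightarrow> (real \<Rightarrow> 'a \<Rightarrow> 'a \<Rightarrow> 'a) \<Rightarrow> ((real \<Rightarrow> 'a) \<Rightarrow> bool) \<Rightarrow>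
   (real \<Rightarrow> 'a::real_normed_vector) \<Rightarrow> bool" where
  "unique_solution T R P h \<longleftrightarrow>
     solves T R h \<and> P h \<and> (\<forall>g. solves T R g \<and> P g \<longrightarrow> (\<forall>t\<in>{0..T}. g t = h t))"

definition limit_cycle :: "(real^'n \<Rightarrow> real^'n) \<Rightarrow> (real \<Rightarrow> real^'n) \<Rightarrow> real \<Rightarrow> bool" where
  "limit_cycle F u0 T \<longleftrightarrow>
     (\<forall>t. (u0 has_vector_derivative F (u0 t)) (at t)) \<and>
     (\<exists>s t. u0 s \<noteq> u0 t) \<and>
     T > 0 \<and> (\<forall>t. u0 (t + T) = u0 t) \<and>
     (\<forall>S. 0 < S \<and> S < T \<longrightarrow> \<not> (\<forall>t. u0 (t + S) = u0 t))"

definition fundamental_matrix ::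
  "(real^'n \<Rightarrow> real^'n) \<Rightarrow> (real \<Rightarrow> real^'n) \<Rightarrow> real \<Rightarrow> (real \<Rightarrow> real^'n^'n) \<Rightarrow> bool" where
  "fundamental_matrix F u0 T Y \<longleftrightarrow>
     (\<forall>t\<in>{0..T}. (Y has_vector_derivative jacobian F (at (u0 t)) ** Y t) (at t within {0..T})) \<and>
     Y 0 = mat 1"

definition eigenvalue_of :: "complex^'n^'n \<Rightarrow> complex \<Rightarrow> bool" where
  "eigenvalue_of M \<mu> \<longleftrightarrow> (\<exists>x. x \<noteq> 0 \<and> M *v x = \<mu> *s x)"

definition charpoly :: "complex^'n^'n \<Rightarrow> complex poly" where
  "charpoly M = det (mat [:0, 1:] - map_matrix (\<lambda>a. [:a:]) M)"

definition simple_eigenvalue_of :: "complex^'n^'n \<Rightarrow> complex \<Rightarrow> bool" where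
  "simple_eigenvalue_of M \<mu> \<longleftrightarrow> eigenvalue_of M \<mu> \<and> order \<mu> (charpoly M) = 1"

text \<open>As usual the angle of the complex pair is taken in the open interval from 0 to pi.\<close>

definition CH_multipliers :: "real^'n^'n \<Rightarrow> real \<Rightarrow> bool" where
  "CH_multipliers M \<theta> \<longleftrightarrow>
     0 < \<theta> \<and> \<theta> < pi \<and> (\<forall>j\<in>{1..6::nat}. \<theta> \<noteq> 2 * pi / real j) \<and>
     simple_eigenvalue_of (cmat M) 1 \<and>
     simple_eigenvalue_of (cmat M) (cis \<theta>) \<and>
     simple_eigenvalue_of (cmat M) (cis (- \<theta>)) \<and>
     (\<forall>\<mu>. eigenvalue_of (cmat M) \<mu> \<and> cmod \<mu> = 1 \<longrightarrow> \<mu> \<in> {1, cis \<theta>, cis (- \<theta>)})"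

text \<open>Only v enters the parametrization of the center manifold, hence only v is required to be
  extended periodically from [0,T] to the real line.\<close>

definition critical_eigenfunctions ::
  "(real^'n \<Rightarrow> real^'n) \<Rightarrow> (real \<Rightarrow> real^'n) \<Rightarrow> real \<Rightarrow> real \<Rightarrow>
   (real \<Rightarrow> complex^'n) \<Rightarrow> (real \<Rightarrow> real^'n) \<Rightarrow> (real \<Rightarrow> complex^'n) \<Rightarrow> bool" where
  "critical_eigenfunctions F u0 T \<omega> v \<phi>s vs \<longleftrightarrow>
     solves T (\<lambda>\<tau> d x. d - cmat (jacobian F (at (u0 \<tau>))) *v x + (\<i> * \<omega>) *s x) v \<and>
     (\<forall>\<tau>. v (\<tau> + T) = v \<tau>) \<and>
     integral {0..T} (\<lambda>\<tau>. \<langle>v \<tau>, v \<tau>\<rangle>) = 1 \<and>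
     solves T (\<lambda>\<tau> d x. d + transpose (jacobian F (at (u0 \<tau>))) *v x) \<phi>s \<and>
     integral {0..T} (\<lambda>\<tau>. \<langle>cvec (\<phi>s \<tau>), cvec (F (u0 \<tau>))\<rangle>) = 1 \<and>
     solves T (\<lambda>\<tau> d x. d + cmat (transpose (jacobian F (at (u0 \<tau>)))) *v x + (\<i> * \<omega>) *s x) vs \<and>
     integral {0..T} (\<lambda>\<tau>. \<langle>vs \<tau>, v \<tau>\<rangle>) = 1"

definition cm_param ::
  "(real \<Rightarrow> real^'n) \<Rightarrow> (real \<Rightarrow> complex^'n) \<Rightarrow> (real \<Rightarrow> complex \<Rightarrow> real^'n) \<Rightarrow>
   real \<Rightarrow> complex \<Rightarrow> real^'n" where
  "cm_param u0 v H \<tau> \<xi> =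
     u0 \<tau> + vRe (\<xi> *s v \<tau> + cnj \<xi> *s vcnj (v \<tau>)) + H \<tau> \<xi>"

text \<open>\<open>\<delta>\<close> is the radius of the neighbourhood of 0 in which \<open>\<xi>\<close> ranges. Class 6 is what a fifth
  order expansion with sixth order remainder needs.\<close>

definition cm_expansion ::
  "real \<Rightarrow> real \<Rightarrow> (real \<Rightarrow> real^'n) \<Rightarrow> (real \<Rightarrow> complex^'n) \<Rightarrow>
   (real \<Rightarrow> complex \<Rightarrow> real^'n) \<Rightarrow> (nat \<Rightarrow> nat \<Rightarrow> real \<Rightarrow> complex^'n) \<Rightarrow> bool" where
  "cm_expansion \<delta> T \<phi>s vs H h \<longleftrightarrow>
     Ck_on 6 (\<lambda>(\<tau>, \<xi>). H \<tau> \<xi>) (UNIV \<times> ball 0 \<delta>) \<and>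
     (\<forall>\<tau>. \<forall>\<xi>\<in>ball 0 \<delta>. H (\<tau> + T) \<xi> = H \<tau> \<xi>) \<and>
     (\<exists>M. \<forall>\<tau>. \<forall>\<xi>\<in>ball 0 \<delta>.
        norm (cvec (H \<tau> \<xi>) -
              (\<Sum>(j, k) \<in> {(j, k). 2 \<le> j + k \<and> j + k \<le> 5}.
                 (\<xi> ^ j * cnj \<xi> ^ k / (fact j * fact k)) *s h j k \<tau>))
        \<le> M * norm \<xi> ^ 6) \<and>
     (\<forall>j k. 2 \<le> j + k \<and> j + k \<le> 5 \<longrightarrow>
        h j k T = h j k 0 \<and> (\<forall>\<tau>. h j k \<tau> = vcnj (h k j \<tau>))) \<and>
     integral {0..T} (\<lambda>\<tau>. \<langle>cvec (\<phi>s \<tau>), h 1 1 \<tau>\<rangle>) = 0 \<and>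
     integral {0..T} (\<lambda>\<tau>. \<langle>vs \<tau>, h 2 1 \<tau>\<rangle>) = 0 \<and>
     integral {0..T} (\<lambda>\<tau>. \<langle>cvec (\<phi>s \<tau>), h 2 2 \<tau>\<rangle>) = 0"

text \<open>The functions p and q are the remainder terms of the restricted dynamics; they are
  continuously differentiable, so that the restricted system has local solutions.\<close>

definition CH_normal_form ::
  "real \<Rightarrow> (real^'n \<Rightarrow> real^'n) \<Rightarrow> (real \<Rightarrow> real^'n) \<Rightarrow> real \<Rightarrow> real \<Rightarrow> (real \<Rightarrow> complex^'n) \<Rightarrow>
   (real \<Rightarrow> complex \<Rightarrow> real^'n) \<Rightarrow> real \<Rightarrow> real \<Rightarrow> real \<Rightarrow> complex \<Rightarrow> bool" where
  "CH_normal_form \<delta> F u0 T \<omega> v H \<alpha>1 \<alpha>2 c e \<longleftrightarrow>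
     (\<exists>(p :: real \<Rightarrow> complex \<Rightarrow> real) (q :: real \<Rightarrow> complex \<Rightarrow> complex).
        Ck_on 1 (\<lambda>(\<tau>, \<xi>). p \<tau> \<xi>) (UNIV \<times> ball 0 \<delta>) \<and>
        Ck_on 1 (\<lambda>(\<tau>, \<xi>). q \<tau> \<xi>) (UNIV \<times> ball 0 \<delta>) \<and>
        (\<forall>\<tau>. \<forall>\<xi>\<in>ball 0 \<delta>. p (\<tau> + T) \<xi> = p \<tau> \<xi> \<and> q (\<tau> + T) \<xi> = q \<tau> \<xi>) \<and>
        (\<exists>M. \<forall>\<tau>. \<forall>\<xi>\<in>ball 0 \<delta>. \<bar>p \<tau> \<xi>\<bar> \<le> M * norm \<xi> ^ 6 \<and> norm (q \<tau> \<xi>) \<le> M * norm \<xi> ^ 6) \<and>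
        (\<forall>a b (\<tau> :: real \<Rightarrow> real) (\<xi> :: real \<Rightarrow> complex).
           (\<forall>t\<in>{a<..<b}.
              \<xi> t \<in> ball 0 \<delta> \<and>
              (\<tau> has_real_derivative
                 1 + \<alpha>1 * norm (\<xi> t) ^ 2 + \<alpha>2 * norm (\<xi> t) ^ 4 + p (\<tau> t) (\<xi> t)) (at t) \<and>
              (\<xi> has_vector_derivative
                 \<i> * \<omega> * \<xi> t + \<i> * c * \<xi> t * norm (\<xi> t) ^ 2 + e * \<xi> t * norm (\<xi> t) ^ 4
                 + q (\<tau> t) (\<xi> t)) (at t))
           \<longrightarrow> (\<forall>t\<in>{a<..<b}.
              ((\<lambda>s. cm_param u0 v H (\<tau> s) (\<xi> s)) has_vector_derivative
                 F (cm_param u0 v H (\<tau> t) (\<xi> t))) (at t))))"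

definition CH_coefficients ::
  "(real^'n \<Rightarrow> real^'n) \<Rightarrow> (real \<Rightarrow> real^'n) \<Rightarrow> real \<Rightarrow> real \<Rightarrow> (real \<Rightarrow> complex^'n) \<Rightarrow>
   real \<Rightarrow> real \<Rightarrow> real \<Rightarrow> complex \<Rightarrow> bool" where
  "CH_coefficients F u0 T \<omega> v \<alpha>1 \<alpha>2 c e \<longleftrightarrow>
     (\<exists>\<phi>s vs \<delta> H h.
        critical_eigenfunctions F u0 T \<omega> v \<phi>s vs \<and> \<delta> > 0 \<and>
        cm_expansion \<delta> T \<phi>s vs H h \<and> CH_normal_form \<delta> F u0 T \<omega> v H \<alpha>1 \<alpha>2 c e)"

end

(* Inserting the local solutions of the restricted system through an arbitrary point of the
   (tau, xi)-strip into the parametrization turns invariance of the manifold into the pointwise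
   homological equation u_tau tau' + u_xi xi' + u_xibar xibar' = F(u).  Both sides are expanded in
   xi and its conjugate up to an error o(|xi|^5); such expansions have unique coefficients.  The
   expansions of u_tau and of the Euler fields come from Taylor's formula, and their coefficients
   are identified with those of H by integrating along curves, so that no interchange of partial
   derivatives of H is needed.  The coefficient of xi^j xibar^k is the differential equation for
   h_jk.  Pairing the resonant ones with the adjoint solutions over a period eliminates h_jk and
   gives the normal form coefficients.  The solution is unique because exp(k T) is not a multiplier
   or is a simple one, in which case the normalization excludes the homogeneous solution. *)
theory Submission
  imports Defs
begin

section \<open>Real and complex vectors\<close>

text \<open>The coefficients \<open>h j k\<close> up to degree 5 determine the \<xi>-derivatives of
  \<open>H\<close> only to order 4. The fifth order is saved because the restricted field is, up to
  its remainder, a combination of \<i> \<xi> and \<xi> whose factors are real polynomials in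
  |\<xi>|^2: differentiating along it brings back a factor \<xi> and acts diagonally on
  coefficients, by \<i> (j - k) and by j + k. Since the derivative of \<open>H\<close> is only real
  linear in \<xi>, \<open>e\<close> is split into \<open>Re e\<close> and \<open>Im e\<close>. The
  error is o(|\<xi>|^5) because the first derivatives of \<open>H\<close> are of class 5; this still
  fixes all coefficients up to degree 5. No periodic solution is constructed. The
  \<open>h j k\<close> of the given manifold are solutions, so the necessity half of the Fredholm
  alternative and uniqueness suffice. The equation for \<open>h 3 2\<close> enters only through its
  solvability condition, which yields \<open>e\<close>. The formulas hold for every admissible
  choice of data and determine the coefficients one after the other. Together with the symmetry
  \<xi> -> \<gamma> \<xi> this gives independence of the phase of \<open>v\<close>.\<close>

lemma norm_smult_complex: "norm (c *s x) = cmod c * norm (x :: complex^'n)"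
  by (simp add: norm_vec_def norm_mult L2_set_right_distrib)

lemma scaleR_eq_smult: "r *\<^sub>R x = complex_of_real r *s (x :: complex^'n)"
  by (simp add: vec_eq_iff) (simp add: scaleR_conv_of_real)

text \<open>\<open>*s\<close> scales by complex numbers, while the normed structure in use is real;
  as a bounded bilinear map it inherits product rules, limits and continuity.\<close>

lemma bounded_bilinear_smult: "bounded_bilinear (\<lambda>c x. c *s (x :: complex^'n))"
proof
  show "\<exists>K. \<forall>a b. norm (a *s (b :: complex^'n)) \<le> norm a * norm b * K"
    by (rule exI[of _ 1]) (simp add: norm_smult_complex)
qed (simp_all add: vec_eq_iff algebra_simps)

lemma bounded_bilinear_matvec:
  "bounded_bilinear (\<lambda>M x. M *v (x :: complex^'n) :: complex^'m)"
  unfolding bilinear_conv_bounded_bilinear[symmetric] bilinear_def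
  by (auto intro!: linearI simp: matrix_vector_right_distrib matrix_vector_mult_add_rdistrib
      vec_eq_iff matrix_vector_mult_def scaleR_sum_right sum.distrib algebra_simps)

lemma bounded_linear_cvec: "bounded_linear (cvec :: real^'n \<Rightarrow> complex^'n)"
  unfolding linear_conv_bounded_linear[symmetric]
  by (auto intro!: linearI simp: cvec_def vec_eq_iff complex_eq_iff)

lemma bounded_linear_vRe: "bounded_linear (vRe :: complex^'n \<Rightarrow> real^'n)"
  unfolding linear_conv_bounded_linear[symmetric]
  by (auto intro!: linearI simp: vRe_def vec_eq_iff)

lemma bounded_linear_vIm: "bounded_linear (vIm :: complex^'n \<Rightarrow> real^'n)"
  unfolding linear_conv_bounded_linear[symmetric]
  by (auto intro!: linearI simp: vIm_def vec_eq_iff)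

lemma bounded_linear_vcnj: "bounded_linear (vcnj :: complex^'n \<Rightarrow> complex^'n)"
  unfolding linear_conv_bounded_linear[symmetric]
  by (auto intro!: linearI simp: vcnj_def vec_eq_iff)

lemma bounded_linear_cmat: "bounded_linear (cmat :: real^'n^'n \<Rightarrow> complex^'n^'n)"
  unfolding linear_conv_bounded_linear[symmetric]
  by (auto intro!: linearI simp: vec_eq_iff complex_eq_iff)

lemma bounded_bilinear_herm: "bounded_bilinear (\<lambda>a b. \<langle>a, b\<rangle>)"
  unfolding bilinear_conv_bounded_bilinear[symmetric] bilinear_def herm_def
  by (auto intro!: linearI simp: algebra_simps sum.distrib scaleR_sum_right)

lemmas cvec_simps = linear_simps[OF bounded_linear_cvec]
lemmas vRe_simps = linear_simps[OF bounded_linear_vRe]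
lemmas vIm_simps = linear_simps[OF bounded_linear_vIm]
lemmas vcnj_simps = linear_simps[OF bounded_linear_vcnj]

lemma vRe_cvec [simp]: "vRe (cvec x) = x" and vIm_cvec [simp]: "vIm (cvec x) = 0"
  and vcnj_cvec [simp]: "vcnj (cvec x) = cvec x" and vcnj_vcnj [simp]: "vcnj (vcnj w) = w"
  by (simp_all add: vRe_def vIm_def cvec_def vcnj_def vec_eq_iff)

lemma vcnj_smult: "vcnj (c *s x) = cnj c *s vcnj x"
  by (simp add: vcnj_def vec_eq_iff)

lemma cvec_vRe: "vcnj w = w \<Longrightarrow> cvec (vRe w) = w"
  by (auto simp: vcnj_def cvec_def vRe_def vec_eq_iff complex_eq_iff)

lemma vRe_add_vIm: "cvec (vRe w) + \<i> *s cvec (vIm w) = w"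
  by (simp add: cvec_def vRe_def vIm_def vec_eq_iff complex_eq_iff)

lemma norm_cvec [simp]: "norm (cvec x) = norm x"
  by (simp add: norm_vec_def cvec_def)

lemma norm_vcnj [simp]: "norm (vcnj x) = norm x"
  by (simp add: norm_vec_def vcnj_def)

lemma norm_vRe_le: "norm (vRe x) \<le> norm x"
  unfolding norm_vec_def vRe_def by (rule L2_set_mono) (auto simp: abs_Re_le_cmod)

lemma cvec_matvec: "cvec (M *v x) = cmat M *v cvec x"
  by (simp add: cvec_def matrix_vector_mult_def vec_eq_iff)

text \<open>The entries are real, so the Hermitian adjoint is the transpose without
  conjugation.\<close>

lemma herm_matvec: "\<langle>a, cmat M *v b\<rangle> = \<langle>cmat (transpose M) *v a, b\<rangle>"
proof -
  have "\<langle>a, cmat M *v b\<rangle> = (\<Sum>i\<in>UNIV. \<Sum>j\<in>UNIV. cnj (a $ i) * complex_of_real (M $ i $ j) * b $ j)"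
    by (simp add: herm_def matrix_vector_mult_def sum_distrib_left mult.assoc)
  also have "\<dots> = (\<Sum>j\<in>UNIV. \<Sum>i\<in>UNIV. cnj (a $ i) * complex_of_real (M $ i $ j) * b $ j)"
    by (rule sum.swap)
  also have "\<dots> = \<langle>cmat (transpose M) *v a, b\<rangle>"
    by (simp add: herm_def matrix_vector_mult_def sum_distrib_right sum_distrib_left transpose_def mult_ac)
  finally show ?thesis .
qed

lemma herm_smult_right: "\<langle>a, c *s b\<rangle> = c * \<langle>a, b\<rangle>"
  and herm_smult_left: "\<langle>c *s a, b\<rangle> = cnj c * \<langle>a, b\<rangle>"
  by (simp_all add: herm_def sum_distrib_left mult_ac)

lemmas herm_add_right = bounded_bilinear.add_right[OF bounded_bilinear_herm]
  and herm_diff_right = bounded_bilinear.diff_right[OF bounded_bilinear_herm]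
  and herm_minus_left = bounded_bilinear.minus_left[OF bounded_bilinear_herm]
  and herm_diff_left = bounded_bilinear.diff_left[OF bounded_bilinear_herm]
  and herm_zero_left = bounded_bilinear.zero_left[OF bounded_bilinear_herm]
  and herm_zero_right = bounded_bilinear.zero_right[OF bounded_bilinear_herm]

lemma herm_axis: "\<langle>a, axis j 1\<rangle> = cnj (a $ j)"
  by (simp add: herm_def axis_def if_distrib cong: if_cong)

section \<open>Linear periodic systems\<close>

text \<open>Evaluation at a point is a ring homomorphism and passes through the Leibniz sum.\<close>

lemma poly_det: "poly (det Q) z = det (map_matrix (\<lambda>p. poly p z) (Q :: complex poly^'n^'n))"
  by (simp add: det_def poly_sum poly_prod of_int_poly)

lemma poly_charpoly: "poly (charpoly M) z = det (mat z - M)"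
proof -
  have "map_matrix (\<lambda>p. poly p z) (mat [:0, 1:] - map_matrix (\<lambda>a. [:a:]) M) = mat z - M"
    by (simp add: vec_eq_iff mat_def)
  then show ?thesis by (simp add: charpoly_def poly_det)
qed

lemma mat_matvec: "mat z *v x = z *s (x :: complex^'n)"
  by (simp add: vec_eq_iff mat_def matrix_vector_mult_def if_distrib[of "\<lambda>a. a * _"] cong: if_cong)

lemma det_nonzero_iff_ker: "det M \<noteq> 0 \<longleftrightarrow> (\<forall>x. M *v x = 0 \<longrightarrow> x = (0 :: complex^'n))"
  by (metis invertible_det_nz invertible_left_inverse matrix_left_invertible_ker)

text \<open>The rules for \<open>order\<close> ask for a nonzero polynomial.
  \<open>mat z - M\<close> is injective as soon as z exceeds a bound for M, hence the sample point
  \<open>K + 1\<close>.\<close>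

lemma charpoly_nonzero: "charpoly (M :: complex^'n^'n) \<noteq> 0"
proof
  assume 0: "charpoly M = 0"
  obtain K where K: "K > 0" "\<And>x. norm (M *v x) \<le> norm x * K"
    using bounded_linear.pos_bounded[OF bounded_bilinear.bounded_linear_right[OF bounded_bilinear_matvec]]
    by blast
  define z where "z = complex_of_real (K + 1)"
  have "det (mat z - M) = 0"
    using 0 poly_charpoly[of M z] by simp
  then obtain x where x: "(mat z - M) *v x = 0" "x \<noteq> 0"
    using det_nonzero_iff_ker by blast
  then have "M *v x = z *s x"
    by (simp add: mat_matvec matrix_vector_mult_diff_rdistrib)
  then have "(K + 1) * norm x \<le> norm x * K"
    using K(2)[of x] K(1) by (simp add: norm_smult_complex z_def del: of_real_add)
  then show False using x(2) by (simp add: algebra_simps)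
qed

lemma charpoly_transpose: "charpoly (transpose M) = charpoly M"
proof -
  have "mat [:0, 1:] - map_matrix (\<lambda>a. [:a:]) (transpose M)
      = transpose (mat [:0, 1:] - map_matrix (\<lambda>a. [:a:]) M)"
    by (simp add: vec_eq_iff transpose_def mat_def)
  then show ?thesis by (simp add: charpoly_def)
qed

text \<open>Two independent eigenvectors, put in place of two columns of the identity matrix, give an
  invertible P such that two columns of \<open>(x - M) P\<close> are divisible by \<open>x - \<mu>\<close>; then \<open>\<mu>\<close> would be a
  double root of the characteristic polynomial.\<close>

lemma eigenvectors_proportional:
  fixes M :: "complex^'n^'n"
  assumes ord: "order \<mu> (charpoly M) = 1"
    and x: "M *v x = \<mu> *s x" and y: "M *v y = \<mu> *s y" and "y \<noteq> 0"
  shows "\<exists>\<kappa>. x = \<kappa> *s y"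
proof (rule ccontr)
  assume nex: "\<nexists>\<kappa>. x = \<kappa> *s y"
  obtain a where a: "y $ a \<noteq> 0" using \<open>y \<noteq> 0\<close> by (auto simp: vec_eq_iff)
  \<comment> \<open>Clearing coordinate a makes the block of y and x' on the rows a, b triangular
    with nonzero diagonal; this is what makes P invertible below.\<close>
  define x' where "x' = x - (x $ a / y $ a) *s y"
  have x'a: "x' $ a = 0" using a by (simp add: x'_def)
  have "x' \<noteq> 0" using nex by (auto simp: x'_def)
  then obtain b where b: "x' $ b \<noteq> 0" by (auto simp: vec_eq_iff)
  with x'a have ab: "a \<noteq> b" by auto
  have x': "M *v x' = \<mu> *s x'"
    by (simp add: x'_def matrix_vector_mult_diff_distrib vector_scalar_commute x y
        vec.scale_right_diff_distrib vec.scale_left_commute)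
  define P :: "complex^'n^'n" where
    "P = (\<chi> i j. if j = a then y $ i else if j = b then x' $ i else if i = j then 1 else 0)"
  define Q where "Q = mat [:0, 1:] - map_matrix (\<lambda>a. [:a:]) M"
  define R where "R = map_matrix (\<lambda>a. [:a:]) P"
  define p where "p = [:- \<mu>, 1:]"
  define S where "S = (\<chi> j. if j = a then (\<chi> i. [:y $ i:])
     else if j = b then (\<chi> i. [:x' $ i:]) else transpose (Q ** R) $ j)"
  define c where "c j = (if j = a \<or> j = b then p else 1)" for j
  have col: "(\<Sum>k\<in>UNIV. Q $ i $ k * [:w $ k:]) = p * [:w $ i:]" if "M *v w = \<mu> *s w" for w i
  proof -
    have "(\<Sum>k\<in>UNIV. Q $ i $ k * [:w $ k:]) =
      (\<Sum>k\<in>UNIV. (if i = k then [:0,1:] * [:w $ k:] else 0)) - (\<Sum>k\<in>UNIV. [:M $ i $ k * w $ k:])"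
      unfolding sum_subtractf[symmetric] by (rule sum.cong) (auto simp: Q_def mat_def left_diff_distrib)
    also have "(\<Sum>k\<in>UNIV. [:M $ i $ k * w $ k:]) = [:(\<Sum>k\<in>UNIV. M $ i $ k * w $ k):]"
      by (induction rule: infinite_finite_induct) auto
    also have "(\<Sum>k\<in>UNIV. M $ i $ k * w $ k) = \<mu> * w $ i"
      using that by (simp add: vec_eq_iff matrix_vector_mult_def)
    finally show ?thesis by (simp add: p_def)
  qed
  \<comment> \<open>Factors are drawn out of the rows of a determinant, so the two divisible columns
    are treated as rows of the transpose.\<close>
  have "transpose (Q ** R) = (\<chi> j. c j *s S $ j)"
  proof -
    have "transpose (Q ** R) $ j $ i = (c j *s S $ j) $ i" for i j
    proof -
      consider "j = a" | "j = b" | "j \<noteq> a" "j \<noteq> b" by blast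
      then show ?thesis
        by cases (use ab col[OF y, of i] col[OF x', of i] in
            \<open>auto simp: transpose_def matrix_matrix_mult_def R_def P_def c_def S_def\<close>)
    qed
    then show ?thesis by (simp add: vec_eq_iff)
  qed
  then have "det (Q ** R) = (\<Prod>j\<in>UNIV. c j) * det S"
    by (metis det_rows_mul det_transpose vec_lambda_eta)
  also have "(\<Prod>j\<in>UNIV. c j) = (\<Prod>j\<in>{a, b}. p)"
    by (rule prod.mono_neutral_cong_right) (auto simp: c_def)
  also have "\<dots> = p ^ 2" using ab by (simp add: power2_eq_square)
  finally have eq: "charpoly M * det R = p ^ 2 * det S"
    by (simp add: det_mul Q_def charpoly_def)
  have "poly (det R) \<mu> = det P"
  proof -
    have "map_matrix (\<lambda>p. poly p \<mu>) R = P" by (simp add: vec_eq_iff R_def)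
    then show ?thesis by (simp add: poly_det)
  qed
  moreover have "det P \<noteq> 0"
    unfolding det_nonzero_iff_ker
  proof (intro allI impI)
    fix w assume w: "P *v w = 0"
    have r: "w $ a * y $ i + w $ b * x' $ i + (if i = a \<or> i = b then 0 else w $ i) = 0" for i
    proof -
      have "0 = (\<Sum>k\<in>UNIV. P $ i $ k * w $ k)"
        using w by (simp add: vec_eq_iff matrix_vector_mult_def)
      also have "\<dots> = (\<Sum>k\<in>UNIV. (if k = a then w $ a * y $ i else 0) + (if k = b then w $ b * x' $ i else 0)
          + (if k = i then (if i = a \<or> i = b then 0 else w $ i) else 0))"
        by (rule sum.cong) (use ab in \<open>auto simp: P_def\<close>)
      also have "\<dots> = w $ a * y $ i + w $ b * x' $ i + (if i = a \<or> i = b then 0 else w $ i)"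
        by (simp add: sum.distrib)
      finally show ?thesis by simp
    qed
    have wa: "w $ a = 0" using r[of a] a x'a by simp
    have wb: "w $ b = 0" using r[of b] b wa by simp
    show "w = 0" using r wa wb by (auto simp: vec_eq_iff) metis
  qed
  ultimately have nz: "poly (det R) \<mu> \<noteq> 0" by simp
  then have R0: "det R \<noteq> 0" and "order \<mu> (det R) = 0"
    using order_root[of "det R" \<mu>] by auto
  then have "order \<mu> (charpoly M * det R) = 1"
    using ord charpoly_nonzero[of M] by (simp add: order_mult)
  moreover have "2 \<le> order \<mu> (charpoly M * det R)"
    using order_divides[of \<mu> 2 "charpoly M * det R"] charpoly_nonzero[of M] R0 eq
    by (auto simp: p_def)
  ultimately show False by simp
qed

text \<open>The weight exp (- 2 K t) turns the growth bound into monotonicity: the weighted squared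
  norm does not increase and starts at 0.\<close>

lemma gronwall_zero:
  fixes x :: "real \<Rightarrow> 'a::real_inner"
  assumes x: "\<And>t. t \<in> {0..T} \<Longrightarrow> (x has_vector_derivative x' t) (at t within {0..T})"
    and K: "\<And>t. t \<in> {0..T} \<Longrightarrow> norm (x' t) \<le> K * norm (x t)"
    and 0: "x 0 = 0" and t: "t \<in> {0..T}"
  shows "x t = 0"
proof (cases "t = 0")
  case False
  define f where "f s = exp (- 2 * K * s) * (x s \<bullet> x s)" for s
  have df: "(f has_real_derivative exp (- 2 * K * s) * (- 2 * K * (x s \<bullet> x s) + 2 * (x s \<bullet> x' s))) (at s within {0..T})"
    if "s \<in> {0..T}" for s
    unfolding f_def has_real_derivative_iff_has_vector_derivative
    using x[OF that]
    by (auto intro!: derivative_eq_intros simp: has_vector_derivative_def algebra_simps inner_commute)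
  have cont: "continuous_on {0..t} f"
    by (rule continuous_on_subset[of "{0..T}"]) (use t in \<open>auto intro: DERIV_continuous_on[OF df]\<close>)
  have "f t \<le> f 0"
  proof (rule DERIV_nonpos_imp_decreasing_open[where f = f])
    show "0 \<le> t" using t by simp
    show "\<exists>y. (f has_real_derivative y) (at s) \<and> y \<le> 0" if "0 < s" "s < t" for s
    proof (intro exI conjI)
      have s: "s \<in> {0..T}" using that t by auto
      show "(f has_real_derivative exp (- 2 * K * s) * (- 2 * K * (x s \<bullet> x s) + 2 * (x s \<bullet> x' s))) (at s)"
        using df[OF s] that t by (simp add: at_within_Icc_at)
      have "x s \<bullet> x' s \<le> norm (x s) * norm (x' s)" by (rule norm_cauchy_schwarz)
      also have "\<dots> \<le> norm (x s) * (K * norm (x s))" by (intro mult_left_mono K s) auto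
      finally have "- 2 * K * (x s \<bullet> x s) + 2 * (x s \<bullet> x' s) \<le> 0"
        by (simp add: dot_square_norm power2_eq_square algebra_simps)
      then show "exp (- 2 * K * s) * (- 2 * K * (x s \<bullet> x s) + 2 * (x s \<bullet> x' s)) \<le> 0"
        by (simp add: mult_nonneg_nonpos)
    qed
  qed (rule cont)
  then have "x t \<bullet> x t \<le> 0" using 0 by (simp add: f_def mult_le_0_iff)
  then show ?thesis using inner_gt_zero_iff[of "x t"] by fastforce
qed (simp add: 0)

section \<open>Linear systems on one period, their monodromy matrix and the adjoint system\<close>

locale floquet =
  fixes A :: "real \<Rightarrow> real^'n^'n" and Y :: "real \<Rightarrow> real^'n^'n" and T :: real
  assumes T: "T > 0" and contA: "continuous_on {0..T} A"
    and Y: "\<And>t. t \<in> {0..T} \<Longrightarrow> (Y has_vector_derivative A t ** Y t) (at t within {0..T})"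
    and Y0: "Y 0 = mat 1"
begin

text \<open>The matrix function L is general because the lemma serves both the system with
  \<open>cmat (A t)\<close> and the adjoint one with \<open>- cmat (transpose (A t))\<close>.
  Compactness of the interval bounds L, which gives the constant for Gronwall.\<close>

lemma linear_unique:
  fixes x :: "real \<Rightarrow> complex^'n"
  assumes x: "\<And>t. t \<in> {0..T} \<Longrightarrow> (x has_vector_derivative L t *v x t + k *s x t) (at t within {0..T})"
    and L: "continuous_on {0..T} L" and "x 0 = 0" "t \<in> {0..T}"
  shows "x t = 0"
proof -
  obtain b where b: "b > 0" "\<And>M (x::complex^'n). norm (M *v x :: complex^'n) \<le> norm M * norm x * b"
    using bounded_bilinear.pos_bounded[OF bounded_bilinear_matvec] by blast
  have "compact (L ` {0..T})" using L by (rule compact_continuous_image) simp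
  then obtain a where a: "\<And>t. t \<in> {0..T} \<Longrightarrow> norm (L t) \<le> a"
    by (meson bounded_iff compact_imp_bounded imageI)
  show ?thesis
  proof (rule gronwall_zero[OF x])
    show "norm (L t *v x t + k *s x t) \<le> (a * b + cmod k) * norm (x t)" if "t \<in> {0..T}" for t
    proof -
      have "norm (L t *v x t + k *s x t) \<le> norm (L t) * norm (x t) * b + cmod k * norm (x t)"
        by (rule norm_triangle_le) (simp add: b(2) norm_smult_complex)
      also have "norm (L t) * norm (x t) * b \<le> a * norm (x t) * b"
        using a[OF that] b(1) by (intro mult_right_mono) auto
      finally show ?thesis by (simp add: algebra_simps)
    qed
  qed (use assms in auto)
qed

lemma continuous_cmatA: "continuous_on {0..T} (\<lambda>t. cmat (A t))"
  by (rule bounded_linear.continuous_on[OF bounded_linear_cmat contA])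

lemma continuous_cmatAT: "continuous_on {0..T} (\<lambda>t. - cmat (transpose (A t)))"
  unfolding transpose_def map_matrix_def
  by (intro continuous_intros contA)

lemma fundamental_apply:
  assumes "t \<in> {0..T}"
  shows "((\<lambda>t. cmat (Y t) *v w) has_vector_derivative cmat (A t) *v (cmat (Y t) *v w)) (at t within {0..T})"
proof -
  have bl: "bounded_linear (\<lambda>M. cmat M *v w :: complex^'n)"
    by (rule bounded_linear_compose[OF bounded_bilinear.bounded_linear_left[OF bounded_bilinear_matvec] bounded_linear_cmat])
  have "cmat (A t ** Y t) *v w = cmat (A t) *v (cmat (Y t) *v w)"
    unfolding matrix_vector_mul_assoc
    by (rule arg_cong[where f = "\<lambda>M. M *v w"]) (simp add: vec_eq_iff matrix_matrix_mult_def)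
  then show ?thesis
    using bounded_linear.has_vector_derivative[OF bl Y[OF assms]] by simp
qed

text \<open>The factor exp (k t) removes the term with k: exp (k t) x(t) and Y(t) x(0) solve the
  same system with the same initial value.\<close>

lemma homogeneous_solution:
  assumes x: "solves T (\<lambda>t d x. d - cmat (A t) *v x + k *s x) x" and t: "t \<in> {0..T}"
  shows "x t = exp (- k * t) *s (cmat (Y t) *v x 0)"
proof -
  define w where "w t = exp (k * complex_of_real t) *s x t - cmat (Y t) *v x 0" for t :: real
  have "w t = 0"
  proof (rule linear_unique[where k = 0, OF _ continuous_cmatA])
    show "w 0 = 0"
      by (simp add: w_def Y0 vec_eq_iff matrix_vector_mult_def mat_def if_distrib[of "\<lambda>a. complex_of_real a * _"] cong: if_cong)
    fix t assume t: "t \<in> {0..T}"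
    obtain d where d: "(x has_vector_derivative d) (at t within {0..T})" "d - cmat (A t) *v x t + k *s x t = 0"
      using x t unfolding solves_def by blast
    have e: "((\<lambda>t. exp (k * complex_of_real t)) has_vector_derivative k * exp (k * complex_of_real t)) (at t within {0..T})"
      by (rule has_vector_derivative_real_field)
        (auto intro!: derivative_eq_intros)
    have "(w has_vector_derivative (exp (k * complex_of_real t) *s d + (k * exp (k * complex_of_real t)) *s x t)
        - cmat (A t) *v (cmat (Y t) *v x 0)) (at t within {0..T})"
      unfolding w_def
      by (intro has_vector_derivative_diff fundamental_apply t
          bounded_bilinear.has_vector_derivative[OF bounded_bilinear_smult e d(1)])
    moreover have "d = cmat (A t) *v x t - k *s x t" using d(2) by (simp add: algebra_simps)
    ultimately show "(w has_vector_derivative cmat (A t) *v w t + 0 *s w t) (at t within {0..T})"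
      by (simp add: w_def matrix_vector_mult_diff_distrib vector_scalar_commute vec.scale_right_diff_distrib mult.commute)
  qed (rule t)
  then have "exp (k * t) *s x t = cmat (Y t) *v x 0" by (simp add: w_def)
  then have "exp (- k * t) *s (cmat (Y t) *v x 0) = (exp (- k * t) * exp (k * t)) *s x t"
    by (metis vec.scale_scale)
  then show ?thesis by (simp add: exp_minus)
qed

text \<open>The solution formula at t = T together with x(T) = x(0). This is the dictionary between
  an exponent k in the differential equation and the multiplier exp (k T).\<close>

lemma periodic_eigenvector:
  assumes x: "solves T (\<lambda>t d x. d - cmat (A t) *v x + k *s x) x"
  shows "cmat (Y T) *v x 0 = exp (k * T) *s x 0"
proof -
  have "x T = exp (- k * T) *s (cmat (Y T) *v x 0)"
    using homogeneous_solution[OF x, of T] T by simp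
  moreover have "x T = x 0" using x by (simp add: solves_def)
  ultimately have "exp (k * T) *s x 0 = (exp (k * T) * exp (- k * T)) *s (cmat (Y T) *v x 0)"
    by (metis vec.scale_scale)
  then show ?thesis by (simp add: exp_minus)
qed

lemma periodic_zero:
  assumes x: "solves T (\<lambda>t d x. d - cmat (A t) *v x + k *s x) x"
    and "\<not> eigenvalue_of (cmat (Y T)) (exp (k * T))" and t: "t \<in> {0..T}"
  shows "x t = 0"
proof -
  have "x 0 = 0" using periodic_eigenvector[OF x] assms(2) by (auto simp: eigenvalue_of_def)
  then show ?thesis using homogeneous_solution[OF x t] by simp
qed

text \<open>Both initial values lie in the eigenspace of exp (k T), which is a line because the root
  is simple; the solution formula carries the factor over to all t.\<close>

lemma periodic_proportional:
  assumes x: "solves T (\<lambda>t d x. d - cmat (A t) *v x + k *s x) x"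
    and y: "solves T (\<lambda>t d x. d - cmat (A t) *v x + k *s x) y"
    and "order (exp (k * T)) (charpoly (cmat (Y T))) = 1" and "y 0 \<noteq> 0"
  shows "\<exists>\<kappa>. \<forall>t\<in>{0..T}. x t = \<kappa> *s y t"
proof -
  obtain \<kappa> where \<kappa>: "x 0 = \<kappa> *s y 0"
    using eigenvectors_proportional[OF assms(3) periodic_eigenvector[OF x] periodic_eigenvector[OF y] assms(4)]
    by blast
  have "x t = \<kappa> *s y t" if "t \<in> {0..T}" for t
    unfolding homogeneous_solution[OF x that] homogeneous_solution[OF y that] \<kappa>
    by (simp add: vector_scalar_commute vec.scale_left_commute)
  then show ?thesis by blast
qed

text \<open>The terms with A cancel by transposition, and the terms with \<i> \<nu> cancel because
  \<nu> is real and the pairing is conjugate-linear in its first argument. Only the inhomogeneity r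
  survives.\<close>

lemma herm_adjoint_derivative:
  assumes z: "solves T (\<lambda>t d z. d + cmat (transpose (A t)) *v z + (\<i> * complex_of_real \<nu>) *s z) z"
    and x: "(x has_vector_derivative d) (at t within {0..T})"
    and r: "d - cmat (A t) *v x t + (\<i> * complex_of_real \<nu>) *s x t = r" and t: "t \<in> {0..T}"
  shows "((\<lambda>t. \<langle>z t, x t\<rangle>) has_vector_derivative \<langle>z t, r\<rangle>) (at t within {0..T})"
proof -
  obtain z' where z': "(z has_vector_derivative z') (at t within {0..T})"
    "z' + cmat (transpose (A t)) *v z t + (\<i> * complex_of_real \<nu>) *s z t = 0"
    using z t unfolding solves_def by blast
  have z'_eq: "z' = - (cmat (transpose (A t)) *v z t) - (\<i> * complex_of_real \<nu>) *s z t"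
    using z'(2) by (simp add: algebra_simps eq_neg_iff_add_eq_0)
  have d: "d = r + cmat (A t) *v x t - (\<i> * complex_of_real \<nu>) *s x t"
    using r by (simp add: algebra_simps)
  have "((\<lambda>t. \<langle>z t, x t\<rangle>) has_vector_derivative \<langle>z t, d\<rangle> + \<langle>z', x t\<rangle>) (at t within {0..T})"
    by (rule bounded_bilinear.has_vector_derivative[OF bounded_bilinear_herm z'(1) x])
  also have "\<langle>z t, d\<rangle> + \<langle>z', x t\<rangle> = \<langle>z t, r\<rangle>"
    unfolding d z'_eq
    by (simp add: herm_add_right herm_diff_right herm_diff_left herm_minus_left herm_smult_right
        herm_smult_left herm_matvec)
  finally show ?thesis .
qed

text \<open>Integrate the derivative of the pairing of z and x; the boundary values agree by
  periodicity. The form \<open>has_integral\<close> also records that r is integrable against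
  z.\<close>

lemma fredholm:
  assumes z: "solves T (\<lambda>t d z. d + cmat (transpose (A t)) *v z + (\<i> * complex_of_real \<nu>) *s z) z"
    and x: "solves T (\<lambda>t d x. d - cmat (A t) *v x + (\<i> * complex_of_real \<nu>) *s x - r t) x"
  shows "((\<lambda>t. \<langle>z t, r t\<rangle>) has_integral 0) {0..T}"
proof -
  have "((\<lambda>t. \<langle>z t, r t\<rangle>) has_integral \<langle>z T, x T\<rangle> - \<langle>z 0, x 0\<rangle>) {0..T}"
  proof (rule fundamental_theorem_of_calculus)
    fix t assume t: "t \<in> {0..T}"
    obtain d where "(x has_vector_derivative d) (at t within {0..T})"
      "d - cmat (A t) *v x t + (\<i> * complex_of_real \<nu>) *s x t - r t = 0"
      using x t unfolding solves_def by blast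
    then show "((\<lambda>t. \<langle>z t, x t\<rangle>) has_vector_derivative \<langle>z t, r t\<rangle>) (at t within {0..T})"
      by (intro herm_adjoint_derivative[OF z _ _ t]) auto
  qed (use T in simp)
  then show ?thesis using z x by (simp add: solves_def)
qed

text \<open>The pairing of z with every solution exp (- \<i> \<nu> t) Y(t) w is constant in t.
  Comparing t = 0 with t = T shows that the conjugate of z(0) is a left eigenvector of the monodromy
  matrix.\<close>

lemma adjoint_eigenvector:
  assumes z: "solves T (\<lambda>t d z. d + cmat (transpose (A t)) *v z + (\<i> * complex_of_real \<nu>) *s z) z"
  shows "transpose (cmat (Y T)) *v vcnj (z 0) = exp (\<i> * \<nu> * T) *s vcnj (z 0)"
proof -
  have "\<langle>z 0, cmat (Y T) *v w\<rangle> = exp (\<i> * \<nu> * T) * \<langle>z 0, w\<rangle>" for w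
  proof -
    define x where "x t = exp (- (\<i> * \<nu>) * complex_of_real t) *s (cmat (Y t) *v w)" for t :: real
    have "((\<lambda>t. \<langle>z t, x t\<rangle>) has_vector_derivative \<langle>z t, 0\<rangle>) (at t within {0..T})" if t: "t \<in> {0..T}" for t
    proof (rule herm_adjoint_derivative[OF z _ _ t])
      have e: "((\<lambda>t. exp (- (\<i> * \<nu>) * complex_of_real t)) has_vector_derivative
         - (\<i> * \<nu>) * exp (- (\<i> * \<nu>) * complex_of_real t)) (at t within {0..T})"
        by (rule has_vector_derivative_real_field) (auto intro!: derivative_eq_intros)
      show "(x has_vector_derivative exp (- (\<i> * \<nu>) * complex_of_real t) *s (cmat (A t) *v (cmat (Y t) *v w))
         + (- (\<i> * \<nu>) * exp (- (\<i> * \<nu>) * complex_of_real t)) *s (cmat (Y t) *v w)) (at t within {0..T})"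
        unfolding x_def
        by (rule bounded_bilinear.has_vector_derivative[OF bounded_bilinear_smult e fundamental_apply[OF t]])
    qed (simp add: x_def vector_scalar_commute vec.scale_minus_left)
    then have "((\<lambda>t. \<langle>z t, 0\<rangle>) has_integral \<langle>z T, x T\<rangle> - \<langle>z 0, x 0\<rangle>) {0..T}"
      using T by (intro fundamental_theorem_of_calculus) auto
    then have "\<langle>z T, x T\<rangle> = \<langle>z 0, x 0\<rangle>"
      using has_integral_unique has_integral_0 by (fastforce simp: herm_zero_right)
    moreover have "z T = z 0" using z by (simp add: solves_def)
    moreover have "cmat (Y 0) *v w = w"
      by (simp add: Y0) (simp add: vec_eq_iff matrix_vector_mult_def mat_def if_distrib[of "\<lambda>a. complex_of_real a * _"] cong: if_cong)
    ultimately have "exp (- (\<i> * \<nu>) * T) * \<langle>z 0, cmat (Y T) *v w\<rangle> = \<langle>z 0, w\<rangle>"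
      by (simp add: x_def herm_smult_right)
    then have "exp (\<i> * \<nu> * T) * \<langle>z 0, w\<rangle> = (exp (\<i> * \<nu> * T) * exp (- (\<i> * \<nu>) * T)) * \<langle>z 0, cmat (Y T) *v w\<rangle>"
      by (simp add: mult.assoc)
    then show ?thesis by (simp add: exp_minus)
  qed
  \<comment> \<open>Taking axis vectors for w turns the identity of pairings into one of
    components.\<close>
  then have "cnj ((cmat (transpose (Y T)) *v z 0) $ j) = exp (\<i> * \<nu> * T) * cnj (z 0 $ j)" for j
    by (metis herm_axis herm_matvec)
  then show ?thesis
    by (simp add: vec_eq_iff vcnj_def matrix_vector_mult_def transpose_def)
qed

lemma adjoint_zero:
  assumes z: "solves T (\<lambda>t d z. d + cmat (transpose (A t)) *v z + k *s z) z" and "z 0 = 0" "t \<in> {0..T}"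
  shows "z t = 0"
proof (rule linear_unique[where k = "- k", OF _ continuous_cmatAT])
  fix t assume t: "t \<in> {0..T}"
  obtain d where d: "(z has_vector_derivative d) (at t within {0..T})"
    "d + cmat (transpose (A t)) *v z t + k *s z t = 0"
    using z t unfolding solves_def by blast
  have "d = - (cmat (transpose (A t)) *v z t) + (- k) *s z t"
    using d(2) unfolding eq_neg_iff_add_eq_0[symmetric] by (simp add: vec.scale_minus_left add.assoc algebra_simps eq_neg_iff_add_eq_0 eq_diff_eq)
  also have "- (cmat (transpose (A t)) *v z t) = - cmat (transpose (A t)) *v z t"
    by (simp add: vec_eq_iff matrix_vector_mult_def sum_negf)
  finally have "d = - cmat (transpose (A t)) *v z t + (- k) *s z t" .
  with d(1) show "(z has_vector_derivative - cmat (transpose (A t)) *v z t + (- k) *s z t) (at t within {0..T})"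
    by simp
qed (use assms in auto)

text \<open>A left eigenvector is an eigenvector of the transpose, which has the same characteristic
  polynomial, so simplicity of the multiplier applies again. This is what lets a normalization
  integral fix the adjoint functions.\<close>

lemma adjoint_proportional:
  assumes z: "solves T (\<lambda>t d z. d + cmat (transpose (A t)) *v z + (\<i> * complex_of_real \<nu>) *s z) z"
    and w: "solves T (\<lambda>t d z. d + cmat (transpose (A t)) *v z + (\<i> * complex_of_real \<nu>) *s z) w"
    and "order (exp (\<i> * \<nu> * T)) (charpoly (cmat (Y T))) = 1" and "w 0 \<noteq> 0"
  shows "\<exists>\<kappa>. \<forall>t\<in>{0..T}. z t = \<kappa> *s w t"
proof -
  have "vcnj (w 0) \<noteq> 0" using assms(4) by (metis vcnj_vcnj vcnj_simps(3))
  then obtain \<kappa> where "vcnj (z 0) = \<kappa> *s vcnj (w 0)"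
    using eigenvectors_proportional[OF _ adjoint_eigenvector[OF z] adjoint_eigenvector[OF w]] assms(3)
    by (auto simp: charpoly_transpose)
  then have \<kappa>: "z 0 = cnj \<kappa> *s w 0" by (metis vcnj_smult vcnj_vcnj)
  have "z t - cnj \<kappa> *s w t = 0" if "t \<in> {0..T}" for t
  proof (rule adjoint_zero[OF _ _ that])
    show "solves T (\<lambda>t d z. d + cmat (transpose (A t)) *v z + (\<i> * complex_of_real \<nu>) *s z) (\<lambda>t. z t - cnj \<kappa> *s w t)"
      unfolding solves_def
    proof (intro conjI ballI)
      fix t assume t: "t \<in> {0..T}"
      obtain d where d: "(z has_vector_derivative d) (at t within {0..T})"
        "d + cmat (transpose (A t)) *v z t + (\<i> * complex_of_real \<nu>) *s z t = 0"
        using z t unfolding solves_def by blast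
      obtain e where e: "(w has_vector_derivative e) (at t within {0..T})"
        "e + cmat (transpose (A t)) *v w t + (\<i> * complex_of_real \<nu>) *s w t = 0"
        using w t unfolding solves_def by blast
      have "((\<lambda>t. z t - cnj \<kappa> *s w t) has_vector_derivative d - cnj \<kappa> *s e) (at t within {0..T})"
        by (intro has_vector_derivative_diff d(1)
            bounded_linear.has_vector_derivative[OF bounded_bilinear.bounded_linear_right[OF bounded_bilinear_smult] e(1)])
      moreover have "d - cnj \<kappa> *s e + cmat (transpose (A t)) *v (z t - cnj \<kappa> *s w t)
          + (\<i> * complex_of_real \<nu>) *s (z t - cnj \<kappa> *s w t)
        = (d + cmat (transpose (A t)) *v z t + (\<i> * complex_of_real \<nu>) *s z t)
          - cnj \<kappa> *s (e + cmat (transpose (A t)) *v w t + (\<i> * complex_of_real \<nu>) *s w t)"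
        by (simp add: matrix_vector_mult_diff_distrib vector_scalar_commute vec.scale_right_diff_distrib
            vec.scale_right_distrib vec.scale_left_commute)
      ultimately show "\<exists>d. ((\<lambda>t. z t - cnj \<kappa> *s w t) has_vector_derivative d) (at t within {0..T}) \<and>
         d + cmat (transpose (A t)) *v (z t - cnj \<kappa> *s w t) + (\<i> * complex_of_real \<nu>) *s (z t - cnj \<kappa> *s w t) = 0"
        unfolding d(2) e(2) by (intro exI conjI) auto
    qed (use z w in \<open>simp add: solves_def\<close>)
  qed (simp add: \<kappa>)
  then show ?thesis by (intro exI[of _ "cnj \<kappa>"]) simp
qed

end

section \<open>Higher derivatives as symmetric multilinear forms\<close>

lemma Ck_on_continuous: "Ck_on k f S \<Longrightarrow> continuous_on S f"
  by (cases k) (auto intro!: continuous_at_imp_continuous_on differentiable_imp_continuous_within)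

lemma Ck_on_SucD: "Ck_on (Suc k) f S \<Longrightarrow> Ck_on k f S"
proof (induction k arbitrary: f)
  case 0
  then show ?case using Ck_on_continuous[of "Suc 0" f S] by simp
next
  case (Suc k)
  then show ?case unfolding Ck_on.simps(2)[of "Suc k"] Ck_on.simps(2)[of k] by blast
qed

lemma Ck_on_le: "Ck_on m f S \<Longrightarrow> k \<le> m \<Longrightarrow> Ck_on k f S"
  by (induction m) (auto simp: le_Suc_eq dest: Ck_on_SucD simp del: Ck_on.simps)

text \<open>Openness of S lets agreement on S pass to the derivatives at its points.\<close>

lemma Ck_on_cong:
  assumes "open S" "\<And>x. x \<in> S \<Longrightarrow> f x = g x" "Ck_on k f S"
  shows "Ck_on k g S"
  using assms(2,3)
proof (induction k arbitrary: f g)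
  case 0
  then show ?case using continuous_on_cong[of S S f g] by simp
next
  case (Suc k)
  have d: "f differentiable at x" if "x \<in> S" for x using Suc.prems(2) that by simp
  have "g differentiable at x" if "x \<in> S" for x
    using d[OF that] has_derivative_transform_within_open[where f = f and g = g, OF _ assms(1) that Suc.prems(1)]
    unfolding differentiable_def by blast
  moreover have "frechet_derivative f (at x) w = frechet_derivative g (at x) w" if "x \<in> S" for x w
    using frechet_derivative_transform_within_open[OF d[OF that] assms(1) that Suc.prems(1)] by simp
  then have "Ck_on k (\<lambda>x. frechet_derivative g (at x) w) S" for w
    using Suc.IH[of "\<lambda>x. frechet_derivative f (at x) w" "\<lambda>x. frechet_derivative g (at x) w"] Suc.prems(2)
    by simp
  ultimately show ?case by simp
qed

text \<open>The derivative of the composite in direction w is L applied to the derivative of f in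
  direction M w, again a map of the same shape, so the induction closes. Used for the substitution
  of \<gamma> \<xi> for \<xi>.\<close>

lemma Ck_on_linear_compose:
  assumes "open S" and L: "bounded_linear L" and M: "bounded_linear M" and f: "Ck_on k f S"
  shows "Ck_on k (\<lambda>x. L (f (M x))) (M -` S)"
  using f
proof (induction k arbitrary: f)
  case 0
  then show ?case
    by (auto intro!: bounded_linear.continuous_on[OF L] continuous_on_compose2[of S f]
        linear_continuous_on[OF M])
next
  case (Suc k)
  have op: "open (M -` S)"
    using assms(1) by (simp add: linear_continuous_on[OF M] open_vimage)
  have d: "((\<lambda>x. L (f (M x))) has_derivative (\<lambda>w. L (frechet_derivative f (at (M x)) (M w)))) (at x)"
    if "M x \<in> S" for x
  proof -
    have "(f has_derivative frechet_derivative f (at (M x))) (at (M x))"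
      using Suc.prems that frechet_derivative_works by auto
    then have "((\<lambda>x. f (M x)) has_derivative (\<lambda>w. frechet_derivative f (at (M x)) (M w))) (at x)"
      using diff_chain_at[OF bounded_linear_imp_has_derivative[OF M]] unfolding o_def by blast
    then show ?thesis by (rule bounded_linear.has_derivative[OF L])
  qed
  have "Ck_on k (\<lambda>x. frechet_derivative (\<lambda>x. L (f (M x))) (at x) w) (M -` S)" for w
  proof (rule Ck_on_cong[OF op])
    show "Ck_on k (\<lambda>x. L (frechet_derivative f (at (M x)) (M w))) (M -` S)"
      using Suc.IH[of "\<lambda>x. frechet_derivative f (at x) (M w)"] Suc.prems by simp
    show "L (frechet_derivative f (at (M x)) (M w)) = frechet_derivative (\<lambda>x. L (f (M x))) (at x) w"
      if "x \<in> M -` S" for x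
      using fun_cong[OF frechet_derivative_at[OF d[of x]], of w] that by simp
  qed
  moreover have "(\<lambda>x. L (f (M x))) differentiable at x" if "x \<in> M -` S" for x
    using d[of x] that unfolding differentiable_def by blast
  ultimately show ?case by simp
qed

section \<open>Symmetry of second derivatives\<close>

lemma line_has_vector_derivative:
  assumes "f differentiable at (y + s *\<^sub>R a)"
  shows "((\<lambda>s. f (y + s *\<^sub>R a)) has_vector_derivative frechet_derivative f (at (y + s *\<^sub>R a)) a) (at s within X)"
proof -
  have "((\<lambda>s. y + s *\<^sub>R a) has_derivative (\<lambda>h. h *\<^sub>R a)) (at s)"
    by (auto intro!: derivative_eq_intros)
  then have "((\<lambda>s. f (y + s *\<^sub>R a)) has_derivative (\<lambda>h. frechet_derivative f (at (y + s *\<^sub>R a)) (h *\<^sub>R a))) (at s)"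
    using diff_chain_at assms frechet_derivative_works unfolding o_def by blast
  then show ?thesis
    unfolding has_vector_derivative_def
    using linear_frechet_derivative[OF assms] by (auto simp: linear_scale intro: has_derivative_at_withinI)
qed

lemma frechet_derivative_inner:
  assumes "f differentiable at y"
  shows "frechet_derivative (\<lambda>y. f y \<bullet> i) (at y) w = frechet_derivative f (at y) w \<bullet> i"
proof -
  have d: "((\<lambda>y. f y \<bullet> i) has_derivative (\<lambda>w. frechet_derivative f (at y) w \<bullet> i)) (at y)"
    by (rule has_derivative_inner_left) (use assms frechet_derivative_works in blast)
  show ?thesis by (rule fun_cong[OF frechet_derivative_at[OF d], symmetric])
qed

text \<open>The mean value theorem is applied twice: in direction a to the increment in direction b,
  then in direction b to the derivative along a.\<close>

lemma second_difference:
  fixes \<phi> :: "'a::real_normed_vector \<Rightarrow> real"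
  assumes 1: "\<And>y. \<phi> differentiable at y"
    and 2: "\<And>y. (\<lambda>y. frechet_derivative \<phi> (at y) a) differentiable at y" and "h > 0"
  shows "\<exists>s t. 0 < s \<and> s < h \<and> 0 < t \<and> t < h \<and>
    \<phi> (x + h *\<^sub>R a + h *\<^sub>R b) - \<phi> (x + h *\<^sub>R a) - \<phi> (x + h *\<^sub>R b) + \<phi> x
     = h\<^sup>2 * frechet_derivative (\<lambda>y. frechet_derivative \<phi> (at y) a) (at (x + s *\<^sub>R a + t *\<^sub>R b)) b"
proof -
  define \<psi> where "\<psi> s = \<phi> (x + h *\<^sub>R b + s *\<^sub>R a) - \<phi> (x + s *\<^sub>R a)" for s
  have "(\<psi> has_real_derivative frechet_derivative \<phi> (at (x + h *\<^sub>R b + s *\<^sub>R a)) a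
      - frechet_derivative \<phi> (at (x + s *\<^sub>R a)) a) (at s)" for s
    unfolding \<psi>_def has_real_derivative_iff_has_vector_derivative
    by (intro has_vector_derivative_diff line_has_vector_derivative 1)
  from MVT2[of 0 h \<psi>, OF \<open>h > 0\<close> this] obtain s where s: "0 < s" "s < h" and
    d\<psi>: "\<psi> h - \<psi> 0 = h * (frechet_derivative \<phi> (at (x + h *\<^sub>R b + s *\<^sub>R a)) a
      - frechet_derivative \<phi> (at (x + s *\<^sub>R a)) a)"
    by auto
  define \<psi>' where psi'_def: "\<psi>' t = frechet_derivative \<phi> (at (x + s *\<^sub>R a + t *\<^sub>R b)) a" for t
  have "(\<psi>' has_real_derivative
      frechet_derivative (\<lambda>y. frechet_derivative \<phi> (at y) a) (at (x + s *\<^sub>R a + t *\<^sub>R b)) b) (at t)" for t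
    unfolding psi'_def has_real_derivative_iff_has_vector_derivative
    by (rule line_has_vector_derivative[where f = "\<lambda>y. frechet_derivative \<phi> (at y) a", OF 2])
  from MVT2[of 0 h \<psi>', OF \<open>h > 0\<close> this] obtain t where t: "0 < t" "t < h" and
    d\<psi>': "\<psi>' h - \<psi>' 0 = h * frechet_derivative (\<lambda>y. frechet_derivative \<phi> (at y) a) (at (x + s *\<^sub>R a + t *\<^sub>R b)) b"
    by auto
  have "\<psi> h - \<psi> 0 = h * (\<psi>' h - \<psi>' 0)"
    unfolding d\<psi> psi'_def by (simp add: add_ac)
  then have "\<psi> h - \<psi> 0 = h\<^sup>2 * frechet_derivative (\<lambda>y. frechet_derivative \<phi> (at y) a) (at (x + s *\<^sub>R a + t *\<^sub>R b)) b"
    unfolding d\<psi>' by (simp add: power2_eq_square)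
  then show ?thesis
    using s t by (intro exI[of _ s] exI[of _ t]) (simp add: \<psi>_def add_ac)
qed

text \<open>The second difference does not change when a and b are exchanged, and divided by h^2 it
  tends to either mixed derivative by continuity. Components \<open>f y \<bullet> i\<close> are used
  because the mean value theorem needs real values.\<close>

lemma frechet_derivative_symmetric:
  fixes f :: "'a::euclidean_space \<Rightarrow> 'b::euclidean_space"
  assumes f: "Ck_on 2 f UNIV"
  shows "frechet_derivative (\<lambda>y. frechet_derivative f (at y) a) (at x) b
       = frechet_derivative (\<lambda>y. frechet_derivative f (at y) b) (at x) a"
proof (rule euclidean_eqI)
  fix i :: 'b
  define \<phi> where "\<phi> y = f y \<bullet> i" for y
  have f1: "f differentiable at y" for y using f by (simp add: numeral_2_eq_2)
  have f2: "(\<lambda>y. frechet_derivative f (at y) w) differentiable at y" for w y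
    using f by (simp add: numeral_2_eq_2)
  have f3: "continuous_on UNIV (\<lambda>y. frechet_derivative (\<lambda>y. frechet_derivative f (at y) w) (at y) w')" for w w'
    using f by (simp add: numeral_2_eq_2)
  have \<phi>1: "\<phi> differentiable at y" for y
    unfolding \<phi>_def using f1[of y] unfolding differentiable_def by (blast intro: has_derivative_inner_left)
  have d\<phi>: "frechet_derivative \<phi> (at y) w = frechet_derivative f (at y) w \<bullet> i" for y w
    unfolding \<phi>_def by (rule frechet_derivative_inner[OF f1])
  have \<phi>2: "(\<lambda>y. frechet_derivative \<phi> (at y) w) differentiable at y" for w y
    using f2[of w y] unfolding d\<phi> differentiable_def by (elim exE) (rule exI, rule has_derivative_inner_left)
  define D where "D w w' y = frechet_derivative (\<lambda>y. frechet_derivative f (at y) w) (at y) w' \<bullet> i" for w w' y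
  have dd\<phi>: "frechet_derivative (\<lambda>y. frechet_derivative \<phi> (at y) w) (at y) w' = D w w' y" for w w' y
    unfolding d\<phi> D_def by (rule frechet_derivative_inner[OF f2])
  have contD: "continuous_on UNIV (D w w')" for w w'
    unfolding D_def by (intro continuous_intros f3)
  \<comment> \<open>Choosing the intermediate points once for each h makes them functions of h, for
    which limits at 0 can be taken.\<close>
  define P where "P w w' h = (SOME p. 0 < fst p \<and> fst p < h \<and> 0 < snd p \<and> snd p < h \<and>
    \<phi> (x + h *\<^sub>R w + h *\<^sub>R w') - \<phi> (x + h *\<^sub>R w) - \<phi> (x + h *\<^sub>R w') + \<phi> x
     = h\<^sup>2 * D w w' (x + fst p *\<^sub>R w + snd p *\<^sub>R w'))" for w w' h
  have P: "0 < fst (P w w' h) \<and> fst (P w w' h) < h \<and> 0 < snd (P w w' h) \<and> snd (P w w' h) < h \<and>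
    \<phi> (x + h *\<^sub>R w + h *\<^sub>R w') - \<phi> (x + h *\<^sub>R w) - \<phi> (x + h *\<^sub>R w') + \<phi> x
     = h\<^sup>2 * D w w' (x + fst (P w w' h) *\<^sub>R w + snd (P w w' h) *\<^sub>R w')" if "h > 0" for w w' h
    unfolding P_def
    by (rule someI_ex) (use second_difference[OF \<phi>1 \<phi>2 that, of x w w'] in \<open>auto simp: dd\<phi>\<close>)
  have tend: "((\<lambda>h. D w w' (x + fst (P w w' h) *\<^sub>R w + snd (P w w' h) *\<^sub>R w')) \<longlongrightarrow> D w w' x) (at_right 0)" for w w'
  proof -
    have ev: "\<forall>\<^sub>F h in at_right (0::real). h > 0" by (simp add: eventually_at_right_less)
    have "((\<lambda>h. fst (P w w' h)) \<longlongrightarrow> 0) (at_right 0)"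
      by (rule tendsto_sandwich[where f = "\<lambda>_. 0" and h = "\<lambda>h. h"])
        (use P in \<open>auto intro!: eventually_mono[OF ev] tendsto_eq_intros less_imp_le\<close>)
    moreover have "((\<lambda>h. snd (P w w' h)) \<longlongrightarrow> 0) (at_right 0)"
      by (rule tendsto_sandwich[where f = "\<lambda>_. 0" and h = "\<lambda>h. h"])
        (use P in \<open>auto intro!: eventually_mono[OF ev] tendsto_eq_intros less_imp_le\<close>)
    ultimately have "((\<lambda>h. x + fst (P w w' h) *\<^sub>R w + snd (P w w' h) *\<^sub>R w') \<longlongrightarrow> x + 0 *\<^sub>R w + 0 *\<^sub>R w') (at_right 0)"
      by (intro tendsto_intros)
    then show ?thesis
      using contD[of w w'] by (intro isCont_tendsto_compose[of x "D w w'"])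
        (auto simp: continuous_on_eq_continuous_at)
  qed
  have "\<forall>\<^sub>F h in at_right (0::real). D a b (x + fst (P a b h) *\<^sub>R a + snd (P a b h) *\<^sub>R b)
      = D b a (x + fst (P b a h) *\<^sub>R b + snd (P b a h) *\<^sub>R a)"
    using eventually_at_right_less[of "0::real"]
  proof eventually_elim
    case (elim h)
    have "h\<^sup>2 * D a b (x + fst (P a b h) *\<^sub>R a + snd (P a b h) *\<^sub>R b)
      = h\<^sup>2 * D b a (x + fst (P b a h) *\<^sub>R b + snd (P b a h) *\<^sub>R a)"
      using P[OF elim, of a b] P[OF elim, of b a] by (simp add: algebra_simps del: mult_cancel_left)
    then show ?case using elim by simp
  qed
  then have "((\<lambda>h. D b a (x + fst (P b a h) *\<^sub>R b + snd (P b a h) *\<^sub>R a)) \<longlongrightarrow> D a b x) (at_right 0)"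
    by (rule Lim_transform_eventually[OF tend])
  then have "D a b x = D b a x"
    using tendsto_unique[OF trivial_limit_at_right_real _ tend] by blast
  then show "frechet_derivative (\<lambda>y. frechet_derivative f (at y) a) (at x) b \<bullet> i
       = frechet_derivative (\<lambda>y. frechet_derivative f (at y) b) (at x) a \<bullet> i"
    by (simp add: D_def)
qed

section \<open>Multilinear forms on lists and their complex extension\<close>

definition mlinear :: "nat \<Rightarrow> ('a::real_vector list \<Rightarrow> 'b::real_vector) \<Rightarrow> bool" where
  "mlinear n M \<longleftrightarrow> (\<forall>pre ws. length pre + Suc (length ws) = n \<longrightarrow> linear (\<lambda>w. M (pre @ w # ws)))"

text \<open>Exchanging neighbours generates all permutations and fits the recursion over argument
  lists.\<close>

definition msym :: "nat \<Rightarrow> ('a list \<Rightarrow> 'b) \<Rightarrow> bool" where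
  "msym n M \<longleftrightarrow> (\<forall>pre a b ws. length pre + Suc (Suc (length ws)) = n \<longrightarrow>
     M (pre @ a # b # ws) = M (pre @ b # a # ws))"

text \<open>Homogeneity is spelled out for complex scalars, since \<open>linear\<close> refers to
  real ones.\<close>

definition clinear_form :: "nat \<Rightarrow> ((complex^'n) list \<Rightarrow> complex^'m) \<Rightarrow> bool" where
  "clinear_form n N \<longleftrightarrow> (\<forall>pre ws. length pre + Suc (length ws) = n \<longrightarrow>
     (\<forall>w w'. N (pre @ (w + w') # ws) = N (pre @ w # ws) + N (pre @ w' # ws)) \<and>
     (\<forall>c w. N (pre @ (c *s w) # ws) = c *s N (pre @ w # ws)))"

lemma mlinear_Cons:
  assumes "mlinear (Suc n) M"
  shows "mlinear n (\<lambda>xs. M (w # xs))"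
  unfolding mlinear_def
proof (intro allI impI)
  fix pre ws :: "'a list" assume "length pre + Suc (length ws) = n"
  then show "linear (\<lambda>v. M (w # pre @ v # ws))"
    using assms[unfolded mlinear_def, rule_format, of "w # pre" ws] by simp
qed

lemma msym_Cons:
  assumes "msym (Suc n) M"
  shows "msym n (\<lambda>xs. M (w # xs))"
  unfolding msym_def
proof (intro allI impI)
  fix pre ws :: "'a list" and a b assume "length pre + Suc (Suc (length ws)) = n"
  then show "M (w # pre @ a # b # ws) = M (w # pre @ b # a # ws)"
    using assms[unfolded msym_def, rule_format, of "w # pre" ws a b] by simp
qed

lemma mlinear_Cons_linear: "mlinear (Suc n) M \<Longrightarrow> length xs = n \<Longrightarrow> linear (\<lambda>w. M (w # xs))"
  unfolding mlinear_def by (drule spec[of _ "[]"]) simp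

lemma cmultilinear_cong:
  "(\<And>xs. length xs = length ws \<Longrightarrow> M xs = N xs) \<Longrightarrow> cmultilinear M ws = cmultilinear N ws"
proof (induction ws arbitrary: M N)
  case (Cons w ws)
  show ?case
    using Cons.IH[of "\<lambda>xs. M (vRe w # xs)" "\<lambda>xs. N (vRe w # xs)"]
      Cons.IH[of "\<lambda>xs. M (vIm w # xs)" "\<lambda>xs. N (vIm w # xs)"] Cons.prems by simp
qed simp

lemma cmultilinear_add: "cmultilinear (\<lambda>xs. M xs + N xs) ws = cmultilinear M ws + cmultilinear N ws"
  by (induction ws arbitrary: M N) (auto simp: cvec_simps vec.scale_right_distrib algebra_simps)

lemma cmultilinear_scale: "cmultilinear (\<lambda>xs. r *\<^sub>R M xs) ws = complex_of_real r *s cmultilinear M ws"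
  by (induction ws arbitrary: M)
    (auto simp: cvec_simps scaleR_eq_smult vec.scale_right_distrib mult.commute)

lemma cmultilinear_zero: "cmultilinear (\<lambda>xs. 0) ws = 0"
  by (induction ws) (auto simp: cvec_simps)

lemma linear_cmultilinear_Cons:
  assumes "mlinear (Suc (length ws)) M"
  shows "cmultilinear (\<lambda>xs. M ((a + b) # xs)) ws
      = cmultilinear (\<lambda>xs. M (a # xs)) ws + cmultilinear (\<lambda>xs. M (b # xs)) ws"
    and "cmultilinear (\<lambda>xs. M (r *\<^sub>R a # xs)) ws = complex_of_real r *s cmultilinear (\<lambda>xs. M (a # xs)) ws"
proof -
  have lin: "linear (\<lambda>w. M (w # xs))" if "length xs = length ws" for xs
    by (rule mlinear_Cons_linear[OF assms that])
  show "cmultilinear (\<lambda>xs. M ((a + b) # xs)) ws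
      = cmultilinear (\<lambda>xs. M (a # xs)) ws + cmultilinear (\<lambda>xs. M (b # xs)) ws"
    unfolding cmultilinear_add[symmetric] by (rule cmultilinear_cong) (rule linear_add[OF lin])
  show "cmultilinear (\<lambda>xs. M (r *\<^sub>R a # xs)) ws = complex_of_real r *s cmultilinear (\<lambda>xs. M (a # xs)) ws"
    unfolding cmultilinear_scale[symmetric] by (rule cmultilinear_cong) (rule linear_scale[OF lin])
qed

text \<open>In the slot in question the extension reads G (vRe w) + \<i> G (vIm w) with G additive
  and real homogeneous; real and imaginary part of c w are the matching combinations of those of w.
  The slots in \<open>pre\<close> are peeled off by induction.\<close>

lemma clinear_form_cmultilinear:
  fixes M :: "(real^'n) list \<Rightarrow> real^'n"
  shows "mlinear n M \<Longrightarrow> clinear_form n (cmultilinear M)"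
  unfolding clinear_form_def
proof (intro allI impI)
  fix pre ws :: "(complex^'n) list"
  assume "mlinear n M" "length pre + Suc (length ws) = n"
  then show "(\<forall>w w'. cmultilinear M (pre @ (w + w') # ws) = cmultilinear M (pre @ w # ws) + cmultilinear M (pre @ w' # ws)) \<and>
     (\<forall>c w. cmultilinear M (pre @ (c *s w) # ws) = c *s cmultilinear M (pre @ w # ws))"
  proof (induction pre arbitrary: n M)
    case Nil
    then have ml: "mlinear (Suc (length ws)) M" by simp
    note l = linear_cmultilinear_Cons[OF ml]
    define G where "G w = cmultilinear (\<lambda>xs. M (w # xs)) ws" for w
    have G: "G (a + b) = G a + G b" "G (r *\<^sub>R a) = complex_of_real r *s G a" for a b r
      using l by (auto simp: G_def)
    have re: "vRe (c *s w) = Re c *\<^sub>R vRe w + (- Im c) *\<^sub>R vIm w"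
      and im: "vIm (c *s w) = Re c *\<^sub>R vIm w + Im c *\<^sub>R vRe w" for c and w :: "complex^'n"
      by (simp_all add: vRe_def vIm_def vec_eq_iff)
    have mm: "cmultilinear M (w # ws) = G (vRe w) + \<i> *s G (vIm w)" for w by (simp add: G_def)
    have "G (vRe (c *s w)) + \<i> *s G (vIm (c *s w)) = c *s (G (vRe w) + \<i> *s G (vIm w))" for c w
      unfolding re im G by (simp add: vec_eq_iff complex_eq_iff algebra_simps)
    then show ?case
      unfolding append_Nil mm by (simp add: vRe_simps vIm_simps G vec.scale_right_distrib)
  next
    case (Cons p pre)
    obtain n' where n: "n = Suc n'" and n': "length pre + Suc (length ws) = n'"
      using Cons.prems by auto
    note ml = mlinear_Cons[OF Cons.prems(1)[unfolded n]]
    show ?case using Cons.IH[OF ml n'] by (simp add: vec.scale_right_distrib mult.commute)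
  qed
qed

lemma msym_cmultilinear:
  fixes M :: "(real^'n) list \<Rightarrow> real^'n"
  shows "msym n M \<Longrightarrow> msym n (cmultilinear M)"
  unfolding msym_def[of n "cmultilinear M"]
proof (intro allI impI)
  fix pre ws :: "(complex^'n) list" and a b
  assume "msym n M" "length pre + Suc (Suc (length ws)) = n"
  then show "cmultilinear M (pre @ a # b # ws) = cmultilinear M (pre @ b # a # ws)"
  proof (induction pre arbitrary: n M)
    case Nil
    then have "M (p # q # xs) = M (q # p # xs)" if "length xs = length ws" for p q xs
      using that Nil(1)[unfolded msym_def, rule_format, of "[]" xs p q] by simp
    then have "cmultilinear (\<lambda>xs. M (p # q # xs)) ws = cmultilinear (\<lambda>xs. M (q # p # xs)) ws" for p q
      by (intro cmultilinear_cong) auto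
    then show ?case by (simp add: vec.scale_right_distrib)
  next
    case (Cons p pre)
    obtain n' where n: "n = Suc n'" and n': "length pre + Suc (Suc (length ws)) = n'"
      using Cons.prems by auto
    show ?case using Cons.IH[OF msym_Cons[OF Cons.prems(1)[unfolded n]] n'] by simp
  qed
qed

text \<open>The imaginary part of a real argument is 0, and multilinearity kills that summand in
  each slot.\<close>

lemma cmultilinear_cvec: "mlinear (length ws) M \<Longrightarrow> cmultilinear M (map cvec ws) = cvec (M ws)"
proof (induction ws arbitrary: M)
  case (Cons w ws)
  have "linear (\<lambda>w. M (w # xs))" if "length xs = length ws" for xs
    by (rule mlinear_Cons_linear[OF _ that]) (use Cons.prems in simp)
  then have "M (0 # xs) = 0" if "length xs = length ws" for xs
    using that linear_0 by blast
  then have "cmultilinear (\<lambda>xs. M (0 # xs)) (map cvec ws) = 0"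
    using cmultilinear_cong[of "map cvec ws" "\<lambda>xs. M (0 # xs)" "\<lambda>_. 0"] by (simp add: cmultilinear_zero)
  moreover have "mlinear (length ws) (\<lambda>xs. M (w # xs))"
    using Cons.prems mlinear_Cons by simp
  ultimately show ?case using Cons.IH by simp
qed simp

section \<open>Iterated directional derivatives and Taylor's formula\<close>

lemma dir_deriv_Ck:
  "Ck_on n F S \<Longrightarrow> length ws \<le> n \<Longrightarrow> Ck_on (n - length ws) (dir_deriv F ws) S"
proof (induction ws)
  case (Cons w ws)
  then have "Ck_on (Suc (n - length (w # ws))) (dir_deriv F ws) S"
    by (simp add: Suc_diff_Suc)
  then show ?case by simp
qed simp

lemma dir_deriv_differentiable:
  assumes "Ck_on n F UNIV" "length ws < n"
  shows "dir_deriv F ws differentiable at x"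
proof -
  have "Ck_on (Suc (n - Suc (length ws))) (dir_deriv F ws) UNIV"
    using dir_deriv_Ck[OF assms(1), of ws] assms(2) by (simp add: Suc_diff_Suc del: Ck_on.simps)
  then show ?thesis by simp
qed

text \<open>The identities are between functions of the base point, so that the outer
  differentiations in \<open>pre\<close> can be applied to both sides in the induction.\<close>

lemma dir_deriv_linear:
  assumes F: "Ck_on n F UNIV"
  shows "length pre + Suc (length ws) \<le> n \<Longrightarrow>
    dir_deriv F (pre @ (w + w') # ws) = (\<lambda>x. dir_deriv F (pre @ w # ws) x + dir_deriv F (pre @ w' # ws) x) \<and>
    dir_deriv F (pre @ (r *\<^sub>R w) # ws) = (\<lambda>x. r *\<^sub>R dir_deriv F (pre @ w # ws) x)"
proof (induction pre)
  case Nil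
  then have "linear (frechet_derivative (dir_deriv F ws) (at x))" for x
    by (intro linear_frechet_derivative dir_deriv_differentiable[OF F]) simp
  then show ?case by (simp add: linear_add linear_scale)
next
  case (Cons p pre)
  have d: "(dir_deriv F (pre @ w # ws) has_derivative frechet_derivative (dir_deriv F (pre @ w # ws)) (at x)) (at x)" for w x
    unfolding frechet_derivative_works[symmetric]
    by (rule dir_deriv_differentiable[OF F]) (use Cons.prems in simp)
  have "frechet_derivative (\<lambda>x. dir_deriv F (pre @ w # ws) x + dir_deriv F (pre @ w' # ws) x) (at x) p
    = frechet_derivative (dir_deriv F (pre @ w # ws)) (at x) p + frechet_derivative (dir_deriv F (pre @ w' # ws)) (at x) p" for x
    by (rule fun_cong[OF frechet_derivative_at[OF has_derivative_add[OF d d]], symmetric])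
  moreover have "frechet_derivative (\<lambda>x. r *\<^sub>R dir_deriv F (pre @ w # ws) x) (at x) p
    = r *\<^sub>R frechet_derivative (dir_deriv F (pre @ w # ws)) (at x) p" for x
    by (rule fun_cong[OF frechet_derivative_at[OF has_derivative_scaleR_right[OF d]], symmetric])
  ultimately show ?case using Cons by simp
qed

lemma mlinear_dir_deriv:
  assumes "Ck_on n F UNIV" "m \<le> n"
  shows "mlinear m (\<lambda>ws. dir_deriv F ws x)"
  unfolding mlinear_def using dir_deriv_linear[OF assms(1)] assms(2) by (auto intro!: linearI)

text \<open>Vectors at the end of the list are differentiated first. The two directions are
  exchanged by symmetry of the second derivative of \<open>dir_deriv F ws\<close>, and the
  derivatives in \<open>pre\<close> then act on equal functions.\<close>

lemma msym_dir_deriv: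
  fixes F :: "'a::euclidean_space \<Rightarrow> 'b::euclidean_space"
  assumes F: "Ck_on n F UNIV" and "m \<le> n"
  shows "msym m (\<lambda>ws. dir_deriv F ws x)"
  unfolding msym_def
proof (intro allI impI)
  fix pre ws :: "'a list" and a b
  assume m: "length pre + Suc (Suc (length ws)) = m"
  have "Ck_on (n - length ws) (dir_deriv F ws) UNIV" by (rule dir_deriv_Ck[OF F]) (use m \<open>m \<le> n\<close> in simp)
  then have "Ck_on 2 (dir_deriv F ws) UNIV" by (rule Ck_on_le) (use m \<open>m \<le> n\<close> in simp)
  then have "dir_deriv F (a # b # ws) = dir_deriv F (b # a # ws)"
    using frechet_derivative_symmetric by fastforce
  then have "dir_deriv F (pre @ a # b # ws) = dir_deriv F (pre @ b # a # ws)"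
    by (induction pre) simp_all
  then show "dir_deriv F (pre @ a # b # ws) x = dir_deriv F (pre @ b # a # ws) x" by simp
qed

text \<open>Continuity is available only for fixed directions. The free slots are therefore filled
  from the right with basis vectors, which move into \<open>suf\<close>, and multilinearity turns
  the finitely many resulting bounds into one that is uniform in the directions.\<close>

lemma dir_deriv_bound:
  fixes F :: "'a::euclidean_space \<Rightarrow> 'b::euclidean_space"
  assumes F: "Ck_on n F UNIV" and S: "compact S"
  shows "k + length suf \<le> n \<Longrightarrow> \<exists>K\<ge>0. \<forall>y\<in>S. \<forall>pre. length pre = k \<longrightarrow>
    norm (dir_deriv F (pre @ suf) y) \<le> K * prod_list (map norm pre)"
proof (induction k arbitrary: suf)
  case 0
  have "continuous_on S (dir_deriv F suf)"
    by (rule continuous_on_subset[OF Ck_on_continuous[OF dir_deriv_Ck[OF F]]]) (use 0 in auto)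
  then have "bounded (dir_deriv F suf ` S)"
    by (intro compact_imp_bounded compact_continuous_image S)
  then obtain K where "\<forall>y\<in>S. norm (dir_deriv F suf y) \<le> K" unfolding bounded_iff by auto
  then show ?case by (intro exI[of _ "max 0 K"]) (auto simp: le_max_iff_disj)
next
  case (Suc k)
  have "\<forall>b. \<exists>K. K \<ge> 0 \<and> (\<forall>y\<in>S. \<forall>pre. length pre = k \<longrightarrow>
     norm (dir_deriv F (pre @ b # suf) y) \<le> K * prod_list (map norm pre))"
    using Suc.IH[of "_ # suf"] Suc.prems by simp
  then obtain K where "\<forall>b. K b \<ge> 0 \<and> (\<forall>y\<in>S. \<forall>pre. length pre = k \<longrightarrow>
     norm (dir_deriv F (pre @ b # suf) y) \<le> K b * prod_list (map norm pre))"
    by (rule choice[THEN exE])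
  then have K: "\<And>b. K b \<ge> 0" "\<And>b y pre. y \<in> S \<Longrightarrow> length pre = k \<Longrightarrow>
     norm (dir_deriv F (pre @ b # suf) y) \<le> K b * prod_list (map norm pre)"
    by blast+
  have "norm (dir_deriv F (pre @ suf) y) \<le> (\<Sum>b\<in>Basis. K b) * prod_list (map norm pre)"
    if y: "y \<in> S" and pre: "length pre = Suc k" for y and pre :: "'a list"
  proof -
    obtain pre' w where p: "pre = pre' @ [w]" "length pre' = k"
      using pre by (metis length_Suc_conv_rev)
    define G where "G w = dir_deriv F (pre' @ w # suf) y" for w
    have "linear G"
      unfolding G_def using dir_deriv_linear[OF F, of pre' suf] p Suc.prems by (auto intro!: linearI)
    have Gw: "G w = G (\<Sum>b\<in>Basis. (w \<bullet> b) *\<^sub>R b)" by (simp add: euclidean_representation)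
    also have "\<dots> = (\<Sum>b\<in>Basis. (w \<bullet> b) *\<^sub>R G b)"
      using \<open>linear G\<close> by (simp add: linear_sum linear_scale)
    finally have "norm (G w) \<le> (\<Sum>b\<in>Basis. norm ((w \<bullet> b) *\<^sub>R G b))" by (simp only: norm_sum)
    also have "\<dots> \<le> (\<Sum>b\<in>Basis. norm w * (K b * prod_list (map norm pre')))"
      unfolding norm_scaleR G_def using K(2)[OF y p(2)]
      by (intro sum_mono mult_mono) (auto simp: Basis_le_norm)
    also have "\<dots> = (\<Sum>b\<in>Basis. K b) * prod_list (map norm pre)"
      by (simp add: p sum_distrib_right sum_distrib_left mult_ac)
    finally show ?thesis by (simp add: G_def p)
  qed
  then show ?case using K(1) by (intro exI[of _ "\<Sum>b\<in>Basis. K b"]) (auto simp: sum_nonneg)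
qed

text \<open>Taylor's formula with integral remainder on the segment from x to x + w. The segment
  stays in the compact unit ball around x, so one K serves all w.\<close>

lemma taylor_dir_deriv:
  fixes F :: "'a::euclidean_space \<Rightarrow> 'b::euclidean_space"
  assumes F: "Ck_on (Suc n) F UNIV"
  shows "\<exists>K. \<forall>w. norm w \<le> 1 \<longrightarrow>
    norm (F (x + w) - (\<Sum>m\<le>n. (1 / fact m) *\<^sub>R dir_deriv F (replicate m w) x)) \<le> K * norm w ^ Suc n"
proof -
  obtain K where K: "K \<ge> 0" "\<And>y ws. y \<in> cball x 1 \<Longrightarrow> length ws = Suc n \<Longrightarrow>
      norm (dir_deriv F ws y) \<le> K * prod_list (map norm ws)"
    using dir_deriv_bound[OF F compact_cball, of "Suc n" "[]" x 1] by auto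
  have "norm (F (x + w) - (\<Sum>m\<le>n. (1 / fact m) *\<^sub>R dir_deriv F (replicate m w) x)) \<le> K * norm w ^ Suc n"
    if w: "norm w \<le> 1" for w
  proof -
    define Df where "Df m s = dir_deriv F (replicate m w) (x + s *\<^sub>R w)" for m s
    have Df: "(Df m has_vector_derivative Df (Suc m) t) (at t within {0..1})" if "m < Suc n" for m t
      unfolding Df_def
      using line_has_vector_derivative[of "dir_deriv F (replicate m w)" x t w, OF dir_deriv_differentiable[OF F]] that
      by simp
    \<comment> \<open>The integrand of the remainder; its kernel has absolute value at most 1 on the
      unit interval.\<close>
    define i where "i s = ((1 - s) ^ (Suc n - 1) / fact (Suc n - 1)) *\<^sub>R Df (Suc n) s" for s
    have int: "(i has_integral F (x + w) - (\<Sum>m\<le>n. (1 / fact m) *\<^sub>R dir_deriv F (replicate m w) x)) {0..1}"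
      using Taylor_has_integral[of "Suc n" Df "Df 0" 0 1, OF _ refl Df]
      unfolding i_def[symmetric] lessThan_Suc_atMost by (simp add: Df_def)
    have "norm (F (x + w) - (\<Sum>m\<le>n. (1 / fact m) *\<^sub>R dir_deriv F (replicate m w) x)) \<le> (K * norm w ^ Suc n) * measure lborel (cbox 0 (1::real))"
    proof (rule has_integral_bound)
      show "0 \<le> K * norm w ^ Suc n" using K by simp
      show "(i has_integral F (x + w) - (\<Sum>m\<le>n. (1 / fact m) *\<^sub>R dir_deriv F (replicate m w) x)) (cbox 0 1)"
        using int by simp
      fix s :: real assume "s \<in> cbox 0 1"
      then have s: "0 \<le> s" "s \<le> 1" by auto
      have "x + s *\<^sub>R w \<in> cball x 1" using s w mult_mono[of s 1 "norm w" 1] by (simp add: dist_norm)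
      from K(2)[OF this, of "replicate (Suc n) w"]
      have D: "norm (Df (Suc n) s) \<le> K * norm w ^ Suc n"
        unfolding Df_def by (simp add: prod_list_replicate map_replicate_const[symmetric])
      have "\<bar>(1 - s) ^ n / fact n\<bar> \<le> 1"
        using s by (auto simp: divide_le_eq_1 power_le_one intro!: order_trans[OF power_le_one fact_ge_1])
      then have "norm (i s) \<le> 1 * (K * norm w ^ Suc n)"
        unfolding i_def norm_scaleR using D by (intro mult_mono) auto
      then show "norm (i s) \<le> K * norm w ^ Suc n" by simp
    qed
    then show ?thesis by simp
  qed
  then show ?thesis by blast
qed

section \<open>Expansions in a complex variable and its conjugate\<close>

definition pol :: "nat \<Rightarrow> (nat \<Rightarrow> nat \<Rightarrow> complex^'n) \<Rightarrow> complex \<Rightarrow> complex^'n" where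
  "pol n X \<xi> = (\<Sum>(j, k)\<in>{(j, k). j + k \<le> n}. (\<xi> ^ j * cnj \<xi> ^ k) *s X j k)"

text \<open>A little-o remainder, since class n yields no more, and uniform in the parameter, since
  expansions will be integrated over it. One radius r has to serve all s in S.\<close>

definition uexp ::
  "nat \<Rightarrow> 'p set \<Rightarrow> ('p \<Rightarrow> complex \<Rightarrow> complex^'n) \<Rightarrow> ('p \<Rightarrow> nat \<Rightarrow> nat \<Rightarrow> complex^'n) \<Rightarrow> bool" where
  "uexp n S f X \<longleftrightarrow> (\<forall>\<eta>>0. \<exists>r>0. \<forall>s\<in>S. \<forall>\<xi>. norm \<xi> < r \<longrightarrow>
     norm (f s \<xi> - pol n (X s) \<xi>) \<le> \<eta> * norm \<xi> ^ n)"

text \<open>Multiplication by \<xi> on families of coefficients; the case j = 0 is separate because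
  of truncated subtraction. \<open>shift_cnj\<close> is multiplication by the conjugate.\<close>

definition shift :: "(nat \<Rightarrow> nat \<Rightarrow> 'a::zero) \<Rightarrow> nat \<Rightarrow> nat \<Rightarrow> 'a" where
  "shift X j k = (if j = 0 then 0 else X (j - 1) k)"

definition shift_cnj :: "(nat \<Rightarrow> nat \<Rightarrow> 'a::zero) \<Rightarrow> nat \<Rightarrow> nat \<Rightarrow> 'a" where
  "shift_cnj X j k = (if k = 0 then 0 else X j (k - 1))"

lemma finite_degree_set [simp]: "finite {(j :: nat, k :: nat). j + k \<le> n}"
  by (rule finite_subset[of _ "{..n} \<times> {..n}"]) auto

lemma pol_add: "pol n (\<lambda>j k. X j k + Z j k) \<xi> = pol n X \<xi> + pol n Z \<xi>"
  by (simp add: pol_def sum.distrib split_def vec.scale_right_distrib)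

lemma pol_diff: "pol n (\<lambda>j k. X j k - Z j k) \<xi> = pol n X \<xi> - pol n Z \<xi>"
  by (simp add: pol_def sum_subtractf split_def vec.scale_right_diff_distrib)

lemma pol_smult: "pol n (\<lambda>j k. c *s X j k) \<xi> = c *s pol n X \<xi>"
  by (simp add: pol_def split_def vec.scale_sum_right mult.commute)

lemma pol_cong: "(\<And>j k. j + k \<le> n \<Longrightarrow> X j k = Z j k) \<Longrightarrow> pol n X \<xi> = pol n Z \<xi>"
  unfolding pol_def by (rule sum.cong) auto

lemma pol_0: "pol n X 0 = X 0 0"
proof -
  have "pol n X 0 = (\<Sum>(j, k)\<in>{(0, 0)}. (0 ^ j * cnj 0 ^ k) *s X j k)"
    unfolding pol_def by (rule sum.mono_neutral_right) (auto simp: power_0_left split: if_splits)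
  then show ?thesis by simp
qed

lemma pol_shift: "pol (Suc n) (shift X) \<xi> = \<xi> *s pol n X \<xi>"
proof -
  have "pol (Suc n) (shift X) \<xi>
      = (\<Sum>(j, k)\<in>{(j, k). j + k \<le> Suc n \<and> j \<noteq> 0}. (\<xi> ^ j * cnj \<xi> ^ k) *s X (j - 1) k)"
    unfolding pol_def by (rule sum.mono_neutral_cong_right) (auto simp: shift_def split: if_splits)
  also have "\<dots> = (\<Sum>(j, k)\<in>{(j, k). j + k \<le> n}. (\<xi> ^ Suc j * cnj \<xi> ^ k) *s X j k)"
    by (rule sum.reindex_bij_witness[of _ "\<lambda>(j, k). (Suc j, k)" "\<lambda>(j, k). (j - 1, k)"]) (auto simp flip: power_Suc)
  finally show ?thesis by (simp add: pol_def split_def vec.scale_sum_right mult.assoc)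
qed

lemma pol_shift_cnj: "pol (Suc n) (shift_cnj X) \<xi> = cnj \<xi> *s pol n X \<xi>"
proof -
  have "pol (Suc n) (shift_cnj X) \<xi>
      = (\<Sum>(j, k)\<in>{(j, k). j + k \<le> Suc n \<and> k \<noteq> 0}. (\<xi> ^ j * cnj \<xi> ^ k) *s X j (k - 1))"
    unfolding pol_def by (rule sum.mono_neutral_cong_right) (auto simp: shift_cnj_def split: if_splits)
  also have "\<dots> = (\<Sum>(j, k)\<in>{(j, k). j + k \<le> n}. (\<xi> ^ j * cnj \<xi> ^ Suc k) *s X j k)"
    by (rule sum.reindex_bij_witness[of _ "\<lambda>(j, k). (j, Suc k)" "\<lambda>(j, k). (j, k - 1)"]) (auto simp flip: power_Suc)
  finally show ?thesis by (simp add: pol_def split_def vec.scale_sum_right mult.left_commute)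
qed

section \<open>Algebra of expansions\<close>

lemma uexp_add:
  assumes "uexp n S f X" "uexp n S g Z"
  shows "uexp n S (\<lambda>s \<xi>. f s \<xi> + g s \<xi>) (\<lambda>s j k. X s j k + Z s j k)"
  unfolding uexp_def
proof (intro allI impI)
  fix \<eta> :: real assume "\<eta> > 0"
  then have "\<eta> / 2 > 0" by simp
  obtain r1 where r1: "r1 > 0" "\<And>s \<xi>. s \<in> S \<Longrightarrow> norm \<xi> < r1 \<Longrightarrow> norm (f s \<xi> - pol n (X s) \<xi>) \<le> \<eta> / 2 * norm \<xi> ^ n"
    using assms(1) \<open>\<eta> / 2 > 0\<close> unfolding uexp_def by meson
  obtain r2 where r2: "r2 > 0" "\<And>s \<xi>. s \<in> S \<Longrightarrow> norm \<xi> < r2 \<Longrightarrow> norm (g s \<xi> - pol n (Z s) \<xi>) \<le> \<eta> / 2 * norm \<xi> ^ n"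
    using assms(2) \<open>\<eta> / 2 > 0\<close> unfolding uexp_def by meson
  show "\<exists>r>0. \<forall>s\<in>S. \<forall>\<xi>. norm \<xi> < r \<longrightarrow>
     norm (f s \<xi> + g s \<xi> - pol n (\<lambda>j k. X s j k + Z s j k) \<xi>) \<le> \<eta> * norm \<xi> ^ n"
  proof (intro exI[of _ "min r1 r2"] conjI ballI allI impI)
    fix s \<xi> assume s: "s \<in> S" and \<xi>: "norm (\<xi> :: complex) < min r1 r2"
    have "norm ((f s \<xi> - pol n (X s) \<xi>) + (g s \<xi> - pol n (Z s) \<xi>)) \<le> \<eta> / 2 * norm \<xi> ^ n + \<eta> / 2 * norm \<xi> ^ n"
      using \<xi> by (intro norm_triangle_le add_mono r1(2) r2(2) s) auto
    then show "norm (f s \<xi> + g s \<xi> - pol n (\<lambda>j k. X s j k + Z s j k) \<xi>) \<le> \<eta> * norm \<xi> ^ n"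
      by (simp add: pol_add algebra_simps)
  qed (use r1 r2 in auto)
qed

text \<open>One estimate behind scaling (d = 0) and multiplication by \<xi> or its conjugate (d = 1,
  which gains an order). Dividing by \<open>K + 1\<close> avoids the case K = 0.\<close>

lemma uexp_transform:
  assumes f: "uexp n S f X" and K: "K \<ge> 0"
    and g: "\<And>s \<xi>. s \<in> S \<Longrightarrow> norm (g s \<xi> - pol m (Z s) \<xi>) \<le> K * norm \<xi> ^ d * norm (f s \<xi> - pol n (X s) \<xi>)"
    and m: "m = n + d"
  shows "uexp m S g Z"
  unfolding uexp_def
proof (intro allI impI)
  fix \<eta> :: real assume "\<eta> > 0"
  then have "\<eta> / (K + 1) > 0" using K by simp
  then obtain r where r: "r > 0" "\<And>s \<xi>. s \<in> S \<Longrightarrow> norm \<xi> < r \<Longrightarrow> norm (f s \<xi> - pol n (X s) \<xi>) \<le> \<eta> / (K + 1) * norm \<xi> ^ n"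
    using f unfolding uexp_def by meson
  show "\<exists>r>0. \<forall>s\<in>S. \<forall>\<xi>. norm \<xi> < r \<longrightarrow> norm (g s \<xi> - pol m (Z s) \<xi>) \<le> \<eta> * norm \<xi> ^ m"
  proof (intro exI[of _ r] conjI ballI allI impI r(1))
    fix s \<xi> assume s: "s \<in> S" and \<xi>: "norm (\<xi> :: complex) < r"
    have "norm (g s \<xi> - pol m (Z s) \<xi>) \<le> K * norm \<xi> ^ d * norm (f s \<xi> - pol n (X s) \<xi>)"
      by (rule g[OF s])
    also have "\<dots> \<le> K * norm \<xi> ^ d * (\<eta> / (K + 1) * norm \<xi> ^ n)"
      by (intro mult_left_mono r(2) s \<xi>) (simp add: K)
    also have "\<dots> = (K / (K + 1)) * (\<eta> * norm \<xi> ^ m)"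
      by (simp add: m power_add)
    also have "\<dots> \<le> 1 * (\<eta> * norm \<xi> ^ m)"
      using K \<open>\<eta> > 0\<close> by (intro mult_right_mono) auto
    finally show "norm (g s \<xi> - pol m (Z s) \<xi>) \<le> \<eta> * norm \<xi> ^ m" by simp
  qed
qed

lemma norm_smult_diff: "norm (c *s a - c *s b) = cmod c * norm (a - b :: complex^'n)"
  by (metis norm_smult_complex vec.scale_right_diff_distrib)

lemma uexp_smult: "uexp n S f X \<Longrightarrow> uexp n S (\<lambda>s \<xi>. c *s f s \<xi>) (\<lambda>s j k. c *s X s j k)"
  by (erule uexp_transform[where K = "cmod c" and d = 0])
    (simp_all add: pol_smult norm_smult_diff)

lemma uexp_shift_Suc: "uexp n S f X \<Longrightarrow> uexp (Suc n) S (\<lambda>s \<xi>. \<xi> *s f s \<xi>) (\<lambda>s. shift (X s))"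
  by (erule uexp_transform[where K = 1 and d = 1])
    (simp_all add: pol_shift norm_smult_diff)

lemma uexp_shift_cnj_Suc:
  "uexp n S f X \<Longrightarrow> uexp (Suc n) S (\<lambda>s \<xi>. cnj \<xi> *s f s \<xi>) (\<lambda>s. shift_cnj (X s))"
  by (erule uexp_transform[where K = 1 and d = 1])
    (simp_all add: pol_shift_cnj norm_smult_diff)

lemma uexp_diff:
  assumes "uexp n S f X" "uexp n S g Z"
  shows "uexp n S (\<lambda>s \<xi>. f s \<xi> - g s \<xi>) (\<lambda>s j k. X s j k - Z s j k)"
  using uexp_add[OF assms(1) uexp_smult[where c = "-1", OF assms(2)]]
  by (simp add: vec.scale_minus_left)

lemma uexp_cong:
  assumes f: "uexp n S f X" and "r0 > 0"
    and fg: "\<And>s \<xi>. s \<in> S \<Longrightarrow> norm \<xi> < r0 \<Longrightarrow> f s \<xi> = g s \<xi>"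
    and XZ: "\<And>s j k. s \<in> S \<Longrightarrow> j + k \<le> n \<Longrightarrow> X s j k = Z s j k"
  shows "uexp n S g Z"
  unfolding uexp_def
proof (intro allI impI)
  fix \<eta> :: real assume "\<eta> > 0"
  then obtain r where r: "r > 0" "\<forall>s\<in>S. \<forall>\<xi>. norm \<xi> < r \<longrightarrow> norm (f s \<xi> - pol n (X s) \<xi>) \<le> \<eta> * norm \<xi> ^ n"
    using f unfolding uexp_def by meson
  have "pol n (X s) \<xi> = pol n (Z s) \<xi>" if "s \<in> S" for s \<xi>
    by (rule pol_cong) (rule XZ[OF that])
  then show "\<exists>r>0. \<forall>s\<in>S. \<forall>\<xi>. norm \<xi> < r \<longrightarrow> norm (g s \<xi> - pol n (Z s) \<xi>) \<le> \<eta> * norm \<xi> ^ n"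
    using r fg[symmetric] \<open>r0 > 0\<close> by (intro exI[of _ "min r r0"]) auto
qed

lemma uexp_pol: "uexp n S (\<lambda>s \<xi>. pol n (X s) \<xi>) X"
  by (auto simp: uexp_def intro!: exI[of _ 1])

lemma uexp_zero: "uexp n S (\<lambda>s \<xi>. 0) (\<lambda>s j k. 0)"
  using uexp_pol[of n S "\<lambda>_ _ _. 0"] by (simp add: pol_def)

text \<open>Here remainders of order n + 1, such as those in the hypotheses on the manifold and on
  the restricted system, enter the little-o calculus: one power of |\<xi>| is traded for
  \<eta>.\<close>

lemma uexp_small:
  assumes "\<And>s \<xi>. s \<in> S \<Longrightarrow> norm \<xi> < r0 \<Longrightarrow> norm (f s \<xi>) \<le> K * norm \<xi> ^ Suc n" and "r0 > 0"
  shows "uexp n S f (\<lambda>_ _ _. 0)"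
  unfolding uexp_def
proof (intro allI impI)
  fix \<eta> :: real assume \<eta>: "\<eta> > 0"
  define r where "r = min r0 (\<eta> / (\<bar>K\<bar> + 1))"
  show "\<exists>r>0. \<forall>s\<in>S. \<forall>\<xi>. norm \<xi> < r \<longrightarrow> norm (f s \<xi> - pol n (\<lambda>_ _. 0) \<xi>) \<le> \<eta> * norm \<xi> ^ n"
  proof (intro exI[of _ r] conjI ballI allI impI)
    fix s \<xi> assume s: "s \<in> S" and \<xi>: "norm (\<xi> :: complex) < r"
    have "norm (f s \<xi>) \<le> K * norm \<xi> ^ Suc n" using assms(1)[OF s] \<xi> by (simp add: r_def)
    also have "\<dots> \<le> (\<bar>K\<bar> + 1) * norm \<xi> ^ Suc n" by (intro mult_right_mono) auto
    also have "\<dots> = ((\<bar>K\<bar> + 1) * norm \<xi>) * norm \<xi> ^ n" by simp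
    also have "\<dots> \<le> \<eta> * norm \<xi> ^ n"
      using \<xi> by (intro mult_right_mono) (auto simp: r_def field_simps)
    finally show "norm (f s \<xi> - pol n (\<lambda>_ _. 0) \<xi>) \<le> \<eta> * norm \<xi> ^ n" by (simp add: pol_def)
  qed (use \<eta> \<open>r0 > 0\<close> in \<open>auto simp: r_def\<close>)
qed

text \<open>The terms of top degree are absorbed into the error. The bound B for them depends on the
  parameter, which is why S is a single point here.\<close>

lemma uexp_drop:
  assumes f: "uexp (Suc n) {s} f X"
  shows "uexp n {s} f X"
proof -
  define B where "B = (\<Sum>(j, k)\<in>{(j, k). j + k = Suc n}. norm (X s j k))"
  have fin: "finite {(j, k). j + k = Suc n}"
    by (rule finite_subset[OF _ finite_degree_set[of "Suc n"]]) auto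
  have split: "pol (Suc n) (X s) \<xi> = pol n (X s) \<xi>
      + (\<Sum>(j, k)\<in>{(j, k). j + k = Suc n}. (\<xi> ^ j * cnj \<xi> ^ k) *s X s j k)" for \<xi>
    unfolding pol_def by (subst sum.union_disjoint[symmetric]) (auto intro!: sum.cong fin)
  have top: "norm (\<Sum>(j, k)\<in>{(j, k). j + k = Suc n}. (\<xi> ^ j * cnj \<xi> ^ k) *s X s j k) \<le> B * norm \<xi> ^ Suc n" for \<xi>
  proof -
    have "norm (\<Sum>(j, k)\<in>{(j, k). j + k = Suc n}. (\<xi> ^ j * cnj \<xi> ^ k) *s X s j k)
      \<le> (\<Sum>(j, k)\<in>{(j, k). j + k = Suc n}. norm (X s j k) * norm \<xi> ^ Suc n)"
      by (rule order_trans[OF norm_sum sum_mono])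
        (auto simp: norm_smult_complex norm_mult norm_power mult.commute simp flip: power_add)
    then show ?thesis by (simp add: B_def sum_distrib_right split_def)
  qed
  obtain r where r: "r > 0" "\<And>\<xi>. norm \<xi> < r \<Longrightarrow> norm (f s \<xi> - pol (Suc n) (X s) \<xi>) \<le> 1 * norm \<xi> ^ Suc n"
    using f[unfolded uexp_def, rule_format, of 1] by auto
  have "uexp n {s} (\<lambda>s \<xi>. f s \<xi> - pol n (X s) \<xi>) (\<lambda>_ _ _. 0)"
  proof (rule uexp_small[OF _ r(1)])
    fix s' \<xi> assume "s' \<in> {s}" and \<xi>: "norm (\<xi>::complex) < r"
    have "norm ((f s \<xi> - pol (Suc n) (X s) \<xi>) + (\<Sum>(j, k)\<in>{(j, k). j + k = Suc n}. (\<xi> ^ j * cnj \<xi> ^ k) *s X s j k))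
      \<le> 1 * norm \<xi> ^ Suc n + B * norm \<xi> ^ Suc n"
      by (intro norm_triangle_le add_mono r(2)[OF \<xi>] top)
    then show "norm (f s' \<xi> - pol n (X s') \<xi>) \<le> (1 + B) * norm \<xi> ^ Suc n"
      using \<open>s' \<in> {s}\<close> by (simp add: split algebra_simps)
  qed
  from uexp_add[OF this uexp_pol[of n "{s}" X]] show ?thesis by simp
qed

lemma uexp_shift: "uexp n {s} f X \<Longrightarrow> uexp n {s} (\<lambda>s \<xi>. \<xi> *s f s \<xi>) (\<lambda>s. shift (X s))"
  by (rule uexp_drop[OF uexp_shift_Suc])

lemma uexp_shift_cnj: "uexp n {s} f X \<Longrightarrow> uexp n {s} (\<lambda>s \<xi>. cnj \<xi> *s f s \<xi>) (\<lambda>s. shift_cnj (X s))"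
  by (rule uexp_drop[OF uexp_shift_cnj_Suc])

lemma uexp_sum:
  "finite I \<Longrightarrow> (\<And>i. i \<in> I \<Longrightarrow> uexp n S (f i) (X i)) \<Longrightarrow>
   uexp n S (\<lambda>s \<xi>. \<Sum>i\<in>I. f i s \<xi>) (\<lambda>s j k. \<Sum>i\<in>I. X i s j k)"
  by (induction I rule: finite_induct) (auto simp: uexp_zero intro!: uexp_add)

text \<open>On the unit circle multiplication by \<zeta>^m turns the form into a polynomial of
  degree at most m in w = \<zeta>^2. It vanishes at all m + 1 roots of unity of order m + 1, which
  is one root too many.\<close>

lemma homogeneous_zero:
  fixes z :: "nat \<Rightarrow> complex"
  assumes "\<And>\<zeta>. norm \<zeta> = 1 \<Longrightarrow> (\<Sum>j\<le>m. \<zeta> ^ j * cnj \<zeta> ^ (m - j) * z j) = 0" and "j \<le> m"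
  shows "z j = 0"
proof (rule ccontr)
  assume nz: "z j \<noteq> 0"
  have "(\<Sum>j\<le>m. z j * w ^ j) = 0" if w: "w ^ Suc m = 1" for w
  proof -
    have "norm w ^ Suc m = 1" by (metis norm_one norm_power w)
    then have "norm w = 1" using power_eq_imp_eq_base[of "norm w" "Suc m" 1] by simp
    define \<zeta> where "\<zeta> = csqrt w"
    have \<zeta>: "norm \<zeta> = 1" "\<zeta>\<^sup>2 = w" using \<open>norm w = 1\<close> by (simp_all add: \<zeta>_def norm_csqrt)
    then have 1: "\<zeta> * cnj \<zeta> = 1" by (simp add: complex_norm_square[symmetric])
    have "(\<Sum>j\<le>m. z j * w ^ j) = (\<Sum>j\<le>m. \<zeta> ^ m * (\<zeta> ^ j * cnj \<zeta> ^ (m - j) * z j))"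
    proof (rule sum.cong)
      fix j assume "j \<in> {..m}"
      then have "\<zeta> ^ m = \<zeta> ^ j * \<zeta> ^ (m - j)" by (simp flip: power_add)
      then have "\<zeta> ^ m * (\<zeta> ^ j * cnj \<zeta> ^ (m - j) * z j) = (\<zeta> ^ j * \<zeta> ^ j) * (\<zeta> * cnj \<zeta>) ^ (m - j) * z j"
        by (simp add: power_mult_distrib mult_ac)
      also have "\<zeta> ^ j * \<zeta> ^ j = w ^ j" by (simp add: \<zeta>(2)[symmetric] power2_eq_square power_mult_distrib)
      finally show "z j * w ^ j = \<zeta> ^ m * (\<zeta> ^ j * cnj \<zeta> ^ (m - j) * z j)"
        unfolding 1 power_one mult_1_right by (simp only: mult.commute)
    qed simp
    also have "\<dots> = 0" using assms(1)[OF \<zeta>(1)] by (simp flip: sum_distrib_left)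
    finally show ?thesis .
  qed
  then have sub: "{w. w ^ Suc m = 1} \<subseteq> {w. (\<Sum>j\<le>m. z j * w ^ j) = 0}" by auto
  have "finite {w. (\<Sum>j\<le>m. z j * w ^ j) = 0} \<and> card {w. (\<Sum>j\<le>m. z j * w ^ j) = 0} \<le> m"
    using Transcendental.polyfun_rootbound[of z j m] nz \<open>j \<le> m\<close> by blast
  then show False
    using card_mono[OF _ sub] card_roots_unity_eq[of "Suc m"] by simp
qed

text \<open>Induction on the degree m = j + k. Once lower degrees vanish, dividing by \<epsilon>^m
  along a ray \<epsilon> \<zeta> and letting \<epsilon> tend to 0 isolates the homogeneous part of
  degree m, to which \<open>homogeneous_zero\<close> applies.\<close>

lemma pol_small_zero:
  fixes Z :: "nat \<Rightarrow> nat \<Rightarrow> complex^'n"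
  assumes small: "\<And>\<eta>. \<eta> > 0 \<Longrightarrow> \<exists>r>0. \<forall>\<xi>. norm \<xi> < r \<longrightarrow> norm (pol n Z \<xi>) \<le> \<eta> * norm \<xi> ^ n"
  shows "j + k \<le> n \<Longrightarrow> Z j k = 0"
proof (induction "j + k" arbitrary: j k rule: less_induct)
  case less
  define m where "m = j + k"
  have m: "m \<le> n" using less.prems by (simp add: m_def)
  have low: "Z a b = 0" if "a + b < m" for a b
    using less.hyps[of a b] that m by (simp add: m_def)
  define Hm where "Hm \<zeta> = (\<Sum>j\<le>m. (\<zeta> ^ j * cnj \<zeta> ^ (m - j)) *s Z j (m - j))" for \<zeta>
  have Hm0: "Hm \<zeta> = 0" if \<zeta>: "norm \<zeta> = 1" for \<zeta>
  proof -
    \<comment> \<open>The polynomial along the ray after division by \<epsilon>^m; the restriction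
      to degrees at least m keeps the exponents honest. At \<epsilon> = 0 only degree m
      remains.\<close>
    define q where "q \<epsilon> = (\<Sum>(j, k)\<in>{(j, k). j + k \<le> n \<and> m \<le> j + k}.
        complex_of_real (\<epsilon> ^ (j + k - m)) *s ((\<zeta> ^ j * cnj \<zeta> ^ k) *s Z j k))" for \<epsilon> :: real
    have polq: "pol n Z (of_real \<epsilon> * \<zeta>) = complex_of_real (\<epsilon> ^ m) *s q \<epsilon>" for \<epsilon>
    proof -
      have "pol n Z (of_real \<epsilon> * \<zeta>) = (\<Sum>(j, k)\<in>{(j, k). j + k \<le> n \<and> m \<le> j + k}.
          ((of_real \<epsilon> * \<zeta>) ^ j * cnj (of_real \<epsilon> * \<zeta>) ^ k) *s Z j k)"
        unfolding pol_def using low low[of _ 0] low[of 0] low[of 0 0]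
        by (intro sum.mono_neutral_right finite_degree_set) (auto simp flip: not_less)
      also have "\<dots> = complex_of_real (\<epsilon> ^ m) *s q \<epsilon>"
        unfolding q_def vec.scale_sum_right
      proof (rule sum.cong)
        fix p :: "nat \<times> nat" assume "p \<in> {(j, k). j + k \<le> n \<and> m \<le> j + k}"
        then obtain j k where p: "p = (j, k)" and "m \<le> j + k" by auto
        then have "\<epsilon> ^ m * \<epsilon> ^ (j + k - m) = \<epsilon> ^ j * \<epsilon> ^ k" by (simp flip: power_add)
        then have "complex_of_real (\<epsilon> ^ m) * complex_of_real (\<epsilon> ^ (j + k - m)) = complex_of_real (\<epsilon> ^ j) * complex_of_real (\<epsilon> ^ k)"
          by (metis of_real_mult)
        then have "(of_real \<epsilon> * \<zeta>) ^ j * cnj (of_real \<epsilon> * \<zeta>) ^ k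
            = complex_of_real (\<epsilon> ^ m) * (complex_of_real (\<epsilon> ^ (j + k - m)) * (\<zeta> ^ j * cnj \<zeta> ^ k))"
          by (simp add: power_mult_distrib mult.assoc[symmetric])
        then show "(case p of (j, k) \<Rightarrow> ((of_real \<epsilon> * \<zeta>) ^ j * cnj (of_real \<epsilon> * \<zeta>) ^ k) *s Z j k)
            = complex_of_real (\<epsilon> ^ m) *s (case p of (j, k) \<Rightarrow>
                complex_of_real (\<epsilon> ^ (j + k - m)) *s ((\<zeta> ^ j * cnj \<zeta> ^ k) *s Z j k))"
          by (simp add: p)
      qed simp
      finally show ?thesis .
    qed
    have q0: "q 0 = Hm \<zeta>"
    proof -
      have "q 0 = (\<Sum>(j, k)\<in>{(j, k). j + k = m}. (\<zeta> ^ j * cnj \<zeta> ^ k) *s Z j k)"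
        unfolding q_def using m
        by (intro sum.mono_neutral_cong_right finite_subset[OF _ finite_degree_set[of n]]) auto
      also have "\<dots> = Hm \<zeta>" unfolding Hm_def
        by (rule sum.reindex_bij_witness[of _ "\<lambda>j. (j, m - j)" fst]) auto
      finally show ?thesis .
    qed
    have "((\<lambda>\<epsilon>. q \<epsilon>) \<longlongrightarrow> q 0) (at 0)"
      unfolding q_def split_def
      by (intro tendsto_sum bounded_bilinear.tendsto[OF bounded_bilinear_smult] tendsto_intros)
    then have lim: "((\<lambda>\<epsilon>. norm (q \<epsilon>)) \<longlongrightarrow> norm (Hm \<zeta>)) (at_right 0)"
      unfolding q0 by (intro tendsto_norm) (simp add: filterlim_at_split)
    have "norm (Hm \<zeta>) \<le> \<eta>" if \<eta>: "\<eta> > 0" for \<eta>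
    proof -
      obtain r where r: "r > 0" "\<And>\<xi>. norm \<xi> < r \<Longrightarrow> norm (pol n Z \<xi>) \<le> \<eta> * norm \<xi> ^ n"
        using small[OF \<eta>] by meson
      have "\<forall>\<^sub>F \<epsilon> in at_right (0::real). norm (q \<epsilon>) \<le> \<eta>"
        unfolding eventually_at_right_field
      proof (intro exI[of _ "min r 1"] conjI allI impI)
        fix \<epsilon> :: real assume \<epsilon>: "0 < \<epsilon>" "\<epsilon> < min r 1"
        have "norm (pol n Z (of_real \<epsilon> * \<zeta>)) \<le> \<eta> * \<epsilon> ^ n"
          using r(2)[of "of_real \<epsilon> * \<zeta>"] \<zeta> \<epsilon> by (simp add: norm_mult)
        \<comment> \<open>Since \<epsilon> < 1 and m \<le> n, smallness of order n implies smallness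
          of order m.\<close>
        also have "\<dots> \<le> \<eta> * \<epsilon> ^ m"
          using \<epsilon> \<eta> m by (intro mult_left_mono power_decreasing) auto
        finally have "\<epsilon> ^ m * norm (q \<epsilon>) \<le> \<epsilon> ^ m * \<eta>"
          unfolding polq norm_smult_complex norm_of_real using \<epsilon> by (simp add: mult.commute)
        then show "norm (q \<epsilon>) \<le> \<eta>" using \<epsilon> by simp
      qed (use r in auto)
      then show ?thesis by (rule tendsto_upperbound[OF lim]) simp
    qed
    then show ?thesis using field_le_epsilon[of "norm (Hm \<zeta>)" 0] by simp
  qed
  have "Z j k $ i = 0" for i
  proof -
    have "Z j (m - j) $ i = 0"
    proof (rule homogeneous_zero[where z = "\<lambda>j. Z j (m - j) $ i" and m = m])
      fix \<zeta> :: complex assume "norm \<zeta> = 1"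
      then have "Hm \<zeta> $ i = 0" by (simp add: Hm0)
      then show "(\<Sum>j\<le>m. \<zeta> ^ j * cnj \<zeta> ^ (m - j) * Z j (m - j) $ i) = 0"
        by (simp add: Hm_def)
    qed (simp add: m_def)
    then show ?thesis by (simp add: m_def)
  qed
  then show ?case by (simp add: vec_eq_iff)
qed

lemma uexp_unique:
  assumes "uexp n S f X" "uexp n S f Z" "s \<in> S" "j + k \<le> n"
  shows "X s j k = Z s j k"
proof -
  have d: "uexp n S (\<lambda>_ _. 0) (\<lambda>s j k. X s j k - Z s j k)"
    using uexp_diff[OF assms(1,2)] by simp
  have "X s j k - Z s j k = 0"
  proof (rule pol_small_zero[OF _ assms(4)])
    show "\<exists>r>0. \<forall>\<xi>. norm \<xi> < r \<longrightarrow> norm (pol n (\<lambda>j k. X s j k - Z s j k) \<xi>) \<le> \<eta> * norm \<xi> ^ n" if "\<eta> > 0" for \<eta>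
      using d[unfolded uexp_def, rule_format, OF that] assms(3) by auto
  qed
  then show ?thesis by simp
qed

section \<open>Expansions of derivatives\<close>

lemma chain_frechet:
  assumes "f differentiable at (p s)" "(p has_vector_derivative p') (at s within X)"
  shows "((\<lambda>s. f (p s)) has_vector_derivative frechet_derivative f (at (p s)) p') (at s within X)"
proof -
  have f: "(f has_derivative frechet_derivative f (at (p s))) (at (p s))"
    using assms(1) frechet_derivative_works by blast
  have "((\<lambda>s. f (p s)) has_derivative (\<lambda>h. frechet_derivative f (at (p s)) (h *\<^sub>R p'))) (at s within X)"
    using diff_chain_within[OF assms(2)[unfolded has_vector_derivative_def] has_derivative_at_withinI[OF f]]
    unfolding o_def .
  then show ?thesis
    unfolding has_vector_derivative_def
    using linear_frechet_derivative[OF assms(1)] by (auto simp: linear_scale)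
qed

text \<open>The derivative is only real linear in the complex direction, so both 1 and \<i> are
  needed to describe it.\<close>

lemma frechet_derivative_complex_split:
  assumes "f differentiable at (x :: real \<times> complex)"
  shows "frechet_derivative f (at x) (0, z)
     = Re z *\<^sub>R frechet_derivative f (at x) (0, 1) + Im z *\<^sub>R frechet_derivative f (at x) (0, \<i>)"
proof -
  have z: "(0, z) = Re z *\<^sub>R (0, 1) + Im z *\<^sub>R (0::real, \<i>)"
    by (simp add: complex_eq_iff)
  show ?thesis
    unfolding z linear_add[OF linear_frechet_derivative[OF assms]] linear_scale[OF linear_frechet_derivative[OF assms]]
    by simp
qed

lemma pol_has_vector_derivative:
  assumes "\<And>j k. j + k \<le> n \<Longrightarrow> ((\<lambda>s. X s j k) has_vector_derivative X' j k) (at s within S)"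
  shows "((\<lambda>s. pol n (X s) \<xi>) has_vector_derivative pol n X' \<xi>) (at s within S)"
  unfolding pol_def
proof (rule has_vector_derivative_sum)
  fix p assume "p \<in> {(j :: nat, k :: nat). j + k \<le> n}"
  then show "((\<lambda>s. case p of (j, k) \<Rightarrow> (\<xi> ^ j * cnj \<xi> ^ k) *s X s j k) has_vector_derivative
      (case p of (j, k) \<Rightarrow> (\<xi> ^ j * cnj \<xi> ^ k) *s X' j k)) (at s within S)"
    by (auto intro!: bounded_linear.has_vector_derivative[OF bounded_bilinear.bounded_linear_right[OF bounded_bilinear_smult]] assms)
qed

text \<open>Let I be the integral of X from a. By the mean value inequality and the uniform
  expansion of g, the difference f t \<xi> - f a \<xi> has the coefficients I t; it also has the
  coefficients Z t - Z a. Uniqueness equates the two, and the fundamental theorem of calculus gives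
  the derivative of Z.\<close>

lemma uexp_coeff_has_vector_derivative:
  fixes f g :: "real \<Rightarrow> complex \<Rightarrow> complex^'n"
  assumes "r0 > 0"
    and df: "\<And>s \<xi>. s \<in> {a..b} \<Longrightarrow> norm \<xi> < r0 \<Longrightarrow>
      ((\<lambda>s. f s \<xi>) has_vector_derivative g s \<xi>) (at s within {a..b})"
    and g: "uexp n {a..b} g X"
    and cont: "\<And>j k. continuous_on {a..b} (\<lambda>s. X s j k)"
    and f: "\<And>s. s \<in> {a..b} \<Longrightarrow> uexp n {s} f Z"
    and s: "s \<in> {a..b}" and jk: "j + k \<le> n"
  shows "((\<lambda>s. Z s j k) has_vector_derivative X s j k) (at s within {a..b})"
proof -
  define I where "I s j k = integral {a..s} (\<lambda>s. X s j k)" for s j k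
  have dI: "((\<lambda>s. I s j k) has_vector_derivative X s j k) (at s within {a..b})" if "s \<in> {a..b}" for s j k
    unfolding I_def by (rule integral_has_vector_derivative[OF cont that])
  have I: "Z t j k - Z a j k = I t j k" if t: "t \<in> {a..b}" for t
  proof -
    have a: "a \<in> {a..b}" using t by auto
    have "uexp n {t} (\<lambda>_ \<xi>. f t \<xi> - f a \<xi>) (\<lambda>_ j k. Z t j k - Z a j k)"
    proof -
      have "uexp n {t} (\<lambda>_ \<xi>. f t \<xi>) (\<lambda>_. Z t)" "uexp n {t} (\<lambda>_ \<xi>. f a \<xi>) (\<lambda>_. Z a)"
        using f[OF t] f[OF a] by (simp_all add: uexp_def)
      then show ?thesis by (rule uexp_diff)
    qed
    moreover have "uexp n {t} (\<lambda>_ \<xi>. f t \<xi> - f a \<xi>) (\<lambda>_. I t)"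
      unfolding uexp_def
    proof (intro allI impI)
      fix \<eta> :: real assume \<eta>: "\<eta> > 0"
      \<comment> \<open>The error is multiplied by the length of the parameter interval; adding 1
        keeps the divisor positive when a = b.\<close>
      define \<eta>' where "\<eta>' = \<eta> / (b - a + 1)"
      have ab: "b - a + 1 > 0" using t by auto
      then have "\<eta>' > 0" using \<eta> by (simp add: \<eta>'_def)
      then obtain r where r: "r > 0" "\<And>s \<xi>. s \<in> {a..b} \<Longrightarrow> norm \<xi> < r \<Longrightarrow> norm (g s \<xi> - pol n (X s) \<xi>) \<le> \<eta>' * norm \<xi> ^ n"
        using g unfolding uexp_def by meson
      have "norm (f t \<xi> - f a \<xi> - pol n (I t) \<xi>) \<le> \<eta> * norm \<xi> ^ n" if \<xi>: "norm \<xi> < min r r0" for \<xi>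
      proof -
        define \<psi> where "\<psi> s = f s \<xi> - pol n (I s) \<xi>" for s
        have d\<psi>: "(\<psi> has_vector_derivative g s \<xi> - pol n (X s) \<xi>) (at s within {a..b})" if "s \<in> {a..b}" for s
          unfolding \<psi>_def using \<xi> that
          by (intro has_vector_derivative_diff df pol_has_vector_derivative dI) auto
        have "norm (\<psi> t - \<psi> a) \<le> (\<eta>' * norm \<xi> ^ n) * norm (t - a)"
        proof (rule differentiable_bound[where S = "{a..b}"])
          show "(\<psi> has_derivative (\<lambda>h. h *\<^sub>R (g s \<xi> - pol n (X s) \<xi>))) (at s within {a..b})" if "s \<in> {a..b}" for s
            using d\<psi>[OF that] by (simp add: has_vector_derivative_def)
          show "onorm (\<lambda>h. h *\<^sub>R (g s \<xi> - pol n (X s) \<xi>)) \<le> \<eta>' * norm \<xi> ^ n" if "s \<in> {a..b}" for s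
          proof (rule onorm_le)
            fix h :: real
            show "norm (h *\<^sub>R (g s \<xi> - pol n (X s) \<xi>)) \<le> \<eta>' * norm \<xi> ^ n * norm h"
              using mult_left_mono[OF r(2)[OF that, of \<xi>], of "\<bar>h\<bar>"] \<xi> by (simp add: mult_ac)
          qed
        qed (use t a in auto)
        also have "\<dots> \<le> (\<eta>' * norm \<xi> ^ n) * (b - a + 1)"
          using t \<open>\<eta>' > 0\<close> by (intro mult_left_mono) auto
        also have "\<dots> = \<eta> * norm \<xi> ^ n" using ab by (simp add: \<eta>'_def)
        also have "\<psi> t - \<psi> a = f t \<xi> - f a \<xi> - pol n (I t) \<xi>"
          by (simp add: \<psi>_def I_def pol_def)
        finally show ?thesis .
      qed
      then show "\<exists>r>0. \<forall>s\<in>{t}. \<forall>\<xi>. norm \<xi> < r \<longrightarrow> norm (f t \<xi> - f a \<xi> - pol n (I t) \<xi>) \<le> \<eta> * norm \<xi> ^ n"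
        using r(1) \<open>r0 > 0\<close> by (intro exI[of _ "min r r0"]) auto
    qed
    ultimately show ?thesis
      using uexp_unique[of n "{t}" _ "\<lambda>_ j k. Z t j k - Z a j k" "\<lambda>_. I t" t j k] jk by simp
  qed
  have "((\<lambda>s. Z a j k + I s j k) has_vector_derivative 0 + X s j k) (at s within {a..b})"
    by (intro has_vector_derivative_add has_vector_derivative_const dI s)
  then have "((\<lambda>s. Z a j k + I s j k) has_vector_derivative X s j k) (at s within {a..b})" by simp
  then show ?thesis
    by (rule has_vector_derivative_transform[OF s, rotated]) (metis I add.commute diff_add_cancel)
qed

text \<open>Euler's identity: a monomial of degree j + k is multiplied by its degree. The factor 1 /
  s is pulled out so that the result is again a polynomial at the point of the ray.\<close>

lemma pol_ray_has_vector_derivative: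
  assumes "s \<noteq> 0"
  shows "((\<lambda>s. pol n X (of_real s * \<xi>)) has_vector_derivative
     (1 / s) *\<^sub>R pol n (\<lambda>j k. of_nat (j + k) *s X j k) (of_real s * \<xi>)) (at s)"
  unfolding pol_def scaleR_sum_right
proof (rule has_vector_derivative_sum)
  fix p assume "p \<in> {(j :: nat, k :: nat). j + k \<le> n}"
  obtain j k where p: "p = (j, k)" by (cases p)
  have pow: "(of_real s * \<xi>) ^ j * cnj (of_real s * \<xi>) ^ k = of_real (s ^ (j + k)) * (\<xi> ^ j * cnj \<xi> ^ k)" for s :: real
    by (simp add: power_mult_distrib power_add mult_ac)
  have ds: "((\<lambda>s. complex_of_real (s ^ (j + k))) has_vector_derivative
      complex_of_real (real (j + k) * s ^ (j + k - 1))) (at s)"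
    by (intro has_vector_derivative_of_real) (auto intro!: derivative_eq_intros)
  have "((\<lambda>s. (complex_of_real (s ^ (j + k)) * (\<xi> ^ j * cnj \<xi> ^ k)) *s X j k) has_vector_derivative
      (complex_of_real (real (j + k) * s ^ (j + k - 1)) * (\<xi> ^ j * cnj \<xi> ^ k)) *s X j k) (at s)"
    by (intro bounded_linear.has_vector_derivative[OF bounded_bilinear.bounded_linear_left[OF bounded_bilinear_smult]]
        has_vector_derivative_mult_left ds)
  note dX = this
  have "real (j + k) * s ^ (j + k - 1) = (1 / s) * (real (j + k) * s ^ (j + k))"
    using assms by (cases "j + k") auto
  then have "complex_of_real (real (j + k) * s ^ (j + k - 1))
      = complex_of_real (1 / s) * (of_nat (j + k) * complex_of_real (s ^ (j + k)))"
    by (metis of_real_mult of_real_of_nat_eq)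
  then have "(complex_of_real (real (j + k) * s ^ (j + k - 1)) * (\<xi> ^ j * cnj \<xi> ^ k)) *s X j k
      = complex_of_real (1 / s) *s ((complex_of_real (s ^ (j + k)) * (\<xi> ^ j * cnj \<xi> ^ k)) *s (of_nat (j + k) *s X j k))"
    by (simp only: vec.scale_scale mult_ac)
  with dX show "((\<lambda>s. case p of (j, k) \<Rightarrow> ((of_real s * \<xi>) ^ j * cnj (of_real s * \<xi>) ^ k) *s X j k) has_vector_derivative
      (1 / s) *\<^sub>R (case p of (j, k) \<Rightarrow> ((of_real s * \<xi>) ^ j * cnj (of_real s * \<xi>) ^ k) *s (of_nat (j + k) *s X j k))) (at s)"
    unfolding p prod.case pow scaleR_eq_smult by (simp only:)
qed

text \<open>Induction on the class: the derivatives in the directions 1 and \<i> have expansions one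
  order lower, and integrating the radial derivative along rays gains the order back. The
  coefficients come out continuous in \<tau>, as the later integration in \<tau> requires.\<close>

lemma taylor_uexp:
  fixes G :: "real \<Rightarrow> complex \<Rightarrow> real^'n"
  assumes "\<delta> > 0" "Ck_on n (\<lambda>(\<tau>, \<xi>). G \<tau> \<xi>) (UNIV \<times> ball 0 \<delta>)"
  shows "\<exists>X. (\<forall>j k. continuous_on UNIV (\<lambda>\<tau>. X \<tau> j k)) \<and> (\<forall>a b. uexp n {a..b} (\<lambda>\<tau> \<xi>. cvec (G \<tau> \<xi>)) X)"
  using assms(2)
proof (induction n arbitrary: G)
  case 0
  have cont: "continuous_on (UNIV \<times> ball 0 \<delta>) (\<lambda>(\<tau>, \<xi>). G \<tau> \<xi>)" using 0 by simp
  define X where "X \<tau> (j :: nat) (k :: nat) = cvec (G \<tau> 0)" for \<tau> j k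
  have "continuous_on UNIV (\<lambda>\<tau>. (\<lambda>(\<tau>, \<xi>). G \<tau> \<xi>) (\<tau>, 0))"
    by (rule continuous_on_compose2[OF cont]) (use \<open>\<delta> > 0\<close> in \<open>auto intro!: continuous_intros\<close>)
  then have "continuous_on UNIV (\<lambda>\<tau>. X \<tau> j k)" for j k
    unfolding X_def by (intro bounded_linear.continuous_on[OF bounded_linear_cvec]) simp
  moreover have "uexp 0 {a..b} (\<lambda>\<tau> \<xi>. cvec (G \<tau> \<xi>)) X" for a b
    unfolding uexp_def
  proof (intro allI impI)
    fix \<eta> :: real assume \<eta>: "\<eta> > 0"
    have "uniformly_continuous_on ({a..b} \<times> cball 0 (\<delta> / 2)) (\<lambda>(\<tau>, \<xi>). G \<tau> \<xi>)"
      by (rule compact_uniformly_continuous[OF continuous_on_subset[OF cont]])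
        (use \<open>\<delta> > 0\<close> in \<open>auto intro!: compact_Times\<close>)
    then obtain d where d: "d > 0" "\<And>x y. x \<in> {a..b} \<times> cball 0 (\<delta> / 2) \<Longrightarrow> y \<in> {a..b} \<times> cball 0 (\<delta> / 2) \<Longrightarrow>
        dist y x < d \<Longrightarrow> dist ((\<lambda>(\<tau>, \<xi>). G \<tau> \<xi>) y) ((\<lambda>(\<tau>, \<xi>). G \<tau> \<xi>) x) < \<eta>"
      using \<eta> unfolding uniformly_continuous_on_def by meson
    show "\<exists>r>0. \<forall>s\<in>{a..b}. \<forall>\<xi>. norm \<xi> < r \<longrightarrow> norm (cvec (G s \<xi>) - pol 0 (X s) \<xi>) \<le> \<eta> * norm \<xi> ^ 0"
    proof (intro exI[of _ "min d (\<delta> / 2)"] conjI ballI allI impI)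
      fix s \<xi> assume s: "s \<in> {a..b}" and \<xi>: "norm (\<xi>::complex) < min d (\<delta> / 2)"
      have "dist (G s \<xi>) (G s 0) < \<eta>"
        using d(2)[of "(s, 0)" "(s, \<xi>)"] s \<xi> \<open>\<delta> > 0\<close> by (simp add: dist_Pair_Pair)
      moreover have "pol 0 (X s) \<xi> = cvec (G s 0)"
        by (simp add: pol_def X_def)
      ultimately show "norm (cvec (G s \<xi>) - pol 0 (X s) \<xi>) \<le> \<eta> * norm \<xi> ^ 0"
        by (simp add: dist_norm flip: cvec_simps)
    qed (use d \<open>\<delta> > 0\<close> in auto)
  qed
  ultimately show ?case by blast
next
  case (Suc n)
  define DG where "DG w \<tau> \<xi> = frechet_derivative (\<lambda>(\<tau>, \<xi>). G \<tau> \<xi>) (at (\<tau>, \<xi>)) w" for w \<tau> \<xi>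
  have diff: "(\<lambda>(\<tau>, \<xi>). G \<tau> \<xi>) differentiable at (\<tau>, \<xi>)" if "norm \<xi> < \<delta>" for \<tau> \<xi>
    using Suc.prems that by simp
  have "Ck_on n (\<lambda>(\<tau>, \<xi>). DG w \<tau> \<xi>) (UNIV \<times> ball 0 \<delta>)" for w
    using Suc.prems by (cases w) (simp add: DG_def split_def)
  from Suc.IH[OF this] obtain X1 X2 where
    X1: "\<And>j k. continuous_on UNIV (\<lambda>\<tau>. X1 \<tau> j k)" "\<And>a b. uexp n {a..b} (\<lambda>\<tau> \<xi>. cvec (DG (0, 1) \<tau> \<xi>)) X1" and
    X2: "\<And>j k. continuous_on UNIV (\<lambda>\<tau>. X2 \<tau> j k)" "\<And>a b. uexp n {a..b} (\<lambda>\<tau> \<xi>. cvec (DG (0, \<i>) \<tau> \<xi>)) X2"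
    by metis
  \<comment> \<open>A and B are the coefficients of the Wirtinger derivatives in \<xi> and in its
    conjugate.\<close>
  define A where "A \<tau> j k = (1/2) *s (X1 \<tau> j k - \<i> *s X2 \<tau> j k)" for \<tau> j k
  define B where "B \<tau> j k = (1/2) *s (X1 \<tau> j k + \<i> *s X2 \<tau> j k)" for \<tau> j k
  \<comment> \<open>Radial integration on coefficients: the part of degree j + k of the radial
    derivative is divided by its degree. A and B never have to be compared with each other.\<close>
  define X where "X \<tau> j k = (if j + k = 0 then cvec (G \<tau> 0)
     else (1 / of_nat (j + k)) *s (shift (A \<tau>) j k + shift_cnj (B \<tau>) j k))" for \<tau> j k
  have cont: "continuous_on UNIV (\<lambda>\<tau>. X \<tau> j k)" for j k
  proof -
    have "Ck_on (Suc n) (\<lambda>(\<tau>, \<xi>). G \<tau> \<xi>) (UNIV \<times> ball 0 \<delta>)" by (rule Suc.prems)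
    then have c: "continuous_on (UNIV \<times> ball 0 \<delta>) (\<lambda>(\<tau>, \<xi>). G \<tau> \<xi>)" by (rule Ck_on_continuous)
    have "continuous_on UNIV (\<lambda>\<tau>. (\<lambda>(\<tau>, \<xi>). G \<tau> \<xi>) (\<tau>, 0))"
      by (rule continuous_on_compose2[OF c]) (use \<open>\<delta> > 0\<close> in \<open>auto intro!: continuous_intros\<close>)
    then have "continuous_on UNIV (\<lambda>\<tau>. cvec (G \<tau> 0))"
      by (intro bounded_linear.continuous_on[OF bounded_linear_cvec]) simp
    moreover have cAB: "continuous_on UNIV (\<lambda>\<tau>. A \<tau> j k)" "continuous_on UNIV (\<lambda>\<tau>. B \<tau> j k)" for j k
      unfolding A_def B_def
      by (intro bounded_linear.continuous_on[OF bounded_bilinear.bounded_linear_right[OF bounded_bilinear_smult]]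
          continuous_intros X1 X2)+
    have "continuous_on UNIV (\<lambda>\<tau>. shift (A \<tau>) j k)" for j k
      unfolding shift_def by (cases "j = 0") (simp_all add: cAB)
    moreover have "continuous_on UNIV (\<lambda>\<tau>. shift_cnj (B \<tau>) j k)" for j k
      unfolding shift_cnj_def by (cases "k = 0") (simp_all add: cAB)
    ultimately show ?thesis
      unfolding X_def
      by (cases "j + k = 0") (auto intro!: bounded_linear.continuous_on[OF bounded_bilinear.bounded_linear_right[OF bounded_bilinear_smult]]
          continuous_intros)
  qed
  have polAB: "\<xi> *s pol n (A \<tau>) z + cnj \<xi> *s pol n (B \<tau>) z
      = complex_of_real (Re \<xi>) *s pol n (X1 \<tau>) z + complex_of_real (Im \<xi>) *s pol n (X2 \<tau>) z" for \<tau> \<xi> z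
    unfolding A_def B_def pol_smult pol_add pol_diff
    by (simp add: vec_eq_iff complex_eq_iff field_simps)
  have "uexp (Suc n) {a..b} (\<lambda>\<tau> \<xi>. cvec (G \<tau> \<xi>)) X" for a b
    unfolding uexp_def
  proof (intro allI impI)
    fix \<eta> :: real assume "\<eta> > 0"
    then have \<eta>: "\<eta> / 2 > 0" by simp
    obtain r1 where r1: "r1 > 0" "\<And>s \<xi>. s \<in> {a..b} \<Longrightarrow> norm \<xi> < r1 \<Longrightarrow>
        norm (cvec (DG (0, 1) s \<xi>) - pol n (X1 s) \<xi>) \<le> \<eta> / 2 * norm \<xi> ^ n"
      using X1(2)[of a b] \<eta> unfolding uexp_def by meson
    obtain r2 where r2: "r2 > 0" "\<And>s \<xi>. s \<in> {a..b} \<Longrightarrow> norm \<xi> < r2 \<Longrightarrow>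
        norm (cvec (DG (0, \<i>) s \<xi>) - pol n (X2 s) \<xi>) \<le> \<eta> / 2 * norm \<xi> ^ n"
      using X2(2)[of a b] \<eta> unfolding uexp_def by meson
    define r where "r = min \<delta> (min r1 r2)"
    have "norm (cvec (G \<tau> \<xi>) - pol (Suc n) (X \<tau>) \<xi>) \<le> \<eta> * norm \<xi> ^ Suc n"
      if \<tau>: "\<tau> \<in> {a..b}" and \<xi>: "norm \<xi> < r" for \<tau> \<xi>
    proof -
      have s\<xi>: "norm (of_real s * \<xi>) \<le> norm \<xi>" if "0 \<le> s" "s \<le> 1" for s :: real
        using that by (simp add: norm_mult mult_left_le_one_le)
      define \<psi> where "\<psi> s = cvec (G \<tau> (of_real s * \<xi>)) - pol (Suc n) (X \<tau>) (of_real s * \<xi>)" for s :: real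
      define \<psi>' where "\<psi>' s = complex_of_real (Re \<xi>) *s (cvec (DG (0, 1) \<tau> (of_real s * \<xi>)) - pol n (X1 \<tau>) (of_real s * \<xi>))
         + complex_of_real (Im \<xi>) *s (cvec (DG (0, \<i>) \<tau> (of_real s * \<xi>)) - pol n (X2 \<tau>) (of_real s * \<xi>))" for s :: real
      have dG: "((\<lambda>s. cvec (G \<tau> (of_real s * \<xi>))) has_vector_derivative
          complex_of_real (Re \<xi>) *s cvec (DG (0, 1) \<tau> (of_real s * \<xi>))
          + complex_of_real (Im \<xi>) *s cvec (DG (0, \<i>) \<tau> (of_real s * \<xi>))) (at s)" if s: "0 \<le> s" "s \<le> 1" for s
      proof -
        have diff': "(\<lambda>(\<tau>, \<xi>). G \<tau> \<xi>) differentiable at (\<tau>, of_real s * \<xi>)"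
          using diff[of "of_real s * \<xi>"] s\<xi>[OF s] \<xi> by (simp add: r_def)
        have "((\<lambda>s::real. (\<tau>, of_real s * \<xi>)) has_vector_derivative (0, \<xi>)) (at s)"
          by (intro has_vector_derivative_Pair has_vector_derivative_const)
            (auto intro!: derivative_eq_intros simp: has_vector_derivative_def scaleR_conv_of_real)
        from chain_frechet[where f = "\<lambda>(\<tau>, \<xi>). G \<tau> \<xi>", OF diff' this]
        have "((\<lambda>s. G \<tau> (of_real s * \<xi>)) has_vector_derivative DG (0, \<xi>) \<tau> (of_real s * \<xi>)) (at s)"
          by (simp add: DG_def)
        from bounded_linear.has_vector_derivative[OF bounded_linear_cvec this]
        have "((\<lambda>s. cvec (G \<tau> (of_real s * \<xi>))) has_vector_derivative cvec (DG (0, \<xi>) \<tau> (of_real s * \<xi>))) (at s)" .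
        moreover have "DG (0, \<xi>) \<tau> (of_real s * \<xi>) = Re \<xi> *\<^sub>R DG (0, 1) \<tau> (of_real s * \<xi>) + Im \<xi> *\<^sub>R DG (0, \<i>) \<tau> (of_real s * \<xi>)"
          unfolding DG_def by (rule frechet_derivative_complex_split[OF diff'])
        ultimately show ?thesis
          by (simp only: cvec_simps scaleR_eq_smult)
      qed
      have dpol: "((\<lambda>s. pol (Suc n) (X \<tau>) (of_real s * \<xi>)) has_vector_derivative
          complex_of_real (Re \<xi>) *s pol n (X1 \<tau>) (of_real s * \<xi>) + complex_of_real (Im \<xi>) *s pol n (X2 \<tau>) (of_real s * \<xi>)) (at s)"
        if "s \<noteq> 0" for s
      proof -
        have "(1 / s) *\<^sub>R pol (Suc n) (\<lambda>j k. of_nat (j + k) *s X \<tau> j k) (of_real s * \<xi>)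
          = (1 / s) *\<^sub>R pol (Suc n) (\<lambda>j k. shift (A \<tau>) j k + shift_cnj (B \<tau>) j k) (of_real s * \<xi>)"
          by (rule arg_cong[where f = "\<lambda>x. (1 / s) *\<^sub>R x"], rule pol_cong)
            (auto simp: X_def shift_def shift_cnj_def simp del: of_nat_add)
        also have "\<dots> = \<xi> *s pol n (A \<tau>) (of_real s * \<xi>) + cnj \<xi> *s pol n (B \<tau>) (of_real s * \<xi>)"
          unfolding pol_add pol_shift pol_shift_cnj scaleR_eq_smult using that
          by (simp add: vec.scale_right_distrib mult.assoc)
        also note polAB
        finally show ?thesis using pol_ray_has_vector_derivative[OF that, of "Suc n" "X \<tau>" \<xi>] by simp
      qed
      have cont\<psi>: "continuous_on {0..1} \<psi>"
        unfolding \<psi>_def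
      proof (rule continuous_on_diff)
        show "continuous_on {0..1} (\<lambda>s. cvec (G \<tau> (of_real s * \<xi>)))"
          using dG by (intro continuous_on_vector_derivative) (auto intro: has_vector_derivative_at_within)
        show "continuous_on {0..1} (\<lambda>s. pol (Suc n) (X \<tau>) (of_real s * \<xi>))"
          unfolding pol_def split_def
          by (intro continuous_on_sum bounded_linear.continuous_on[OF bounded_bilinear.bounded_linear_left[OF bounded_bilinear_smult]]
              continuous_intros)
      qed
      \<comment> \<open>The comparison uses derivatives at interior points only, since the formula
        for the polynomial part divides by s.\<close>
      have "norm (\<psi> 1 - \<psi> 0) \<le> (\<eta> * norm \<xi> ^ Suc n) * 1 - (\<eta> * norm \<xi> ^ Suc n) * 0"
      proof (rule differentiable_bound_general[where f' = \<psi>' and \<phi>' = "\<lambda>_. \<eta> * norm \<xi> ^ Suc n"])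
        fix s :: real assume s: "0 < s" "s < 1"
        show "(\<psi> has_vector_derivative \<psi>' s) (at s)"
          using has_vector_derivative_diff[OF dG dpol, of s] s
          by (simp add: \<psi>_def[abs_def] \<psi>'_def algebra_simps vec.scale_right_diff_distrib)
        show "((\<lambda>s. \<eta> * norm \<xi> ^ Suc n * s) has_vector_derivative \<eta> * norm \<xi> ^ Suc n) (at s)"
          by (auto intro!: derivative_eq_intros simp: has_vector_derivative_def)
        have z: "norm (of_real s * \<xi>) < r1" "norm (of_real s * \<xi>) < r2"
          using s\<xi>[of s] s \<xi> by (auto simp: r_def)
        have zn: "norm (of_real s * \<xi>) ^ n \<le> norm \<xi> ^ n"
          using s\<xi>[of s] s by (intro power_mono) auto
        have "norm (\<psi>' s) \<le> norm \<xi> * (\<eta> / 2 * norm \<xi> ^ n) + norm \<xi> * (\<eta> / 2 * norm \<xi> ^ n)"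
          unfolding \<psi>'_def
        proof (rule norm_triangle_le, rule add_mono)
          have "norm (cvec (DG (0, 1) \<tau> (of_real s * \<xi>)) - pol n (X1 \<tau>) (of_real s * \<xi>)) \<le> \<eta> / 2 * norm \<xi> ^ n"
            by (rule order_trans[OF r1(2)[OF \<tau> z(1)]]) (use zn \<eta> in simp)
          then show "norm (complex_of_real (Re \<xi>) *s (cvec (DG (0, 1) \<tau> (of_real s * \<xi>)) - pol n (X1 \<tau>) (of_real s * \<xi>)))
            \<le> norm \<xi> * (\<eta> / 2 * norm \<xi> ^ n)"
            unfolding norm_smult_complex by (intro mult_mono) (auto simp: abs_Re_le_cmod)
          have "norm (cvec (DG (0, \<i>) \<tau> (of_real s * \<xi>)) - pol n (X2 \<tau>) (of_real s * \<xi>)) \<le> \<eta> / 2 * norm \<xi> ^ n"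
            by (rule order_trans[OF r2(2)[OF \<tau> z(2)]]) (use zn \<eta> in simp)
          then show "norm (complex_of_real (Im \<xi>) *s (cvec (DG (0, \<i>) \<tau> (of_real s * \<xi>)) - pol n (X2 \<tau>) (of_real s * \<xi>)))
            \<le> norm \<xi> * (\<eta> / 2 * norm \<xi> ^ n)"
            unfolding norm_smult_complex by (intro mult_mono) (auto simp: abs_Im_le_cmod)
        qed
        then show "norm (\<psi>' s) \<le> \<eta> * norm \<xi> ^ Suc n" by (simp add: field_simps)
      qed (auto intro!: continuous_intros cont\<psi>)
      moreover have "\<psi> 0 = 0" by (simp add: \<psi>_def pol_0 X_def)
      ultimately show ?thesis by (simp add: \<psi>_def)
    qed
    moreover have "r > 0" using \<open>\<delta> > 0\<close> r1 r2 by (simp add: r_def)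
    ultimately show "\<exists>r>0. \<forall>s\<in>{a..b}. \<forall>\<xi>. norm \<xi> < r \<longrightarrow>
       norm (cvec (G s \<xi>) - pol (Suc n) (X s) \<xi>) \<le> \<eta> * norm \<xi> ^ Suc n" by blast
  qed
  with cont show ?case by blast
qed

text \<open>The modulus of the factor c s is merely bounded, so that dilations are covered as well
  as rotations. The bound is what keeps the radius uniform in s.\<close>

lemma uexp_rotate:
  fixes f :: "complex \<Rightarrow> complex^'n"
  assumes f: "uexp n {t} (\<lambda>_. f) (\<lambda>_. X)" and M: "\<And>s. s \<in> S \<Longrightarrow> norm (c s) \<le> M"
  shows "uexp n S (\<lambda>s \<xi>. f (c s * \<xi>)) (\<lambda>s j k. (c s ^ j * cnj (c s) ^ k) *s X j k)"
  unfolding uexp_def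
proof (intro allI impI)
  fix \<eta> :: real assume \<eta>: "\<eta> > 0"
  define M' where "M' = \<bar>M\<bar> + 1"
  have M': "M' > 0" "\<And>s. s \<in> S \<Longrightarrow> norm (c s) \<le> M'" using M by (auto simp: M'_def) (smt (verit) M)
  have "\<eta> / M' ^ n > 0" using \<eta> M' by simp
  then obtain r where r: "r > 0" "\<And>\<xi>. norm \<xi> < r \<Longrightarrow> norm (f \<xi> - pol n X \<xi>) \<le> \<eta> / M' ^ n * norm \<xi> ^ n"
    using f[unfolded uexp_def, rule_format, of "\<eta> / M' ^ n"] by auto
  show "\<exists>r>0. \<forall>s\<in>S. \<forall>\<xi>. norm \<xi> < r \<longrightarrow>
      norm (f (c s * \<xi>) - pol n (\<lambda>j k. (c s ^ j * cnj (c s) ^ k) *s X j k) \<xi>) \<le> \<eta> * norm \<xi> ^ n"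
  proof (intro exI[of _ "r / M'"] conjI ballI allI impI)
    fix s \<xi> assume s: "s \<in> S" and \<xi>: "norm (\<xi> :: complex) < r / M'"
    have le: "norm (c s * \<xi>) \<le> M' * norm \<xi>"
      unfolding norm_mult by (intro mult_right_mono M' s) simp
    then have "norm (c s * \<xi>) < r" using \<xi> M' by (simp add: field_simps)
    then have "norm (f (c s * \<xi>) - pol n X (c s * \<xi>)) \<le> \<eta> / M' ^ n * norm (c s * \<xi>) ^ n" by (rule r(2))
    also have "\<dots> \<le> \<eta> / M' ^ n * (M' * norm \<xi>) ^ n"
      using \<eta> M' le by (intro mult_left_mono power_mono) auto
    also have "\<dots> = \<eta> * norm \<xi> ^ n" using M' by (simp add: power_mult_distrib)
    also have "pol n X (c s * \<xi>) = pol n (\<lambda>j k. (c s ^ j * cnj (c s) ^ k) *s X j k) \<xi>"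
      by (simp add: pol_def power_mult_distrib mult_ac)
    finally show "norm (f (c s * \<xi>) - pol n (\<lambda>j k. (c s ^ j * cnj (c s) ^ k) *s X j k) \<xi>) \<le> \<eta> * norm \<xi> ^ n" .
  qed (use r M' in auto)
qed

text \<open>The coefficients are found by differentiating \<open>G \<tau> (exp (\<mu> s) \<xi>)\<close> with respect to s; the
  values 1 and \<open>\<i>\<close> of \<open>\<mu>\<close> give the radial and the angular derivative.\<close>

lemma uexp_euler_field:
  fixes G :: "real \<Rightarrow> complex \<Rightarrow> real^'n"
  assumes \<delta>: "\<delta> > 0" and C: "Ck_on (Suc n) (\<lambda>(\<tau>, \<xi>). G \<tau> \<xi>) (UNIV \<times> ball 0 \<delta>)"
    and G: "uexp (Suc n) {\<tau>} (\<lambda>\<tau> \<xi>. cvec (G \<tau> \<xi>)) X"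
  shows "uexp (Suc n) {\<tau>} (\<lambda>\<tau> \<xi>. cvec (frechet_derivative (\<lambda>(\<tau>, \<xi>). G \<tau> \<xi>) (at (\<tau>, \<xi>)) (0, \<mu> * \<xi>)))
     (\<lambda>\<tau> j k. (of_nat j * \<mu> + of_nat k * cnj \<mu>) *s X \<tau> j k)"
proof -
  define DG where "DG w \<tau> \<xi> = frechet_derivative (\<lambda>(\<tau>, \<xi>). G \<tau> \<xi>) (at (\<tau>, \<xi>)) w" for w \<tau> \<xi>
  have diff: "(\<lambda>(\<tau>, \<xi>). G \<tau> \<xi>) differentiable at (\<tau>, \<xi>)" if "norm \<xi> < \<delta>" for \<tau> \<xi>
    using C that by simp
  have "Ck_on n (\<lambda>(\<tau>, \<xi>). DG w \<tau> \<xi>) (UNIV \<times> ball 0 \<delta>)" for w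
    using C by (cases w) (simp add: DG_def split_def)
  from taylor_uexp[OF \<delta> this] obtain X1 X2 where
    X1: "\<And>a b. uexp n {a..b} (\<lambda>\<tau> \<xi>. cvec (DG (0, 1) \<tau> \<xi>)) X1" and
    X2: "\<And>a b. uexp n {a..b} (\<lambda>\<tau> \<xi>. cvec (DG (0, \<i>) \<tau> \<xi>)) X2"
    by metis
  define fA where "fA \<xi> = (1/2) *s (cvec (DG (0, 1) \<tau> \<xi>) - \<i> *s cvec (DG (0, \<i>) \<tau> \<xi>))" for \<xi>
  define fB where "fB \<xi> = (1/2) *s (cvec (DG (0, 1) \<tau> \<xi>) + \<i> *s cvec (DG (0, \<i>) \<tau> \<xi>))" for \<xi>
  define A where "A j k = (1/2) *s (X1 \<tau> j k - \<i> *s X2 \<tau> j k)" for j k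
  define B where "B j k = (1/2) *s (X1 \<tau> j k + \<i> *s X2 \<tau> j k)" for j k
  have X12: "uexp n {\<tau>} (\<lambda>_ \<xi>. cvec (DG (0, 1) \<tau> \<xi>)) (\<lambda>_. X1 \<tau>)" "uexp n {\<tau>} (\<lambda>_ \<xi>. cvec (DG (0, \<i>) \<tau> \<xi>)) (\<lambda>_. X2 \<tau>)"
    using X1[of \<tau> \<tau>] X2[of \<tau> \<tau>] by (auto simp: uexp_def)
  have DGz: "cvec (DG (0, z) \<tau> \<xi>) = z *s fA \<xi> + cnj z *s fB \<xi>" if "norm \<xi> < \<delta>" for z \<xi>
  proof -
    have "DG (0, z) \<tau> \<xi> = Re z *\<^sub>R DG (0, 1) \<tau> \<xi> + Im z *\<^sub>R DG (0, \<i>) \<tau> \<xi>"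
      unfolding DG_def by (rule frechet_derivative_complex_split[OF diff[OF that]])
    then show ?thesis
      by (simp add: cvec_simps fA_def fB_def scaleR_eq_smult) (simp add: vec_eq_iff complex_eq_iff field_simps)
  qed
  \<comment> \<open>The Wirtinger derivatives are expanded to order n only; the factors \<xi> and
    cnj \<xi> of the field raise this to order n + 1. It remains to express Z through X.\<close>
  define Z where "Z j k = \<mu> *s shift A j k + cnj \<mu> *s shift_cnj B j k" for j k
  have "uexp n {\<tau>} (\<lambda>_. fA) (\<lambda>_. A)" "uexp n {\<tau>} (\<lambda>_. fB) (\<lambda>_. B)"
    unfolding fA_def A_def fB_def B_def
    by (rule uexp_smult uexp_add uexp_diff X12)+
  then have "uexp (Suc n) {\<tau>} (\<lambda>_ \<xi>. \<mu> *s (\<xi> *s fA \<xi>) + cnj \<mu> *s (cnj \<xi> *s fB \<xi>)) (\<lambda>_. Z)"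
    unfolding Z_def by (intro uexp_add uexp_smult uexp_shift_Suc uexp_shift_cnj_Suc)
  then have Z: "uexp (Suc n) {\<tau>} (\<lambda>_ \<xi>. cvec (DG (0, \<mu> * \<xi>) \<tau> \<xi>)) (\<lambda>_. Z)"
    by (rule uexp_cong[OF _ \<delta>]) (auto simp: DGz)
  define c where "c s = exp (\<mu> * complex_of_real s)" for s :: real
  have nc: "norm (c s) \<le> exp (norm \<mu>)" if "s \<in> {0..1}" for s
  proof -
    have "norm (c s) \<le> exp (norm (\<mu> * complex_of_real s))" unfolding c_def by (rule norm_exp)
    also have "\<dots> \<le> exp (norm \<mu>)" using that by (simp add: norm_mult mult_left_le)
    finally show ?thesis .
  qed
  \<comment> \<open>For \<xi> of this size the curve exp (\<mu> s) \<xi> with s between 0 and 1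
    stays in the disc of radius \<delta>.\<close>
  define r0 where "r0 = \<delta> / exp (norm \<mu>)"
  have r0: "r0 > 0" using \<delta> by (simp add: r0_def)
  have eq: "(of_nat j * \<mu> + of_nat k * cnj \<mu>) *s X \<tau> j k = Z j k" if jk: "j + k \<le> Suc n" for j k
  proof -
    have dc: "(c has_vector_derivative \<mu> * c s) (at s within {0..1})" for s
      unfolding c_def by (rule has_vector_derivative_real_field) (auto intro!: derivative_eq_intros)
    \<comment> \<open>Along the curve the coefficient at (j, k) is X multiplied by exp ((j \<mu> + k
      cnj \<mu>) s). Its derivative at s = 0 is found twice: here through the expansion of the
      derivative, below directly from the exponential.\<close>
    have "((\<lambda>s. (c s ^ j * cnj (c s) ^ k) *s X \<tau> j k) has_vector_derivative (c 0 ^ j * cnj (c 0) ^ k) *s Z j k) (at 0 within {0..1})"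
    proof (rule uexp_coeff_has_vector_derivative[where f = "\<lambda>s \<xi>. cvec (G \<tau> (c s * \<xi>))"
          and Z = "\<lambda>s j k. (c s ^ j * cnj (c s) ^ k) *s X \<tau> j k"
          and g = "\<lambda>s \<xi>. cvec (DG (0, \<mu> * (c s * \<xi>)) \<tau> (c s * \<xi>))"
          and X = "\<lambda>s j k. (c s ^ j * cnj (c s) ^ k) *s Z j k", OF r0 _ _ _ _ _ jk])
      fix s :: real and \<xi> assume s: "s \<in> {0..1}" and \<xi>: "norm (\<xi>::complex) < r0"
      have "norm (c s * \<xi>) \<le> exp (norm \<mu>) * norm \<xi>"
        unfolding norm_mult by (intro mult_right_mono nc s) simp
      also have "\<dots> < \<delta>" using \<xi> by (simp add: r0_def field_simps)
      finally have d: "(\<lambda>(\<tau>, \<xi>). G \<tau> \<xi>) differentiable at (\<tau>, c s * \<xi>)" by (rule diff)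
      have "((\<lambda>s. (\<tau>, c s * \<xi>)) has_vector_derivative (0, \<mu> * c s * \<xi>)) (at s within {0..1})"
        by (intro has_vector_derivative_Pair has_vector_derivative_const has_vector_derivative_mult_left dc)
      from chain_frechet[where f = "\<lambda>(\<tau>, \<xi>). G \<tau> \<xi>" and p = "\<lambda>s. (\<tau>, c s * \<xi>)", OF d this]
      have "((\<lambda>s. G \<tau> (c s * \<xi>)) has_vector_derivative DG (0, \<mu> * (c s * \<xi>)) \<tau> (c s * \<xi>)) (at s within {0..1})"
        by (simp add: DG_def mult.assoc)
      then show "((\<lambda>s. cvec (G \<tau> (c s * \<xi>))) has_vector_derivative cvec (DG (0, \<mu> * (c s * \<xi>)) \<tau> (c s * \<xi>))) (at s within {0..1})"
        by (rule bounded_linear.has_vector_derivative[OF bounded_linear_cvec])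
    next
      show "uexp (Suc n) {0..1} (\<lambda>s \<xi>. cvec (DG (0, \<mu> * (c s * \<xi>)) \<tau> (c s * \<xi>))) (\<lambda>s j k. (c s ^ j * cnj (c s) ^ k) *s Z j k)"
        by (rule uexp_rotate[OF Z nc])
      show "continuous_on {0..1} (\<lambda>s. (c s ^ j * cnj (c s) ^ k) *s Z j k)" for j k
        unfolding c_def
        by (intro bounded_linear.continuous_on[OF bounded_bilinear.bounded_linear_left[OF bounded_bilinear_smult]] continuous_intros)
      fix s :: real assume s: "s \<in> {0..1}"
      have "uexp (Suc n) {\<tau>} (\<lambda>_ \<xi>. cvec (G \<tau> \<xi>)) (\<lambda>_. X \<tau>)" using G by (simp add: uexp_def)
      from uexp_rotate[OF this, of "{s}" c] nc[OF s]
      show "uexp (Suc n) {s} (\<lambda>s \<xi>. cvec (G \<tau> (c s * \<xi>))) (\<lambda>s j k. (c s ^ j * cnj (c s) ^ k) *s X \<tau> j k)"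
        by blast
    qed simp
    moreover have "((\<lambda>s. (c s ^ j * cnj (c s) ^ k) *s X \<tau> j k) has_vector_derivative
        (of_nat j * \<mu> + of_nat k * cnj \<mu>) *s X \<tau> j k) (at 0 within {0..1})"
    proof -
      have e: "c s ^ j * cnj (c s) ^ k = exp ((of_nat j * \<mu> + of_nat k * cnj \<mu>) * complex_of_real s)" for s :: real
        by (simp add: c_def exp_cnj exp_of_nat_mult[symmetric] exp_add[symmetric] algebra_simps)
      have "((\<lambda>s. exp ((of_nat j * \<mu> + of_nat k * cnj \<mu>) * complex_of_real s)) has_vector_derivative
          (of_nat j * \<mu> + of_nat k * cnj \<mu>) * exp ((of_nat j * \<mu> + of_nat k * cnj \<mu>) * complex_of_real 0)) (at 0 within {0..1})"
        by (rule has_vector_derivative_real_field) (auto intro!: derivative_eq_intros)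
      then show ?thesis
        unfolding e using bounded_linear.has_vector_derivative[OF bounded_bilinear.bounded_linear_left[OF bounded_bilinear_smult]]
        by fastforce
    qed
    ultimately have "(c 0 ^ j * cnj (c 0) ^ k) *s Z j k = (of_nat j * \<mu> + of_nat k * cnj \<mu>) *s X \<tau> j k"
      using vector_derivative_unique_within_closed_interval[of 0 "1::real" 0] by fastforce
    then show ?thesis by (simp add: c_def)
  qed
  have "uexp (Suc n) {\<tau>} (\<lambda>_ \<xi>. cvec (DG (0, \<mu> * \<xi>) \<tau> \<xi>)) (\<lambda>_ j k. (of_nat j * \<mu> + of_nat k * cnj \<mu>) *s X \<tau> j k)"
    by (rule uexp_cong[OF Z zero_less_one]) (simp_all only: singleton_iff eq)
  then show ?thesis by (simp add: uexp_def DG_def)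
qed

section \<open>The homological equation\<close>

lemma integral_from_zero_bound:
  fixes h :: "real \<Rightarrow> 'a::euclidean_space"
  assumes "continuous_on {-\<eta>..\<eta>} h" "\<And>s. s \<in> {-\<eta>..\<eta>} \<Longrightarrow> norm (h s) \<le> B" "s \<in> {-\<eta>..\<eta>}"
  shows "norm (integral {-\<eta>..s} h - integral {-\<eta>..0} h) \<le> B * \<eta>"
proof -
  \<comment> \<open>The difference is the integral between 0 and s; the mean value inequality covers
    both signs of s at once.\<close>
  have "norm (integral {-\<eta>..s} h - integral {-\<eta>..0} h) \<le> B * norm (s - 0)"
  proof (rule differentiable_bound[where S = "{-\<eta>..\<eta>}" and f' = "\<lambda>s x. x *\<^sub>R h s"])
    show "((\<lambda>s. integral {-\<eta>..s} h) has_derivative (\<lambda>x. x *\<^sub>R h s)) (at s within {-\<eta>..\<eta>})"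
      if "s \<in> {-\<eta>..\<eta>}" for s
      using integral_has_vector_derivative[OF assms(1) that] by (simp add: has_vector_derivative_def)
    show "onorm (\<lambda>x. x *\<^sub>R h s) \<le> B" if "s \<in> {-\<eta>..\<eta>}" for s
      by (rule onorm_le) (use mult_right_mono[OF assms(2)[OF that] abs_ge_zero] in \<open>auto simp: mult.commute\<close>)
  qed (use assms(3) in auto)
  also have "\<dots> \<le> B * \<eta>"
  proof (rule mult_left_mono)
    show "0 \<le> B" using assms(2)[OF assms(3)] norm_ge_zero order_trans by blast
  qed (use assms(3) in auto)
  finally show ?thesis .
qed

text \<open>Banach's fixed point theorem for the integral equation. The time interval is two-sided
  because the hypothesis on the restricted system speaks of two-sided derivatives on open intervals,
  and time 0 has to be an interior point.\<close>

lemma picard_local: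
  fixes f :: "'a::euclidean_space \<Rightarrow> 'a"
  assumes "r > 0" and lip: "\<And>y z. y \<in> cball x0 r \<Longrightarrow> z \<in> cball x0 r \<Longrightarrow> norm (f y - f z) \<le> L * norm (y - z)"
  shows "\<exists>\<eta>>0. \<exists>x. x 0 = x0 \<and> (\<forall>t\<in>{-\<eta><..<\<eta>}. x t \<in> cball x0 r \<and> (x has_vector_derivative f (x t)) (at t))"
proof -
  define L' where "L' = \<bar>L\<bar> + 1"
  have L': "L' > 0" "norm (f y - f z) \<le> L' * norm (y - z)" if "y \<in> cball x0 r" "z \<in> cball x0 r" for y z
    using order_trans[OF lip[OF that], of "L' * norm (y - z)"] mult_right_mono[of L L' "norm (y - z)"]
    by (auto simp: L'_def)
  have L'0: "L' > 0" by (simp add: L'_def)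
  define B where "B = norm (f x0) + L' * r"
  have B: "norm (f y) \<le> B" if "y \<in> cball x0 r" for y
  proof -
    have "norm (f y) \<le> norm (f x0) + norm (f y - f x0)" using norm_triangle_sub by blast
    also have "norm (f y - f x0) \<le> L' * norm (y - x0)" using L'(2)[OF that, of x0] \<open>r > 0\<close> by simp
    also have "L' * norm (y - x0) \<le> L' * r"
      using that L'0 by (intro mult_left_mono) (auto simp: dist_norm norm_minus_commute)
    finally show ?thesis by (simp add: B_def)
  qed
  have B0: "B > 0" using L'0 \<open>r > 0\<close> by (simp add: B_def add_nonneg_pos)
  \<comment> \<open>The first bound keeps the iterates in the ball of radius r, as B bounds f there;
    the second makes the iteration a contraction with factor 1/2.\<close>
  define \<eta> where "\<eta> = min (r / B) (1 / (2 * L'))"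
  have \<eta>: "\<eta> > 0" "B * \<eta> \<le> r" "L' * \<eta> \<le> 1 / 2"
    using B0 L'0 \<open>r > 0\<close> by (auto simp: \<eta>_def min_def field_simps)
  have contf: "continuous_on (cball x0 r) f"
  proof (rule lipschitz_on_continuous_on)
    show "L'-lipschitz_on (cball x0 r) f"
      using L'(2) L'0 by (intro lipschitz_onI) (auto simp: dist_norm)
  qed
  define X :: "(real \<Rightarrow>\<^sub>C 'a) set" where "X = cball (const_bcontfun x0) r"
  have X: "g \<in> X \<longleftrightarrow> (\<forall>t. apply_bcontfun g t \<in> cball x0 r)" for g :: "real \<Rightarrow>\<^sub>C 'a"
  proof
    assume "g \<in> X"
    then show "\<forall>t. apply_bcontfun g t \<in> cball x0 r"
      unfolding X_def using dist_bounded[of "const_bcontfun x0" _ g] by (auto intro: order_trans)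
  next
    assume "\<forall>t. apply_bcontfun g t \<in> cball x0 r"
    then show "g \<in> X" unfolding X_def by (auto intro!: dist_bound)
  qed
  \<comment> \<open>The space of bounded continuous functions has the whole line as domain, so time
    is clamped to the interval outside of which nothing is claimed.\<close>
  define cl where "cl t = max (-\<eta>) (min \<eta> t)" for t
  have cl: "cl t \<in> {-\<eta>..\<eta>}" for t using \<eta>(1) by (auto simp: cl_def)
  have contcl: "continuous_on UNIV cl" unfolding cl_def by (intro continuous_intros)
  define I where "I g s = integral {-\<eta>..s} (\<lambda>s. f (apply_bcontfun g s))" for g and s :: real
  have contfg: "continuous_on {-\<eta>..\<eta>} (\<lambda>s. f (apply_bcontfun g s))" if "g \<in> X" for g
    by (rule continuous_on_compose2[OF contf]) (use that X in auto)
  define \<Phi> where "\<Phi> g = Bcontfun (\<lambda>t. x0 + (I g (cl t) - I g 0))" for g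
  have \<Phi>: "apply_bcontfun (\<Phi> g) t = x0 + (I g (cl t) - I g 0)" if g: "g \<in> X" for g t
  proof -
    have c: "continuous_on {-\<eta>..\<eta>} (I g)"
      unfolding I_def by (intro indefinite_integral_continuous_1 integrable_continuous_interval contfg g)
    have "(\<lambda>t. x0 + (I g (cl t) - I g 0)) \<in> bcontfun"
    proof (rule bcontfun_normI)
      show "continuous_on UNIV (\<lambda>t. x0 + (I g (cl t) - I g 0))"
        by (intro continuous_intros continuous_on_compose2[OF c contcl]) (use cl in auto)
      show "norm (x0 + (I g (cl t) - I g 0)) \<le> norm x0 + B * \<eta>" for t
        unfolding I_def using g cl[of t] X B
        by (intro norm_triangle_le add_left_mono integral_from_zero_bound contfg) auto
    qed
    then show ?thesis by (simp add: \<Phi>_def Bcontfun_inverse)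
  qed
  have "\<exists>!g\<in>X. \<Phi> g = g"
  proof (rule Banach_fix[where c = "1/2"])
    show "complete X" unfolding X_def by (simp add: complete_eq_closed)
    show "X \<noteq> {}" using \<open>r > 0\<close> by (auto simp: X_def)
    show "\<Phi> ` X \<subseteq> X"
    proof
      fix g' assume "g' \<in> \<Phi> ` X"
      then obtain g where g: "g \<in> X" "g' = \<Phi> g" by auto
      have "norm (I g (cl t) - I g 0) \<le> B * \<eta>" for t
        unfolding I_def using g cl[of t] X B by (intro integral_from_zero_bound contfg) auto
      then have "norm (I g (cl t) - I g 0) \<le> r" for t using \<eta>(2) order_trans by blast
      then show "g' \<in> X" unfolding X g(2) by (simp add: \<Phi>[OF g(1)] dist_norm norm_minus_commute)
    qed
    show "dist (\<Phi> g) (\<Phi> g') \<le> 1/2 * dist g g'" if g: "g \<in> X" "g' \<in> X" for g g'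
    proof (rule dist_bound)
      fix t
      have i: "(\<lambda>s. f (apply_bcontfun g s)) integrable_on {-\<eta>..s}" if "g \<in> X" "s \<in> {-\<eta>..\<eta>}" for g s
        by (rule integrable_continuous_interval, rule continuous_on_subset[OF contfg[OF that(1)]]) (use that in auto)
      have "dist (apply_bcontfun (\<Phi> g) t) (apply_bcontfun (\<Phi> g') t)
          = norm (integral {-\<eta>..cl t} (\<lambda>s. f (apply_bcontfun g s) - f (apply_bcontfun g' s))
              - integral {-\<eta>..0} (\<lambda>s. f (apply_bcontfun g s) - f (apply_bcontfun g' s)))"
        using i[OF g(1), of "cl t"] i[OF g(2), of "cl t"] i[OF g(1), of 0] i[OF g(2), of 0] cl[of t] \<eta>(1)
        by (simp add: \<Phi> g dist_norm I_def integral_diff algebra_simps)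
      also have "\<dots> \<le> (L' * dist g g') * \<eta>"
      proof (rule integral_from_zero_bound)
        show "norm (f (apply_bcontfun g s) - f (apply_bcontfun g' s)) \<le> L' * dist g g'" for s
        proof -
          have "norm (f (apply_bcontfun g s) - f (apply_bcontfun g' s)) \<le> L' * norm (apply_bcontfun g s - apply_bcontfun g' s)"
            by (rule L'(2)) (use g X in auto)
          also have "\<dots> \<le> L' * dist g g'"
            using L'0 dist_bounded[of g s g'] by (simp add: dist_norm)
          finally show ?thesis .
        qed
      qed (use cl in \<open>auto intro!: continuous_intros contfg g\<close>)
      also have "\<dots> = (L' * \<eta>) * dist g g'" by simp
      also have "\<dots> \<le> 1/2 * dist g g'" using \<eta>(3) by (intro mult_right_mono) auto
      finally show "dist (apply_bcontfun (\<Phi> g) t) (apply_bcontfun (\<Phi> g') t) \<le> 1/2 * dist g g'" .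
    qed
  qed auto
  then obtain g where g: "g \<in> X" "\<Phi> g = g" by blast
  define x where "x = apply_bcontfun g"
  have x: "x t = x0 + (I g (cl t) - I g 0)" for t
    unfolding x_def using \<Phi>[OF g(1), of t] g(2) by simp
  have "x 0 = x0" using \<eta>(1) by (simp add: x cl_def)
  moreover have "x t \<in> cball x0 r \<and> (x has_vector_derivative f (x t)) (at t)" if t: "t \<in> {-\<eta><..<\<eta>}" for t
  proof
    show "x t \<in> cball x0 r" using g(1) X by (simp add: x_def)
    have "(I g has_vector_derivative f (x t)) (at t within {-\<eta>..\<eta>})"
      unfolding I_def x_def by (rule integral_has_vector_derivative[OF contfg[OF g(1)]]) (use t in auto)
    then have "(I g has_vector_derivative f (x t)) (at t)"
      using t by (simp add: at_within_Icc_at)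
    then have "((\<lambda>t. x0 + (I g t - I g 0)) has_vector_derivative f (x t)) (at t)"
      by (auto intro!: derivative_eq_intros simp: has_vector_derivative_def)
    then show "(x has_vector_derivative f (x t)) (at t)"
      by (rule has_vector_derivative_transform_within_open[where S = "{-\<eta><..<\<eta>}"])
        (use t in \<open>auto simp: x cl_def\<close>)
  qed
  ultimately show ?thesis using \<eta>(1) by blast
qed

text \<open>A class closed under sums, products and pairing that contains the maps of class 1 as
  well as the norm, so that the restricted field can be assembled term by term.\<close>

definition llip :: "('a::real_normed_vector \<Rightarrow> 'b::real_normed_vector) \<Rightarrow> 'a \<Rightarrow> bool" where
  "llip f x \<longleftrightarrow> (\<exists>r>0. \<exists>L. \<forall>y\<in>cball x r. \<forall>z\<in>cball x r. norm (f y - f z) \<le> L * norm (y - z))"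

lemma llipD:
  assumes "llip f x"
  shows "\<exists>r L K. r > 0 \<and> L \<ge> 0 \<and> K \<ge> 0 \<and>
    (\<forall>y\<in>cball x r. \<forall>z\<in>cball x r. norm (f y - f z) \<le> L * norm (y - z)) \<and>
    (\<forall>y\<in>cball x r. norm (f y) \<le> K)"
proof -
  obtain r L where r: "r > 0" "\<And>y z. y \<in> cball x r \<Longrightarrow> z \<in> cball x r \<Longrightarrow> norm (f y - f z) \<le> L * norm (y - z)"
    using assms unfolding llip_def by blast
  have L: "norm (f y - f z) \<le> \<bar>L\<bar> * norm (y - z)" if "y \<in> cball x r" "z \<in> cball x r" for y z
    using order_trans[OF r(2)[OF that] mult_right_mono[OF abs_ge_self norm_ge_zero]] .
  have "norm (f y) \<le> norm (f x) + \<bar>L\<bar> * r" if "y \<in> cball x r" for y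
  proof -
    have "norm (f y) \<le> norm (f x) + norm (f y - f x)" using norm_triangle_sub by blast
    also have "norm (f y - f x) \<le> \<bar>L\<bar> * norm (y - x)" using L[OF that, of x] r(1) by simp
    also have "\<bar>L\<bar> * norm (y - x) \<le> \<bar>L\<bar> * r"
      using that by (intro mult_left_mono) (auto simp: dist_norm norm_minus_commute)
    finally show ?thesis by simp
  qed
  then show ?thesis
    using r(1) L by (intro exI[of _ r] exI[of _ "\<bar>L\<bar>"] exI[of _ "norm (f x) + \<bar>L\<bar> * r"]) simp
qed

lemma llip_const: "llip (\<lambda>_. c) x"
  unfolding llip_def by (intro exI[of _ 1] exI[of _ 0] conjI) auto

lemma llip_bounded_linear:
  assumes "bounded_linear f"
  shows "llip f x"
proof -
  obtain K where K: "\<And>y. norm (f y) \<le> norm y * K" using bounded_linear.bounded[OF assms] by blast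
  have "norm (f y - f z) \<le> K * norm (y - z)" for y z
    using K[of "y - z"] by (simp add: linear_simps(2)[OF assms] mult.commute)
  then show ?thesis unfolding llip_def by (intro exI[of _ 1] exI[of _ K]) auto
qed

lemma llip_add:
  assumes "llip f x" "llip g x"
  shows "llip (\<lambda>y. f y + g y) x"
proof -
  obtain r L K where f: "r > 0" "L \<ge> 0" "K \<ge> 0"
    "\<And>y z. y \<in> cball x r \<Longrightarrow> z \<in> cball x r \<Longrightarrow> norm (f y - f z) \<le> L * norm (y - z)"
    "\<And>y. y \<in> cball x r \<Longrightarrow> norm (f y) \<le> K"
    using llipD[OF assms(1)] by blast
  obtain r' L' K' where g: "r' > 0" "L' \<ge> 0" "K' \<ge> 0"
    "\<And>y z. y \<in> cball x r' \<Longrightarrow> z \<in> cball x r' \<Longrightarrow> norm (g y - g z) \<le> L' * norm (y - z)"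
    "\<And>y. y \<in> cball x r' \<Longrightarrow> norm (g y) \<le> K'"
    using llipD[OF assms(2)] by blast
  have "norm ((f y + g y) - (f z + g z)) \<le> (L + L') * norm (y - z)"
    if "y \<in> cball x (min r r')" "z \<in> cball x (min r r')" for y z
  proof -
    have "norm ((f y - f z) + (g y - g z)) \<le> L * norm (y - z) + L' * norm (y - z)"
      using that by (intro norm_triangle_le add_mono f g) auto
    then show ?thesis by (simp add: algebra_simps)
  qed
  then show ?thesis unfolding llip_def using f(1) g(1)
    by (intro exI[of _ "min r r'"] conjI exI[of _ "L + L'"]) auto
qed

text \<open>Products need the boundedness on small balls that \<open>llipD\<close> adds to the
  Lipschitz estimate.\<close>

lemma llip_bilinear:
  assumes "bounded_bilinear pr" "llip f x" "llip g x"
  shows "llip (\<lambda>y. pr (f y) (g y)) x"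
proof -
  obtain C where C: "C \<ge> 0" "\<And>a b. norm (pr a b) \<le> norm a * norm b * C"
    using bounded_bilinear.nonneg_bounded[OF assms(1)] by blast
  obtain r L K where f: "r > 0" "L \<ge> 0" "K \<ge> 0"
    "\<And>y z. y \<in> cball x r \<Longrightarrow> z \<in> cball x r \<Longrightarrow> norm (f y - f z) \<le> L * norm (y - z)"
    "\<And>y. y \<in> cball x r \<Longrightarrow> norm (f y) \<le> K"
    using llipD[OF assms(2)] by blast
  obtain r' L' K' where g: "r' > 0" "L' \<ge> 0" "K' \<ge> 0"
    "\<And>y z. y \<in> cball x r' \<Longrightarrow> z \<in> cball x r' \<Longrightarrow> norm (g y - g z) \<le> L' * norm (y - z)"
    "\<And>y. y \<in> cball x r' \<Longrightarrow> norm (g y) \<le> K'"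
    using llipD[OF assms(3)] by blast
  have "norm (pr (f y) (g y) - pr (f z) (g z)) \<le> (L * K' * C + K * L' * C) * norm (y - z)"
    if "y \<in> cball x (min r r')" "z \<in> cball x (min r r')" for y z
  proof -
    have y: "y \<in> cball x r" "y \<in> cball x r'" and z: "z \<in> cball x r" "z \<in> cball x r'" using that by auto
    have "pr (f y) (g y) - pr (f z) (g z) = pr (f y - f z) (g y) + pr (f z) (g y - g z)"
      by (simp add: bounded_bilinear.diff_left[OF assms(1)] bounded_bilinear.diff_right[OF assms(1)])
    also have "norm \<dots> \<le> (L * norm (y - z)) * K' * C + K * (L' * norm (y - z)) * C"
      using f(2,3) g(2,3) C(1)
      by (intro norm_triangle_le add_mono order_trans[OF C(2)] mult_mono f(4) g(4) f(5) g(5) y z mult_nonneg_nonneg) auto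
    finally show ?thesis by (simp add: algebra_simps)
  qed
  then show ?thesis unfolding llip_def using f(1) g(1)
    by (intro exI[of _ "min r r'"] conjI exI[of _ "L * K' * C + K * L' * C"]) auto
qed

text \<open>\<open>Ck_on\<close> gives continuity of the derivative direction by direction. Summing
  bounds over a basis yields an operator bound on a compact ball, and the mean value inequality
  applies.\<close>

lemma llip_Ck:
  fixes f :: "'a::euclidean_space \<Rightarrow> 'b::real_normed_vector"
  assumes "Ck_on (Suc 0) f S" "open S" "x \<in> S"
  shows "llip f x"
proof -
  obtain r where r: "r > 0" "cball x r \<subseteq> S" using assms(2,3) open_contains_cball by blast
  have diff: "f differentiable at y" if "y \<in> cball x r" for y using assms(1) r that by auto
  have "\<exists>K. \<forall>y\<in>cball x r. norm (frechet_derivative f (at y) b) \<le> K" for b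
  proof -
    have "continuous_on (cball x r) (\<lambda>y. frechet_derivative f (at y) b)"
      by (rule continuous_on_subset[OF _ r(2)]) (use assms(1) in auto)
    then have "bounded ((\<lambda>y. frechet_derivative f (at y) b) ` cball x r)"
      by (intro compact_imp_bounded compact_continuous_image) auto
    then show ?thesis unfolding bounded_iff by auto
  qed
  then have "\<forall>b. \<exists>K. \<forall>y\<in>cball x r. norm (frechet_derivative f (at y) b) \<le> K" by blast
  then obtain K where K: "\<forall>b. \<forall>y\<in>cball x r. norm (frechet_derivative f (at y) b) \<le> K b"
    by (rule choice[THEN exE])
  have "norm (f y - f z) \<le> (\<Sum>b\<in>Basis. K b) * norm (y - z)" if yz: "y \<in> cball x r" "z \<in> cball x r" for y z
  proof (rule differentiable_bound[OF convex_cball _ _ yz])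
    fix y assume y: "y \<in> cball x r"
    show "(f has_derivative frechet_derivative f (at y)) (at y within cball x r)"
      using diff[OF y] frechet_derivative_works has_derivative_at_withinI by blast
    show "onorm (frechet_derivative f (at y)) \<le> (\<Sum>b\<in>Basis. K b)"
    proof (rule onorm_le)
      fix w
      note lin = linear_frechet_derivative[OF diff[OF y]]
      have "frechet_derivative f (at y) w = frechet_derivative f (at y) (\<Sum>b\<in>Basis. (w \<bullet> b) *\<^sub>R b)"
        by (simp add: euclidean_representation)
      also have "\<dots> = (\<Sum>b\<in>Basis. (w \<bullet> b) *\<^sub>R frechet_derivative f (at y) b)"
        by (simp add: linear_sum[OF lin] linear_scale[OF lin])
      also have "norm \<dots> \<le> (\<Sum>b\<in>Basis. norm w * K b)"
        by (rule order_trans[OF norm_sum sum_mono]) (use K y in \<open>auto intro!: mult_mono simp: Basis_le_norm\<close>)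
      finally show "norm (frechet_derivative f (at y) w) \<le> (\<Sum>b\<in>Basis. K b) * norm w"
        by (simp add: sum_distrib_left mult.commute)
    qed
  qed
  then show ?thesis unfolding llip_def using r(1) by blast
qed

lemma llip_norm_snd: "llip (\<lambda>x :: real \<times> complex. norm (snd x)) x"
  unfolding llip_def
proof (intro exI[of _ 1] conjI ballI)
  fix y z :: "real \<times> complex"
  have "\<bar>norm (snd y) - norm (snd z)\<bar> \<le> norm (snd (y - z))" by (simp add: norm_triangle_ineq3)
  also have "\<dots> \<le> norm (y - z)" by (metis norm_snd_le prod.collapse)
  finally show "norm (norm (snd y) - norm (snd z)) \<le> 1 * norm (y - z)" by simp
qed simp

lemma llip_power: "llip f x \<Longrightarrow> llip (\<lambda>y. f y ^ n :: real) x"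
  by (induction n) (auto intro: llip_const llip_bilinear[OF bounded_bilinear_mult])

lemma llip_of_real: "llip f x \<Longrightarrow> llip (\<lambda>y. complex_of_real (f y)) x"
  unfolding llip_def by (metis norm_of_real of_real_diff real_norm_def)

lemma llip_Pair:
  assumes "llip f x" "llip g x"
  shows "llip (\<lambda>y. (f y, g y)) x"
proof -
  obtain r L K where f: "r > 0" "L \<ge> 0" "K \<ge> 0"
    "\<And>y z. y \<in> cball x r \<Longrightarrow> z \<in> cball x r \<Longrightarrow> norm (f y - f z) \<le> L * norm (y - z)"
    "\<And>y. y \<in> cball x r \<Longrightarrow> norm (f y) \<le> K"
    using llipD[OF assms(1)] by blast
  obtain r' L' K' where g: "r' > 0" "L' \<ge> 0" "K' \<ge> 0"
    "\<And>y z. y \<in> cball x r' \<Longrightarrow> z \<in> cball x r' \<Longrightarrow> norm (g y - g z) \<le> L' * norm (y - z)"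
    "\<And>y. y \<in> cball x r' \<Longrightarrow> norm (g y) \<le> K'"
    using llipD[OF assms(2)] by blast
  have "norm ((f y, g y) - (f z, g z)) \<le> (L + L') * norm (y - z)"
    if "y \<in> cball x (min r r')" "z \<in> cball x (min r r')" for y z
  proof -
    have "norm ((f y, g y) - (f z, g z)) \<le> norm (f y - f z) + norm (g y - g z)"
      by (simp add: norm_Pair_le)
    also have "\<dots> \<le> L * norm (y - z) + L' * norm (y - z)"
      using that by (intro add_mono f g) auto
    finally show ?thesis by (simp add: algebra_simps)
  qed
  then show ?thesis unfolding llip_def using f(1) g(1)
    by (intro exI[of _ "min r r'"] conjI exI[of _ "L + L'"]) auto
qed

lemma homological_equation:
  fixes H :: "real \<Rightarrow> complex \<Rightarrow> real^'n" and p :: "real \<Rightarrow> complex \<Rightarrow> real"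
  assumes p: "Ck_on 1 (\<lambda>(\<tau>, \<xi>). p \<tau> \<xi>) (UNIV \<times> ball 0 \<delta>)"
    and q: "Ck_on 1 (\<lambda>(\<tau>, \<xi>). q \<tau> \<xi>) (UNIV \<times> ball 0 \<delta>)"
    and sol: "\<And>a b (\<tau> :: real \<Rightarrow> real) (\<xi> :: real \<Rightarrow> complex).
           (\<forall>t\<in>{a<..<b}.
              \<xi> t \<in> ball 0 \<delta> \<and>
              (\<tau> has_real_derivative
                 1 + \<alpha>1 * norm (\<xi> t) ^ 2 + \<alpha>2 * norm (\<xi> t) ^ 4 + p (\<tau> t) (\<xi> t)) (at t) \<and>
              (\<xi> has_vector_derivative
                 \<i> * \<omega> * \<xi> t + \<i> * c * \<xi> t * norm (\<xi> t) ^ 2 + e * \<xi> t * norm (\<xi> t) ^ 4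
                 + q (\<tau> t) (\<xi> t)) (at t))
           \<Longrightarrow> (\<forall>t\<in>{a<..<b}.
              ((\<lambda>s. cm_param u0 v H (\<tau> s) (\<xi> s)) has_vector_derivative
                 F (cm_param u0 v H (\<tau> t) (\<xi> t))) (at t))"
    and H: "(\<lambda>(\<tau>, \<xi>). H \<tau> \<xi>) differentiable at (\<tau>0, \<xi>0)"
    and u0: "(u0 has_vector_derivative u0') (at \<tau>0)"
    and v: "(v has_vector_derivative v') (at \<tau>0)"
    and \<xi>0: "norm \<xi>0 < \<delta>"
    and a: "a = 1 + \<alpha>1 * norm \<xi>0 ^ 2 + \<alpha>2 * norm \<xi>0 ^ 4 + p \<tau>0 \<xi>0"
    and z: "z = \<i> * \<omega> * \<xi>0 + \<i> * c * \<xi>0 * norm \<xi>0 ^ 2 + e * \<xi>0 * norm \<xi>0 ^ 4 + q \<tau>0 \<xi>0"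
  shows "F (cm_param u0 v H \<tau>0 \<xi>0) = a *\<^sub>R (u0' + vRe (\<xi>0 *s v' + cnj \<xi>0 *s vcnj v'))
    + vRe (z *s v \<tau>0 + cnj z *s vcnj (v \<tau>0))
    + frechet_derivative (\<lambda>(\<tau>, \<xi>). H \<tau> \<xi>) (at (\<tau>0, \<xi>0)) (a, z)"
proof -
  define f where "f x = (1 + \<alpha>1 * norm (snd x) ^ 2 + \<alpha>2 * norm (snd x) ^ 4 + p (fst x) (snd x),
     \<i> * \<omega> * snd x + \<i> * c * snd x * complex_of_real (norm (snd x) ^ 2) + e * snd x * complex_of_real (norm (snd x) ^ 4)
       + q (fst x) (snd x))" for x
  define x0 where "x0 = (\<tau>0, \<xi>0)"
  have op: "open (UNIV \<times> ball 0 \<delta> :: (real \<times> complex) set)" by (intro open_Times) auto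
  have x0: "x0 \<in> UNIV \<times> ball 0 \<delta>" using \<xi>0 by (simp add: x0_def)
  have "llip (\<lambda>x. p (fst x) (snd x)) x0" "llip (\<lambda>x. q (fst x) (snd x)) x0"
    using llip_Ck[OF _ op x0] p q by (simp_all add: split_def)
  then have "llip f x0"
    unfolding f_def
    by (intro llip_Pair llip_add llip_const llip_bilinear[OF bounded_bilinear_mult] llip_power llip_norm_snd llip_of_real
        llip_bounded_linear[OF bounded_linear_snd])
  then obtain r1 L where r1: "r1 > 0"
    "\<And>y z. y \<in> cball x0 r1 \<Longrightarrow> z \<in> cball x0 r1 \<Longrightarrow> norm (f y - f z) \<le> L * norm (y - z)"
    unfolding llip_def by blast
  \<comment> \<open>The first radius provides the Lipschitz estimate, the second keeps the solution
    in the strip where the invariance hypothesis may be used.\<close>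
  obtain r2 where r2: "r2 > 0" "cball x0 r2 \<subseteq> UNIV \<times> ball 0 \<delta>"
    using op x0 open_contains_cball by blast
  have "\<exists>\<eta>>0. \<exists>x. x 0 = x0 \<and> (\<forall>t\<in>{-\<eta><..<\<eta>}. x t \<in> cball x0 (min r1 r2) \<and> (x has_vector_derivative f (x t)) (at t))"
    by (rule picard_local[where L = L]) (use r1 r2 in auto)
  then obtain \<eta> x where \<eta>: "\<eta> > 0" "x 0 = x0"
    "\<And>t. t \<in> {-\<eta><..<\<eta>} \<Longrightarrow> x t \<in> cball x0 (min r1 r2)"
    "\<And>t. t \<in> {-\<eta><..<\<eta>} \<Longrightarrow> (x has_vector_derivative f (x t)) (at t)" by blast
  have ball: "snd (x t) \<in> ball 0 \<delta>" if "t \<in> {-\<eta><..<\<eta>}" for t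
    using \<eta>(3)[OF that] r2(2) by (auto simp: mem_Times_iff)
  have d1: "((\<lambda>t. fst (x t)) has_vector_derivative fst (f (x t))) (at t)"
    and d2: "((\<lambda>t. snd (x t)) has_vector_derivative snd (f (x t))) (at t)" if "t \<in> {-\<eta><..<\<eta>}" for t
    using bounded_linear.has_vector_derivative[OF bounded_linear_fst \<eta>(4)[OF that]]
      bounded_linear.has_vector_derivative[OF bounded_linear_snd \<eta>(4)[OF that]] by auto
  have "\<forall>t\<in>{-\<eta><..<\<eta>}. ((\<lambda>s. cm_param u0 v H (fst (x s)) (snd (x s))) has_vector_derivative
                 F (cm_param u0 v H (fst (x t)) (snd (x t)))) (at t)"
    by (rule sol) (use ball d1 d2 in \<open>auto simp: f_def has_real_derivative_iff_has_vector_derivative\<close>)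
  \<comment> \<open>The velocity at time 0 as given by invariance; the chain rule computes the same
    derivative below.\<close>
  from bspec[OF this, of 0] \<eta> have D1: "((\<lambda>s. cm_param u0 v H (fst (x s)) (snd (x s))) has_vector_derivative
                 F (cm_param u0 v H \<tau>0 \<xi>0)) (at 0)"
    by (simp add: x0_def)
  have fx: "f (x 0) = (a, z)" using \<eta>(2) by (simp add: f_def x0_def a z)
  have x': "(x has_vector_derivative (a, z)) (at 0)" using \<eta>(4)[of 0] \<eta>(1) fx by simp
  have t': "((\<lambda>t. fst (x t)) has_vector_derivative a) (at 0)" and z': "((\<lambda>t. snd (x t)) has_vector_derivative z) (at 0)"
    using d1[of 0] d2[of 0] \<eta>(1) fx by simp_all
  have "((\<lambda>s. H (fst (x s)) (snd (x s))) has_vector_derivative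
     frechet_derivative (\<lambda>(\<tau>, \<xi>). H \<tau> \<xi>) (at (\<tau>0, \<xi>0)) (a, z)) (at 0)"
    using chain_frechet[where f = "\<lambda>(\<tau>, \<xi>). H \<tau> \<xi>" and p = x, OF _ x'] H \<eta>(2) by (simp add: x0_def split_def)
  moreover have u: "((\<lambda>s. u0 (fst (x s))) has_vector_derivative a *\<^sub>R u0') (at 0)"
    using vector_diff_chain_at[OF t', of u0 u0'] u0 \<eta>(2) by (simp add: x0_def o_def)
  moreover have vv: "((\<lambda>s. v (fst (x s))) has_vector_derivative a *\<^sub>R v') (at 0)"
    using vector_diff_chain_at[OF t', of v v'] v \<eta>(2) by (simp add: x0_def o_def)
  moreover have "((\<lambda>s. vRe (snd (x s) *s v (fst (x s)) + cnj (snd (x s)) *s vcnj (v (fst (x s))))) has_vector_derivative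
     vRe ((\<xi>0 *s (a *\<^sub>R v') + z *s v \<tau>0) + (cnj \<xi>0 *s vcnj (a *\<^sub>R v') + cnj z *s vcnj (v \<tau>0)))) (at 0)"
    using bounded_linear.has_vector_derivative[OF bounded_linear_vRe
        has_vector_derivative_add[OF bounded_bilinear.has_vector_derivative[OF bounded_bilinear_smult z' vv]
         bounded_bilinear.has_vector_derivative[OF bounded_bilinear_smult has_vector_derivative_cnj[OF z']
           bounded_linear.has_vector_derivative[OF bounded_linear_vcnj vv]]]] \<eta>(2)
    by (simp add: x0_def)
  ultimately have "((\<lambda>s. cm_param u0 v H (fst (x s)) (snd (x s))) has_vector_derivative
      a *\<^sub>R u0' + vRe ((\<xi>0 *s (a *\<^sub>R v') + z *s v \<tau>0) + (cnj \<xi>0 *s vcnj (a *\<^sub>R v') + cnj z *s vcnj (v \<tau>0)))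
      + frechet_derivative (\<lambda>(\<tau>, \<xi>). H \<tau> \<xi>) (at (\<tau>0, \<xi>0)) (a, z)) (at 0)"
    unfolding cm_param_def by (intro has_vector_derivative_add)
  from vector_derivative_unique_at[OF D1 this] show ?thesis
    by (simp add: vRe_simps vcnj_simps scaleR_eq_smult vcnj_smult)
      (simp add: vec_eq_iff vRe_def vcnj_def algebra_simps)
qed

section \<open>Expansion of the vector field\<close>

text \<open>For a multilinear N, \<open>faa g m N J K\<close> is the coefficient of \<open>\<xi> ^ J * cnj \<xi> ^ K\<close> in \<open>N [w, \<dots>, w]\<close>
  with m arguments \<open>w = (\<Sum>(j, k). (\<xi> ^ j * cnj \<xi> ^ k / (fact j * fact k)) *s g j k)\<close>, the sum
  being over \<open>(j, k) \<noteq> (0, 0)\<close>.\<close>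

fun faa :: "(nat \<Rightarrow> nat \<Rightarrow> complex^'n) \<Rightarrow> nat \<Rightarrow> ((complex^'n) list \<Rightarrow> complex^'n) \<Rightarrow> nat \<Rightarrow> nat \<Rightarrow> complex^'n" where
  "faa g 0 N J K = (if J = 0 \<and> K = 0 then N [] else 0)"
| "faa g (Suc m) N J K = (\<Sum>j\<le>J. \<Sum>k\<le>K. if j + k = 0 then 0 else
     (1 / (fact j * fact k)) *s faa g m (\<lambda>ws. N (g j k # ws)) (J - j) (K - k))"

context
  fixes N :: "(complex^'n) list \<Rightarrow> complex^'n" and g :: "nat \<Rightarrow> nat \<Rightarrow> complex^'n"
  assumes s2: "\<And>a b. N [a, b] = N [b, a]"
    and s3: "\<And>a b c. N [a, b, c] = N [b, a, c]" "\<And>a b c. N [a, b, c] = N [a, c, b]"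
    and s4: "\<And>a b c d. N [a, b, c, d] = N [b, a, c, d]" "\<And>a b c d. N [a, b, c, d] = N [a, c, b, d]"
      "\<And>a b c d. N [a, b, c, d] = N [a, b, d, c]"
    and s5: "\<And>a b c d e. N [a, b, c, d, e] = N [b, a, c, d, e]" "\<And>a b c d e. N [a, b, c, d, e] = N [a, c, b, d, e]"
      "\<And>a b c d e. N [a, b, c, d, e] = N [a, b, d, c, e]" "\<And>a b c d e. N [a, b, c, d, e] = N [a, b, c, e, d]"
begin

text \<open>The recursion is unfolded over all ordered choices and the symmetry of N collects equal
  terms; forms with more than J + K arguments contribute nothing. The prefactor is 1 / (J! K!), and
  the integers inside count set partitions of J elements marked \<xi> and K elements marked by its
  conjugate, a block with j and k of them giving \<open>g j k\<close>. The identities below have the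
  same origin.\<close>

lemma faa_1_1: "(\<Sum>m\<le>5. (1 / fact m) *s faa g m N 1 1) = (1/1) *s (N [g 1 1] + N [g 1 0, g 0 1])"
  by (simp add: vec_eq_iff eval_nat_numeral field_simps s2 s3 s4 s5)

lemma faa_2_0: "(\<Sum>m\<le>5. (1 / fact m) *s faa g m N 2 0) = (1/2) *s (N [g 2 0] + N [g 1 0, g 1 0])"
  by (simp add: vec_eq_iff eval_nat_numeral field_simps s2 s3 s4 s5)

lemma faa_2_1: "(\<Sum>m\<le>5. (1 / fact m) *s faa g m N 2 1) = (1/2) *s (N [g 2 1] + N [g 1 0, g 1 0, g 0 1] + 2 *s N [g 1 0, g 1 1] + N [g 0 1, g 2 0])"
  by (simp add: vec_eq_iff eval_nat_numeral field_simps s2 s3 s4 s5)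

lemma faa_3_0: "(\<Sum>m\<le>5. (1 / fact m) *s faa g m N 3 0) = (1/6) *s (N [g 3 0] + N [g 1 0, g 1 0, g 1 0] + 3 *s N [g 1 0, g 2 0])"
  by (simp add: vec_eq_iff eval_nat_numeral field_simps s2 s3 s4 s5)

lemma faa_3_1: "(\<Sum>m\<le>5. (1 / fact m) *s faa g m N 3 1) = (1/6) *s (N [g 3 1] + N [g 1 0, g 1 0, g 1 0, g 0 1] + 3 *s N [g 1 0, g 1 0, g 1 1] + 3 *s N [g 1 0, g 0 1, g 2 0] + 3 *s N [g 1 1, g 2 0] + 3 *s N [g 1 0, g 2 1] + N [g 0 1, g 3 0])"
  by (simp add: vec_eq_iff eval_nat_numeral field_simps s2 s3 s4 s5)

lemma faa_2_2: "(\<Sum>m\<le>5. (1 / fact m) *s faa g m N 2 2) = (1/4) *s (N [g 2 2] + N [g 1 0, g 1 0, g 0 1, g 0 1] + N [g 1 0, g 1 0, g 0 2] + 4 *s N [g 1 0, g 0 1, g 1 1] + N [g 0 1, g 0 1, g 2 0] + 2 *s N [g 1 1, g 1 1] + 2 *s N [g 1 0, g 1 2] + N [g 0 2, g 2 0] + 2 *s N [g 0 1, g 2 1])"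
  by (simp add: vec_eq_iff eval_nat_numeral field_simps s2 s3 s4 s5)

text \<open>An instance of the count: in the term with \<open>g 1 0, g 1 0, g 0 1, g 1 1\<close> the
  block of type (1, 1) can be chosen in 3 times 2 ways, hence the 6.\<close>

lemma faa_3_2: "(\<Sum>m\<le>5. (1 / fact m) *s faa g m N 3 2) = (1/12) *s (N [g 3 2]
   + N [g 1 0, g 1 0, g 1 0, g 0 1, g 0 1] + N [g 1 0, g 1 0, g 1 0, g 0 2]
   + 6 *s N [g 1 0, g 1 0, g 0 1, g 1 1] + 3 *s N [g 1 0, g 0 1, g 0 1, g 2 0]
   + 6 *s N [g 1 0, g 1 1, g 1 1] + 3 *s N [g 1 0, g 1 0, g 1 2] + 3 *s N [g 1 0, g 0 2, g 2 0]
   + 6 *s N [g 0 1, g 1 1, g 2 0] + 6 *s N [g 1 0, g 0 1, g 2 1] + N [g 0 1, g 0 1, g 3 0]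
   + 3 *s N [g 1 2, g 2 0] + 6 *s N [g 1 1, g 2 1] + 3 *s N [g 1 0, g 2 2] + N [g 0 2, g 3 0]
   + 2 *s N [g 0 1, g 3 1])"
  by (simp add: vec_eq_iff eval_nat_numeral field_simps s2 s3 s4 s5)

end

section \<open>Taylor expansion of F along the parametrization\<close>

lemma uexp_monomial:
  assumes f: "uexp n {t} f X"
  shows "uexp n {t} (\<lambda>s \<xi>. (\<xi> ^ j * cnj \<xi> ^ k) *s f s \<xi>)
     (\<lambda>s J K. if j \<le> J \<and> k \<le> K then X s (J - j) (K - k) else 0)"
proof (induction j)
  case 0
  show ?case
  proof (induction k)
    case 0
    then show ?case using f by simp
  next
    case (Suc k)
    show ?case
      by (rule uexp_cong[OF uexp_shift_cnj[OF Suc] zero_less_one]) (auto simp: shift_cnj_def mult_ac)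
  qed
next
  case (Suc j)
  show ?case
    by (rule uexp_cong[OF uexp_shift[OF Suc] zero_less_one]) (auto simp: shift_def mult_ac)
qed

lemma finite_degree_set1 [simp]: "finite {(j :: nat, k :: nat). 1 \<le> j + k \<and> j + k \<le> n}"
  by (rule finite_subset[OF _ finite_degree_set[of n]]) auto

text \<open>In contrast to \<open>pol\<close> this carries the Taylor factorials and no constant
  term: the form in which the displacement from the cycle is given.\<close>

definition cpoly :: "nat \<Rightarrow> (nat \<Rightarrow> nat \<Rightarrow> complex^'n) \<Rightarrow> complex \<Rightarrow> complex^'n" where
  "cpoly n g \<xi> = (\<Sum>(j, k)\<in>{(j, k). 1 \<le> j + k \<and> j + k \<le> n}. (\<xi> ^ j * cnj \<xi> ^ k / (fact j * fact k)) *s g j k)"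

lemma clinear_form_sum:
  assumes "clinear_form (Suc (length ws)) N" "finite I"
  shows "N ((\<Sum>i\<in>I. c i *s w i) # ws) = (\<Sum>i\<in>I. c i *s N (w i # ws))"
proof -
  have add: "N ((a + b) # ws) = N (a # ws) + N (b # ws)" and sc: "N ((c *s a) # ws) = c *s N (a # ws)" for a b c
    using assms(1)[unfolded clinear_form_def, rule_format, of "[]" ws] by auto
  have "N (0 # ws) = 0" using sc[of 0 0] by simp
  with \<open>finite I\<close> show ?thesis by (induction I rule: finite_induct) (auto simp: add sc)
qed

lemma clinear_form_Cons:
  assumes "clinear_form (Suc n) N"
  shows "clinear_form n (\<lambda>ws. N (w # ws))"
  unfolding clinear_form_def
proof (intro allI impI)
  fix pre ws :: "(complex^'a) list"
  assume "length pre + Suc (length ws) = n"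
  then show "(\<forall>a b. N (w # pre @ (a + b) # ws) = N (w # pre @ a # ws) + N (w # pre @ b # ws)) \<and>
     (\<forall>c a. N (w # pre @ (c *s a) # ws) = c *s N (w # pre @ a # ws))"
    using assms[unfolded clinear_form_def, rule_format, of "w # pre" ws] by simp
qed

text \<open>Induction on the number of arguments. The first argument is expanded by linearity, and
  each of its monomials shifts the expansion of the form with one argument fewer.\<close>

lemma uexp_faa:
  "clinear_form m N \<Longrightarrow> uexp n {t} (\<lambda>_ \<xi>. N (replicate m (cpoly n g \<xi>))) (\<lambda>_. faa g m N)"
proof (induction m arbitrary: N)
  case 0
  have "uexp n {t} (\<lambda>_. pol n (\<lambda>J K. if J = 0 \<and> K = 0 then N [] else 0)) (\<lambda>_ J K. if J = 0 \<and> K = 0 then N [] else 0)"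
    by (rule uexp_pol)
  moreover have "pol n (\<lambda>J K. if J = 0 \<and> K = 0 then N [] else 0) = (\<lambda>\<xi>. N [])"
  proof
    fix \<xi>
    have "pol n (\<lambda>J K. if J = 0 \<and> K = 0 then N [] else 0) \<xi> = (\<Sum>(j, k)\<in>{(0, 0)}. (\<xi> ^ j * cnj \<xi> ^ k) *s N [])"
      unfolding pol_def by (rule sum.mono_neutral_cong_right) (auto split: if_splits)
    then show "pol n (\<lambda>J K. if J = 0 \<and> K = 0 then N [] else 0) \<xi> = N []" by simp
  qed
  ultimately show ?case by simp
next
  case (Suc m)
  define I where "I = {(j :: nat, k :: nat). 1 \<le> j + k \<and> j + k \<le> n}"
  have fin: "finite I" unfolding I_def by (rule finite_degree_set1)
  define Z where "Z p J K = (1 / (fact (fst p) * fact (snd p))) *s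
     (if fst p \<le> J \<and> snd p \<le> K then faa g m (\<lambda>ws. N (g (fst p) (snd p) # ws)) (J - fst p) (K - snd p) else 0)"
    for p J K
  have "uexp n {t} (\<lambda>_ \<xi>. \<Sum>p\<in>I. (1 / (fact (fst p) * fact (snd p))) *s ((\<xi> ^ fst p * cnj \<xi> ^ snd p) *s
      N (g (fst p) (snd p) # replicate m (cpoly n g \<xi>)))) (\<lambda>_ J K. \<Sum>p\<in>I. Z p J K)"
    unfolding Z_def
    by (intro uexp_sum fin uexp_smult uexp_monomial Suc.IH clinear_form_Cons Suc.prems)
  then show ?case
  proof (rule uexp_cong[OF _ zero_less_one])
    fix \<xi> :: complex
    define c where "c p = \<xi> ^ fst p * cnj \<xi> ^ snd p / (fact (fst p) * fact (snd p))" for p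
    have cp: "cpoly n g \<xi> = (\<Sum>p\<in>I. c p *s g (fst p) (snd p))"
      by (simp add: cpoly_def c_def I_def split_def)
    have "N ((\<Sum>p\<in>I. c p *s g (fst p) (snd p)) # replicate m (cpoly n g \<xi>))
       = (\<Sum>p\<in>I. c p *s N (g (fst p) (snd p) # replicate m (cpoly n g \<xi>)))"
      by (rule clinear_form_sum) (simp_all add: Suc.prems fin)
    then have "N (cpoly n g \<xi> # replicate m (cpoly n g \<xi>))
       = (\<Sum>p\<in>I. (\<xi> ^ fst p * cnj \<xi> ^ snd p / (fact (fst p) * fact (snd p))) *s N (g (fst p) (snd p) # replicate m (cpoly n g \<xi>)))"
      unfolding cp[symmetric] by (simp only: c_def)
    then show "(\<Sum>p\<in>I. (1 / (fact (fst p) * fact (snd p))) *s ((\<xi> ^ fst p * cnj \<xi> ^ snd p) *s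
      N (g (fst p) (snd p) # replicate m (cpoly n g \<xi>)))) = N (replicate (Suc m) (cpoly n g \<xi>))"
      by simp
  next
    fix J K assume JK: "J + K \<le> n"
    \<comment> \<open>Pairs outside the box contribute 0. Since J + K \<le> n, the only pair of the
      box missing from I is (0, 0), which the recursion skips as well.\<close>
    have "(\<Sum>p\<in>I. Z p J K) = (\<Sum>p\<in>{..J} \<times> {..K}. if fst p + snd p = 0 then 0 else Z p J K)"
      using JK by (intro sum.mono_neutral_cong fin) (auto simp: I_def Z_def)
    also have "\<dots> = faa g (Suc m) N J K"
      unfolding faa.simps sum.cartesian_product by (rule sum.cong) (auto simp: Z_def)
    finally show "(\<Sum>p\<in>I. Z p J K) = faa g (Suc m) N J K" .
  qed
qed

lemma norm_cpoly_le:
  assumes "norm \<xi> \<le> 1"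
  shows "norm (cpoly n g \<xi>) \<le> (\<Sum>(j, k)\<in>{(j, k). 1 \<le> j + k \<and> j + k \<le> n}. norm (g j k)) * norm \<xi>"
proof -
  have "norm (cpoly n g \<xi>) \<le> (\<Sum>(j, k)\<in>{(j, k). 1 \<le> j + k \<and> j + k \<le> n}. norm (g j k) * norm \<xi>)"
    unfolding cpoly_def
  proof (rule order_trans[OF norm_sum sum_mono])
    fix p :: "nat \<times> nat" assume "p \<in> {(j, k). 1 \<le> j + k \<and> j + k \<le> n}"
    then obtain j k where p: "p = (j, k)" "Suc 0 \<le> j + k" by auto
    have "cmod (\<xi> ^ j * cnj \<xi> ^ k / (fact j * fact k)) = norm \<xi> ^ (j + k) / (fact j * fact k)"
      by (simp add: norm_mult norm_divide norm_power power_add norm_fact)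
    also have "\<dots> \<le> norm \<xi> ^ (j + k) / 1"
      by (intro divide_left_mono) (auto intro: mult_ge1_I[of "fact j" "fact k", simplified] simp: order_trans[OF _ mult_mono, of 1 1 "fact j" 1 "fact k"])
    also have "\<dots> \<le> norm \<xi>"
      using assms p(2) power_decreasing[of 1 "j + k" "norm \<xi>"] by simp
    finally show "norm (case p of (j, k) \<Rightarrow> (\<xi> ^ j * cnj \<xi> ^ k / (fact j * fact k)) *s g j k)
        \<le> (case p of (j, k) \<Rightarrow> norm (g j k) * norm \<xi>)"
      unfolding p(1) prod.case norm_smult_complex mult.commute[of "norm (g j k)"] by (rule mult_right_mono) simp
  qed
  then show ?thesis by (simp add: sum_distrib_right split_def)
qed

text \<open>Conjugation permutes the summands by exchanging j and k. The polynomial is therefore a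
  real vector, at which F can be evaluated.\<close>

lemma vcnj_cpoly:
  assumes "\<And>j k. vcnj (g j k) = g k j"
  shows "vcnj (cpoly n g \<xi>) = cpoly n g \<xi>"
proof -
  have "vcnj (cpoly n g \<xi>) = (\<Sum>(j, k)\<in>{(j, k). 1 \<le> j + k \<and> j + k \<le> n}. (cnj \<xi> ^ j * \<xi> ^ k / (fact j * fact k)) *s g k j)"
    unfolding cpoly_def linear_sum[OF bounded_linear.linear[OF bounded_linear_vcnj]]
    by (rule sum.cong) (auto simp: vcnj_smult assms)
  also have "\<dots> = cpoly n g \<xi>" unfolding cpoly_def
    by (rule sum.reindex_bij_witness[of _ "\<lambda>(j, k). (k, j)" "\<lambda>(j, k). (k, j)"]) (auto simp: mult.commute add.commute)
  finally show ?thesis .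
qed

text \<open>F is locally Lipschitz, so u may be replaced by its polynomial part up to order n + 1.
  Taylor's formula at x and the composition rule \<open>uexp_faa\<close> then give the
  coefficients.\<close>

lemma uexp_vector_field:
  fixes F :: "real^'n \<Rightarrow> real^'n"
  assumes F: "Ck_on (Suc n) F UNIV" and n: "n \<ge> 1" and g: "\<And>j k. vcnj (g j k) = g k j"
    and u: "\<And>\<xi>. norm \<xi> < r0 \<Longrightarrow> norm (cvec (u \<xi> - x) - cpoly n g \<xi>) \<le> M * norm \<xi> ^ Suc n" and "r0 > 0"
  shows "uexp n {t} (\<lambda>_ \<xi>. cvec (F (u \<xi>))) (\<lambda>_ J K. \<Sum>m\<le>n. (1 / fact m) *s faa g m (cderiv F x) J K)"
proof -
  define W where "W = cpoly n g"
  define S where "S = (\<Sum>(j, k)\<in>{(j, k). 1 \<le> j + k \<and> j + k \<le> n}. norm (g j k)) + 1"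
  have W: "norm (W \<xi>) \<le> S * norm \<xi>" if "norm \<xi> \<le> 1" for \<xi>
    unfolding W_def S_def by (rule order_trans[OF norm_cpoly_le[OF that]]) (simp add: algebra_simps)
  have S: "S > 0" unfolding S_def by (intro add_nonneg_pos sum_nonneg) auto
  have M': "norm (cvec (u \<xi> - x) - W \<xi>) \<le> (\<bar>M\<bar> + 1) * norm \<xi> ^ Suc n" if "norm \<xi> < r0" for \<xi>
    unfolding W_def by (rule order_trans[OF u[OF that] mult_right_mono]) auto
  have real: "cvec (vRe (W \<xi>)) = W \<xi>" for \<xi>
    unfolding W_def by (rule cvec_vRe[OF vcnj_cpoly[OF g]])
  have uW: "norm (u \<xi> - (x + vRe (W \<xi>))) \<le> (\<bar>M\<bar> + 1) * norm \<xi> ^ Suc n" if "norm \<xi> < r0" for \<xi>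
  proof -
    have "norm (u \<xi> - (x + vRe (W \<xi>))) = norm (cvec (u \<xi> - x - vRe (W \<xi>)))" by (simp add: algebra_simps)
    also have "\<dots> = norm (cvec (u \<xi> - x) - W \<xi>)" by (simp only: cvec_simps real)
    also note M'[OF that]
    finally show ?thesis .
  qed
  obtain rl L where l: "rl > 0" "\<And>y z. y \<in> cball x rl \<Longrightarrow> z \<in> cball x rl \<Longrightarrow> norm (F y - F z) \<le> L * norm (y - z)"
  proof -
    have "Ck_on (Suc 0) F UNIV" by (rule Ck_on_le[OF F]) simp
    then have "llip F x" by (rule llip_Ck) auto
    then show ?thesis using that unfolding llip_def by blast
  qed
  obtain K where K: "\<And>w. norm w \<le> 1 \<Longrightarrow>
     norm (F (x + w) - (\<Sum>m\<le>n. (1 / fact m) *\<^sub>R dir_deriv F (replicate m w) x)) \<le> K * norm w ^ Suc n"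
    using taylor_dir_deriv[OF F, of x] by blast
  define c where "c = min 1 rl"
  have c: "c > 0" "c \<le> 1" "c \<le> rl" using l(1) by (auto simp: c_def)
  \<comment> \<open>This radius keeps \<open>u \<xi>\<close> and x + w in the ball where F is
    Lipschitz and the norm of w below 1, as the Taylor estimate demands.\<close>
  define r where "r = min (min r0 1) (c / (\<bar>M\<bar> + 1 + S))"
  have r: "r > 0" using \<open>r0 > 0\<close> c S by (auto simp: r_def)
  have T: "uexp n {t} (\<lambda>_ \<xi>. \<Sum>m\<le>n. (1 / fact m) *s cderiv F x (replicate m (W \<xi>)))
     (\<lambda>_ J K. \<Sum>m\<le>n. (1 / fact m) *s faa g m (cderiv F x) J K)"
    unfolding W_def
  proof (intro uexp_sum uexp_smult uexp_faa)
    fix m assume "m \<in> {..n}"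
    then show "clinear_form m (cderiv F x)"
      unfolding cderiv_def by (intro clinear_form_cmultilinear mlinear_dir_deriv[OF F]) auto
  qed auto
  have "uexp n {t} (\<lambda>_ \<xi>. cvec (F (u \<xi>)) - (\<Sum>m\<le>n. (1 / fact m) *s cderiv F x (replicate m (W \<xi>)))) (\<lambda>_ _ _. 0)"
  proof (rule uexp_small[OF _ r])
    fix \<xi> :: complex assume \<xi>: "norm \<xi> < r"
    then have \<xi>1: "norm \<xi> \<le> 1" "norm \<xi> < r0" by (auto simp: r_def)
    have \<xi>c: "(\<bar>M\<bar> + 1 + S) * norm \<xi> \<le> c"
      using \<xi> S by (auto simp: r_def field_simps)
    define w where "w = vRe (W \<xi>)"
    have w: "norm w \<le> S * norm \<xi>" unfolding w_def using norm_vRe_le W[OF \<xi>1(1)] order_trans by blast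
    have wc: "norm w \<le> c" using w \<xi>c by (smt (verit) mult_nonneg_nonneg norm_ge_zero distrib_right)
    have pw: "norm \<xi> ^ Suc n \<le> norm \<xi>" using power_decreasing[of 1 "Suc n" "norm \<xi>"] \<xi>1 by simp
    have "norm (u \<xi> - (x + w)) \<le> (\<bar>M\<bar> + 1) * norm \<xi>"
      unfolding w_def by (rule order_trans[OF uW[OF \<xi>1(2)] mult_left_mono[OF pw]]) simp
    then have "norm ((u \<xi> - (x + w)) + w) \<le> (\<bar>M\<bar> + 1) * norm \<xi> + S * norm \<xi>"
      using w by (intro norm_triangle_le add_mono)
    also have "\<dots> \<le> c" using \<xi>c by (simp add: algebra_simps)
    finally have "norm (u \<xi> - x) \<le> c" by simp
    then have ub: "u \<xi> \<in> cball x rl" using c(3) by (simp add: dist_norm norm_minus_commute)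
    have xb: "x + w \<in> cball x rl" using wc c(3) by (simp add: dist_norm)
    have "norm (F (u \<xi>) - F (x + w)) \<le> \<bar>L\<bar> * norm (u \<xi> - (x + w))"
      by (rule order_trans[OF l(2)[OF ub xb] mult_right_mono]) auto
    also have "\<dots> \<le> \<bar>L\<bar> * ((\<bar>M\<bar> + 1) * norm \<xi> ^ Suc n)"
      unfolding w_def by (intro mult_left_mono uW \<xi>1) simp
    finally have 1: "norm (F (u \<xi>) - F (x + w)) \<le> \<bar>L\<bar> * (\<bar>M\<bar> + 1) * norm \<xi> ^ Suc n" by (simp add: mult.assoc)
    have "norm (F (x + w) - (\<Sum>m\<le>n. (1 / fact m) *\<^sub>R dir_deriv F (replicate m w) x)) \<le> \<bar>K\<bar> * norm w ^ Suc n"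
      by (rule order_trans[OF K mult_right_mono]) (use wc c(2) in auto)
    also have "\<dots> \<le> \<bar>K\<bar> * (S * norm \<xi>) ^ Suc n"
      using w by (intro mult_left_mono power_mono) auto
    finally have 2: "norm (F (x + w) - (\<Sum>m\<le>n. (1 / fact m) *\<^sub>R dir_deriv F (replicate m w) x)) \<le> \<bar>K\<bar> * S ^ Suc n * norm \<xi> ^ Suc n"
      by (simp add: power_mult_distrib mult_ac)
    \<comment> \<open>W is real, so on it the complex extension agrees with the real derivative in
      Taylor's formula.\<close>
    have "cderiv F x (replicate m (W \<xi>)) = cvec (dir_deriv F (replicate m w) x)" if "m \<le> n" for m
      unfolding cderiv_def using cmultilinear_cvec[of "replicate m w" "\<lambda>ws. dir_deriv F ws x"]
        mlinear_dir_deriv[OF F, of m x] that by (simp add: w_def real)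
    then have "(\<Sum>m\<le>n. (1 / fact m) *s cderiv F x (replicate m (W \<xi>)))
        = cvec (\<Sum>m\<le>n. (1 / fact m) *\<^sub>R dir_deriv F (replicate m w) x)"
      unfolding linear_sum[OF bounded_linear.linear[OF bounded_linear_cvec]]
      by (intro sum.cong) (auto simp: cvec_simps scaleR_eq_smult)
    then have "norm (cvec (F (u \<xi>)) - (\<Sum>m\<le>n. (1 / fact m) *s cderiv F x (replicate m (W \<xi>))))
       = norm ((F (u \<xi>) - F (x + w)) + (F (x + w) - (\<Sum>m\<le>n. (1 / fact m) *\<^sub>R dir_deriv F (replicate m w) x)))"
      by (simp add: cvec_simps(2)[symmetric])
    also have "\<dots> \<le> \<bar>L\<bar> * (\<bar>M\<bar> + 1) * norm \<xi> ^ Suc n + \<bar>K\<bar> * S ^ Suc n * norm \<xi> ^ Suc n"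
      by (intro norm_triangle_le add_mono 1 2)
    also have "\<dots> = (\<bar>L\<bar> * (\<bar>M\<bar> + 1) + \<bar>K\<bar> * S ^ Suc n) * norm \<xi> ^ Suc n" by (simp only: distrib_right)
    finally show "norm (cvec (F (u \<xi>)) - (\<Sum>m\<le>n. (1 / fact m) *s cderiv F x (replicate m (W \<xi>))))
       \<le> (\<bar>L\<bar> * (\<bar>M\<bar> + 1) + \<bar>K\<bar> * S ^ Suc n) * norm \<xi> ^ Suc n" .
  qed
  from uexp_add[OF T this] show ?thesis by simp
qed

section \<open>Comparison of coefficients\<close>

lemma has_vector_derivative_Un:
  "(f has_vector_derivative D) (at x within S) \<Longrightarrow> (f has_vector_derivative D) (at x within S')
   \<Longrightarrow> (f has_vector_derivative D) (at x within S \<union> S')"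
  unfolding has_vector_derivative_def has_derivative_within Lim_within_Un by blast

lemma has_vector_derivative_translate:
  fixes f :: "real \<Rightarrow> 'a::real_normed_vector"
  assumes "(f has_vector_derivative D) (at (x + d) within {a + d..b + d})"
  shows "((\<lambda>s. f (s + d)) has_vector_derivative D) (at x within {a..b})"
proof -
  have "((\<lambda>s. s + d) has_vector_derivative 1) (at x within {a..b})"
    by (auto intro!: derivative_eq_intros simp: has_vector_derivative_def)
  moreover have "(\<lambda>s. s + d) ` {a..b} = {a + d..b + d}" by simp
  ultimately show ?thesis
    using vector_diff_chain_within[of "\<lambda>s. s + d" 1 x "{a..b}" f D] assms by (simp add: o_def)
qed

text \<open>At the ends of the interval the equation gives one-sided derivatives only. Periodicity
  of f transports each of them to the other end, and D T = D 0 glues the two sides. Solutions of the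
  restricted system pass through such points, so a two-sided derivative of \<open>v\<close> is
  needed there.\<close>

lemma periodic_derivative:
  fixes f :: "real \<Rightarrow> 'a::real_normed_vector"
  assumes "T > 0" and per: "\<And>s. f (s + T) = f s"
    and d: "\<And>t. t \<in> {0..T} \<Longrightarrow> (f has_vector_derivative D t) (at t within {0..T})"
    and D: "D T = D 0" and t: "t \<in> {0..T}"
  shows "(f has_vector_derivative D t) (at t)"
proof -
  have left: "(f has_vector_derivative D 0) (at 0 within {-T..0})"
    using has_vector_derivative_translate[of f "D T" 0 T "-T" 0] d[of T] D per \<open>T > 0\<close> by simp
  have "(f has_vector_derivative D 0) (at 0 within {-T..0} \<union> {0..T})"
    using left d[of 0] \<open>T > 0\<close> by (intro has_vector_derivative_Un) auto
  also have "{-T..0} \<union> {0..T} = {-T..T}" using \<open>T > 0\<close> by auto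
  finally have 0: "(f has_vector_derivative D 0) (at 0 within {-T..T})" .
  have per': "f (s + (- T)) = f s" for s using per[of "s - T"] by simp
  have T: "(f has_vector_derivative D T) (at T within {0..T + T})"
    using has_vector_derivative_translate[of f "D 0" T "-T" 0 "T + T"] 0 D unfolding per' by simp
  consider "t = 0" | "t = T" | "0 < t" "t < T" using t by force
  then show ?thesis
  proof cases
    case 1
    then show ?thesis using 0 \<open>T > 0\<close> at_within_Icc_at[of "-T" 0 T] by simp
  next
    case 2
    then show ?thesis using T \<open>T > 0\<close> at_within_Icc_at[of 0 T "T + T"] by simp
  next
    case 3
    then show ?thesis using d[OF t] at_within_Icc_at[of 0 t T] by simp
  qed
qed

text \<open>All Taylor coefficients of the displacement from the cycle in one family:
  \<open>v\<close> and its conjugate fill degree 1, and no other entries outside degrees 2 to 5 are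
  nonzero.\<close>

definition hcoef :: "(real \<Rightarrow> complex^'n) \<Rightarrow> (nat \<Rightarrow> nat \<Rightarrow> real \<Rightarrow> complex^'n) \<Rightarrow> real \<Rightarrow> nat \<Rightarrow> nat \<Rightarrow> complex^'n" where
  "hcoef v h \<tau> j k = (if j = 1 \<and> k = 0 then v \<tau> else if j = 0 \<and> k = 1 then vcnj (v \<tau>)
     else if 2 \<le> j + k \<and> j + k \<le> 5 then h j k \<tau> else 0)"

lemma cpoly_hcoef:
  "cpoly 5 (hcoef v h \<tau>) \<xi> = \<xi> *s v \<tau> + cnj \<xi> *s vcnj (v \<tau>)
     + (\<Sum>(j, k)\<in>{(j, k). 2 \<le> j + k \<and> j + k \<le> 5}. (\<xi> ^ j * cnj \<xi> ^ k / (fact j * fact k)) *s h j k \<tau>)"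
proof -
  have eq: "{(j :: nat, k :: nat). 1 \<le> j + k \<and> j + k \<le> 5} = {(1, 0), (0, 1)} \<union> {(j, k). 2 \<le> j + k \<and> j + k \<le> 5}"
    by auto
  have fin: "finite {(j :: nat, k :: nat). 2 \<le> j + k \<and> j + k \<le> 5}"
    by (rule finite_subset[OF _ finite_degree_set[of 5]]) auto
  have "(\<Sum>(j, k)\<in>{(j, k). 2 \<le> j + k \<and> j + k \<le> 5}. (\<xi> ^ j * cnj \<xi> ^ k / (fact j * fact k)) *s hcoef v h \<tau> j k)
     = (\<Sum>(j, k)\<in>{(j, k). 2 \<le> j + k \<and> j + k \<le> 5}. (\<xi> ^ j * cnj \<xi> ^ k / (fact j * fact k)) *s h j k \<tau>)"
    by (rule sum.cong) (auto simp: hcoef_def)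
  then show ?thesis
    unfolding cpoly_def eq by (subst sum.union_disjoint) (auto simp: fin, auto simp: hcoef_def)
qed

section \<open>Coefficients of the parametrization and of its derivatives\<close>

locale ch_data =
  fixes F :: "real^'n \<Rightarrow> real^'n"
    and u0 :: "real \<Rightarrow> real^'n"
    and T \<omega> \<delta> \<alpha>1 \<alpha>2 c :: real
    and e :: complex
    and v vs :: "real \<Rightarrow> complex^'n"
    and \<phi>s :: "real \<Rightarrow> real^'n"
    and H :: "real \<Rightarrow> complex \<Rightarrow> real^'n"
    and h :: "nat \<Rightarrow> nat \<Rightarrow> real \<Rightarrow> complex^'n"
  assumes smooth: "Ck_on 6 F UNIV"
    and cycle: "limit_cycle F u0 T"
    and eigenfunctions: "critical_eigenfunctions F u0 T \<omega> v \<phi>s vs"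
    and \<delta>: "\<delta> > 0"
    and manifold: "cm_expansion \<delta> T \<phi>s vs H h"
    and normal_form: "CH_normal_form \<delta> F u0 T \<omega> v H \<alpha>1 \<alpha>2 c e"
begin

abbreviation "A \<tau> \<equiv> cmat (jacobian F (at (u0 \<tau>)))"

lemma T: "T > 0" and u0: "(u0 has_vector_derivative F (u0 t)) (at t)" and u0_periodic: "u0 (t + T) = u0 t"
  using cycle by (auto simp: limit_cycle_def)

definition dv :: "real \<Rightarrow> complex^'n" where
  "dv \<tau> = A \<tau> *v v \<tau> - (\<i> * \<omega>) *s v \<tau>"

lemma v_derivative: "\<tau> \<in> {0..T} \<Longrightarrow> (v has_vector_derivative dv \<tau>) (at \<tau>)"
proof (rule periodic_derivative[OF T])
  show vT: "v (s + T) = v s" for s using eigenfunctions by (simp add: critical_eigenfunctions_def)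
  show "dv T = dv 0" using u0_periodic[of 0] vT[of 0] by (simp add: dv_def)
  fix t assume "t \<in> {0..T}"
  then obtain d where "(v has_vector_derivative d) (at t within {0..T})"
    "d - A t *v v t + (\<i> * \<omega>) *s v t = 0"
    using eigenfunctions unfolding critical_eigenfunctions_def solves_def by blast
  moreover from this(2) have "d = dv t" by (simp add: dv_def algebra_simps eq_neg_iff_add_eq_0)
  ultimately show "(v has_vector_derivative dv t) (at t within {0..T})" by simp
qed

lemma HC6: "Ck_on 6 (\<lambda>(\<tau>, \<xi>). H \<tau> \<xi>) (UNIV \<times> ball 0 \<delta>)"
  using manifold by (simp add: cm_expansion_def)

lemma H_differentiable: "norm \<xi> < \<delta> \<Longrightarrow> (\<lambda>(\<tau>, \<xi>). H \<tau> \<xi>) differentiable at (\<tau>, \<xi>)"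
  using HC6 by (simp add: eval_nat_numeral)

definition DH :: "real \<times> complex \<Rightarrow> real \<Rightarrow> complex \<Rightarrow> real^'n" where
  "DH w \<tau> \<xi> = frechet_derivative (\<lambda>(\<tau>, \<xi>). H \<tau> \<xi>) (at (\<tau>, \<xi>)) w"

lemma DH_Ck: "Ck_on 5 (\<lambda>(\<tau>, \<xi>). DH w \<tau> \<xi>) (UNIV \<times> ball 0 \<delta>)"
  using HC6 by (cases w) (simp add: DH_def split_def eval_nat_numeral)

lemma H_expansion:
  obtains M where "\<And>\<tau> \<xi>. norm \<xi> < \<delta> \<Longrightarrow> norm (cvec (H \<tau> \<xi>) -
     (\<Sum>(j, k) \<in> {(j, k). 2 \<le> j + k \<and> j + k \<le> 5}. (\<xi> ^ j * cnj \<xi> ^ k / (fact j * fact k)) *s h j k \<tau>)) \<le> M * norm \<xi> ^ 6"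
proof -
  obtain M where "\<forall>\<tau>. \<forall>\<xi>\<in>ball 0 \<delta>. norm (cvec (H \<tau> \<xi>) -
     (\<Sum>(j, k) \<in> {(j, k). 2 \<le> j + k \<and> j + k \<le> 5}. (\<xi> ^ j * cnj \<xi> ^ k / (fact j * fact k)) *s h j k \<tau>)) \<le> M * norm \<xi> ^ 6"
    using manifold[unfolded cm_expansion_def, THEN conjunct2, THEN conjunct2, THEN conjunct1] ..
  then show thesis by (intro that[of M]) simp
qed

lemma h_symmetric: "\<forall>j k. 2 \<le> j + k \<and> j + k \<le> 5 \<longrightarrow> h j k T = h j k 0 \<and> (\<forall>\<tau>. h j k \<tau> = vcnj (h k j \<tau>))"
  by (rule manifold[unfolded cm_expansion_def, THEN conjunct2, THEN conjunct2, THEN conjunct2, THEN conjunct1])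

lemma h_cnj: "2 \<le> j + k \<Longrightarrow> j + k \<le> 5 \<Longrightarrow> h j k \<tau> = vcnj (h k j \<tau>)"
  using h_symmetric by blast

lemma h_periodic: "2 \<le> j + k \<Longrightarrow> j + k \<le> 5 \<Longrightarrow> h j k T = h j k 0"
  using h_symmetric by blast

definition Hcoef :: "real \<Rightarrow> nat \<Rightarrow> nat \<Rightarrow> complex^'n" where
  "Hcoef \<tau> j k = (if 2 \<le> j + k \<and> j + k \<le> 5 then (1 / (fact j * fact k)) *s h j k \<tau> else 0)"

lemma pol_Hcoef: "pol 5 (Hcoef \<tau>) \<xi> =
  (\<Sum>(j, k) \<in> {(j, k). 2 \<le> j + k \<and> j + k \<le> 5}. (\<xi> ^ j * cnj \<xi> ^ k / (fact j * fact k)) *s h j k \<tau>)"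
  unfolding pol_def by (rule sum.mono_neutral_cong_right) (auto simp: Hcoef_def split: if_splits)

lemma H_uexp: "uexp 5 S (\<lambda>\<tau> \<xi>. cvec (H \<tau> \<xi>)) Hcoef"
proof -
  obtain M where M: "\<And>\<tau> \<xi>. norm \<xi> < \<delta> \<Longrightarrow> norm (cvec (H \<tau> \<xi>) -
     (\<Sum>(j, k) \<in> {(j, k). 2 \<le> j + k \<and> j + k \<le> 5}. (\<xi> ^ j * cnj \<xi> ^ k / (fact j * fact k)) *s h j k \<tau>)) \<le> M * norm \<xi> ^ 6"
    using H_expansion by blast
  have "uexp 5 S (\<lambda>\<tau> \<xi>. cvec (H \<tau> \<xi>) - pol 5 (Hcoef \<tau>) \<xi>) (\<lambda>_ _ _. 0)"
    by (rule uexp_small[OF _ \<delta>, where K = M]) (simp add: pol_Hcoef M)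
  from uexp_add[OF this uexp_pol[of 5 S Hcoef]] show ?thesis by simp
qed

definition h' :: "nat \<Rightarrow> nat \<Rightarrow> real \<Rightarrow> complex^'n" where
  "h' j k \<tau> = vector_derivative (h j k) (at \<tau> within {0..T})"

text \<open>The \<open>h j k\<close> are given only as coefficients of an expansion. The
  \<tau>-derivative of \<open>H\<close> is of class 5 and has an expansion with continuous
  coefficients; integrating these in \<tau> shows that each \<open>h j k\<close> is differentiable
  and identifies its derivative.\<close>

lemma
  assumes \<tau>: "\<tau> \<in> {0..T}"
  shows H_tau_uexp: "uexp 5 {\<tau>} (\<lambda>\<tau> \<xi>. cvec (DH (1, 0) \<tau> \<xi>))
      (\<lambda>\<tau> j k. if 2 \<le> j + k \<and> j + k \<le> 5 then (1 / (fact j * fact k)) *s h' j k \<tau> else 0)"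
    and h_derivative: "\<And>j k. 2 \<le> j + k \<Longrightarrow> j + k \<le> 5 \<Longrightarrow> (h j k has_vector_derivative h' j k \<tau>) (at \<tau> within {0..T})"
proof -
  obtain X where X: "\<And>j k. continuous_on UNIV (\<lambda>\<tau>. X \<tau> j k)" "\<And>a b. uexp 5 {a..b} (\<lambda>\<tau> \<xi>. cvec (DH (1, 0) \<tau> \<xi>)) X"
    using taylor_uexp[OF \<delta> DH_Ck] by blast
  have d: "((\<lambda>\<tau>. Hcoef \<tau> j k) has_vector_derivative X \<tau> j k) (at \<tau> within {0..T})" if "j + k \<le> 5" for j k
  proof (rule uexp_coeff_has_vector_derivative[OF \<delta> _ X(2) _ _ \<tau> that])
    fix s \<xi> assume \<xi>: "norm (\<xi> :: complex) < \<delta>"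
    have "((\<lambda>s. (s, \<xi>)) has_vector_derivative (1, 0)) (at s within {0..T})"
      by (intro has_vector_derivative_Pair has_vector_derivative_const has_vector_derivative_id)
    from chain_frechet[where f = "\<lambda>(\<tau>, \<xi>). H \<tau> \<xi>" and p = "\<lambda>s. (s, \<xi>)", OF H_differentiable[OF \<xi>] this]
    have "((\<lambda>s. H s \<xi>) has_vector_derivative DH (1, 0) s \<xi>) (at s within {0..T})"
      by (simp add: DH_def)
    then show "((\<lambda>s. cvec (H s \<xi>)) has_vector_derivative cvec (DH (1, 0) s \<xi>)) (at s within {0..T})"
      by (rule bounded_linear.has_vector_derivative[OF bounded_linear_cvec])
  qed (auto intro: continuous_on_subset[OF X(1)] H_uexp)
  have h: "(h j k has_vector_derivative (fact j * fact k) *s X \<tau> j k) (at \<tau> within {0..T})" if "2 \<le> j + k" "j + k \<le> 5" for j k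
  proof -
    have "((\<lambda>\<tau>. (fact j * fact k) *s Hcoef \<tau> j k) has_vector_derivative (fact j * fact k) *s X \<tau> j k) (at \<tau> within {0..T})"
      by (rule bounded_linear.has_vector_derivative[OF bounded_bilinear.bounded_linear_right[OF bounded_bilinear_smult] d[OF that(2)]])
    moreover have "(\<lambda>\<tau>. (fact j * fact k) *s Hcoef \<tau> j k) = h j k"
      using that by (simp add: Hcoef_def)
    ultimately show ?thesis by simp
  qed
  have h'X: "h' j k \<tau> = (fact j * fact k) *s X \<tau> j k" if "2 \<le> j + k" "j + k \<le> 5" for j k
    unfolding h'_def using vector_derivative_within_cbox[of 0 T \<tau> "h j k"] h[OF that] T \<tau> by simp
  show "(h j k has_vector_derivative h' j k \<tau>) (at \<tau> within {0..T})" if "2 \<le> j + k" "j + k \<le> 5" for j k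
    using h[OF that] h'X[OF that] by simp
  \<comment> \<open>\<open>H\<close> has no terms below degree 2, so the derivatives of these
    coefficients vanish too.\<close>
  have X0: "X \<tau> j k = 0" if "j + k < 2" for j k
  proof -
    have "((\<lambda>\<tau>. 0) has_vector_derivative X \<tau> j k) (at \<tau> within cbox 0 T)"
      using d[of j k] that by (simp add: Hcoef_def)
    then show ?thesis
      using vector_derivative_unique_within_closed_interval[of 0 T \<tau> "\<lambda>_. 0" "X \<tau> j k" 0] T \<tau> by simp
  qed
  have "uexp 5 {\<tau>} (\<lambda>\<tau> \<xi>. cvec (DH (1, 0) \<tau> \<xi>)) X" using X(2)[of \<tau> \<tau>] by simp
  then show "uexp 5 {\<tau>} (\<lambda>\<tau> \<xi>. cvec (DH (1, 0) \<tau> \<xi>))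
      (\<lambda>\<tau> j k. if 2 \<le> j + k \<and> j + k \<le> 5 then (1 / (fact j * fact k)) *s h' j k \<tau> else 0)"
    by (rule uexp_cong[OF _ zero_less_one]) (auto simp: h'X X0)
qed

definition U :: "real \<Rightarrow> nat \<Rightarrow> nat \<Rightarrow> complex^'n" where
  "U \<tau> j k = (1 / (fact j * fact k)) *s hcoef v h \<tau> j k"

text \<open>Coefficients of the \<tau>-derivative of the parametrization. The constant term F(u0) is
  the velocity of the cycle; it has no counterpart in \<open>U\<close>, as fields in \<xi>
  annihilate constants.\<close>

definition dU :: "real \<Rightarrow> nat \<Rightarrow> nat \<Rightarrow> complex^'n" where
  "dU \<tau> j k = (if j = 0 \<and> k = 0 then cvec (F (u0 \<tau>)) else if j = 1 \<and> k = 0 then dv \<tau>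
     else if j = 0 \<and> k = 1 then vcnj (dv \<tau>)
     else if 2 \<le> j + k \<and> j + k \<le> 5 then (1 / (fact j * fact k)) *s h' j k \<tau> else 0)"

lemma uexp_linear_part: "uexp 5 {t} (\<lambda>_ \<xi>. \<xi> *s a + cnj \<xi> *s b)
    (\<lambda>_ j k. if j = 1 \<and> k = 0 then a else if j = 0 \<and> k = 1 then b else 0)"
proof -
  have "pol 5 (\<lambda>j k. if j = 1 \<and> k = 0 then a else if j = 0 \<and> k = 1 then b else 0) \<xi> = \<xi> *s a + cnj \<xi> *s b" for \<xi>
  proof -
    have "pol 5 (\<lambda>j k. if j = 1 \<and> k = 0 then a else if j = 0 \<and> k = 1 then b else 0) \<xi>
      = (\<Sum>(j, k)\<in>{(1, 0), (0, 1)}. (\<xi> ^ j * cnj \<xi> ^ k) *s (if j = 1 \<and> k = 0 then a else if j = 0 \<and> k = 1 then b else 0))"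
      unfolding pol_def by (rule sum.mono_neutral_right) (auto split: if_splits)
    then show ?thesis by simp
  qed
  then show ?thesis
    using uexp_pol[of 5 "{t}" "\<lambda>_ j k. if j = 1 \<and> k = 0 then a else if j = 0 \<and> k = 1 then b else 0"] by simp
qed

lemma uexp_const: "uexp 5 {t} (\<lambda>_ \<xi>. a) (\<lambda>_ j k. if j = 0 \<and> k = 0 then a else (0 :: complex^'n))"
proof -
  have p: "pol 5 (\<lambda>j k. if j = 0 \<and> k = 0 then a else 0) = (\<lambda>\<xi>. a)"
  proof
    fix \<xi>
    have "pol 5 (\<lambda>j k. if j = 0 \<and> k = 0 then a else 0) \<xi> = (\<Sum>(j, k)\<in>{(0, 0)}. (\<xi> ^ j * cnj \<xi> ^ k) *s a)"
      unfolding pol_def by (rule sum.mono_neutral_cong_right) (auto split: if_splits)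
    then show "pol 5 (\<lambda>j k. if j = 0 \<and> k = 0 then a else 0) \<xi> = a" by simp
  qed
  show ?thesis
    using uexp_pol[of 5 "{t}" "\<lambda>_ j k. if j = 0 \<and> k = 0 then a else 0"] unfolding p .
qed

definition E0 :: "real \<Rightarrow> complex \<Rightarrow> complex^'n" where
  "E0 \<tau> \<xi> = cvec (F (u0 \<tau>)) + (\<xi> *s dv \<tau> + cnj \<xi> *s vcnj (dv \<tau>)) + cvec (DH (1, 0) \<tau> \<xi>)"

text \<open>Complexified derivative of the parametrization along the linear field that sends \<xi>
  to l \<xi>. The values l = \<i> and l = 1 give the angular and the radial part.\<close>

definition EL :: "complex \<Rightarrow> real \<Rightarrow> complex \<Rightarrow> complex^'n" where
  "EL l \<tau> \<xi> = (\<xi> *s (l *s v \<tau>) + cnj \<xi> *s (cnj l *s vcnj (v \<tau>))) + cvec (DH (0, l * \<xi>) \<tau> \<xi>)"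

lemma E0_uexp: "\<tau> \<in> {0..T} \<Longrightarrow> uexp 5 {\<tau>} (\<lambda>_ \<xi>. E0 \<tau> \<xi>) (\<lambda>_. dU \<tau>)"
proof -
  assume \<tau>: "\<tau> \<in> {0..T}"
  have "uexp 5 {\<tau>} (\<lambda>_ \<xi>. cvec (DH (1, 0) \<tau> \<xi>))
      (\<lambda>_ j k. if 2 \<le> j + k \<and> j + k \<le> 5 then (1 / (fact j * fact k)) *s h' j k \<tau> else 0)"
    using H_tau_uexp[OF \<tau>] by (simp add: uexp_def)
  from uexp_add[OF uexp_add[OF uexp_const uexp_linear_part] this]
  have "uexp 5 {\<tau>} (\<lambda>_. E0 \<tau>) (\<lambda>_ j k. (if j = 0 \<and> k = 0 then cvec (F (u0 \<tau>)) else 0)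
      + (if j = 1 \<and> k = 0 then dv \<tau> else if j = 0 \<and> k = 1 then vcnj (dv \<tau>) else 0)
      + (if 2 \<le> j + k \<and> j + k \<le> 5 then (1 / (fact j * fact k)) *s h' j k \<tau> else 0))"
    unfolding E0_def[abs_def] .
  then show ?thesis
    by (rule uexp_cong[OF _ zero_less_one]) (auto simp: dU_def)
qed

text \<open>The Euler field lemma with n = 4 gives order 5. Its weights also fit the linear part,
  where they are l and cnj l.\<close>

lemma EL_uexp: "uexp 5 {\<tau>} (\<lambda>_ \<xi>. EL l \<tau> \<xi>) (\<lambda>_ j k. (of_nat j * l + of_nat k * cnj l) *s U \<tau> j k)"
proof -
  have "Ck_on (Suc 4) (\<lambda>(\<tau>, \<xi>). H \<tau> \<xi>) (UNIV \<times> ball 0 \<delta>)" by (rule Ck_on_le[OF HC6]) simp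
  from uexp_euler_field[OF \<delta> this, of \<tau> Hcoef l] H_uexp[of "{\<tau>}"]
  have "uexp 5 {\<tau>} (\<lambda>_ \<xi>. cvec (DH (0, l * \<xi>) \<tau> \<xi>)) (\<lambda>_ j k. (of_nat j * l + of_nat k * cnj l) *s Hcoef \<tau> j k)"
    by (simp add: uexp_def DH_def)
  from uexp_add[OF uexp_linear_part this]
  have "uexp 5 {\<tau>} (\<lambda>_ \<xi>. EL l \<tau> \<xi>) (\<lambda>_ j k. (if j = 1 \<and> k = 0 then l *s v \<tau> else if j = 0 \<and> k = 1 then cnj l *s vcnj (v \<tau>) else 0)
     + (of_nat j * l + of_nat k * cnj l) *s Hcoef \<tau> j k)"
    unfolding EL_def .
  then show ?thesis
    by (rule uexp_cong[OF _ zero_less_one]) (auto simp: U_def hcoef_def Hcoef_def add_divide_distrib vec.scale_left_distrib)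
qed

lemma u_expansion:
  obtains M where "\<And>\<tau> \<xi>. norm \<xi> < \<delta> \<Longrightarrow>
    norm (cvec (cm_param u0 v H \<tau> \<xi> - u0 \<tau>) - cpoly 5 (hcoef v h \<tau>) \<xi>) \<le> M * norm \<xi> ^ Suc 5"
proof -
  obtain M where M: "\<And>\<tau> \<xi>. norm \<xi> < \<delta> \<Longrightarrow> norm (cvec (H \<tau> \<xi>) -
     (\<Sum>(j, k) \<in> {(j, k). 2 \<le> j + k \<and> j + k \<le> 5}. (\<xi> ^ j * cnj \<xi> ^ k / (fact j * fact k)) *s h j k \<tau>)) \<le> M * norm \<xi> ^ 6"
    using H_expansion by blast
  have "norm (cvec (cm_param u0 v H \<tau> \<xi> - u0 \<tau>) - cpoly 5 (hcoef v h \<tau>) \<xi>) \<le> M * norm \<xi> ^ Suc 5" if "norm \<xi> < \<delta>" for \<tau> \<xi>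
  proof -
    have "cvec (vRe (\<xi> *s v \<tau> + cnj \<xi> *s vcnj (v \<tau>))) = \<xi> *s v \<tau> + cnj \<xi> *s vcnj (v \<tau>)"
      by (rule cvec_vRe) (simp add: vcnj_simps vcnj_smult)
    then have "cvec (cm_param u0 v H \<tau> \<xi> - u0 \<tau>) - cpoly 5 (hcoef v h \<tau>) \<xi> = cvec (H \<tau> \<xi>) -
     (\<Sum>(j, k) \<in> {(j, k). 2 \<le> j + k \<and> j + k \<le> 5}. (\<xi> ^ j * cnj \<xi> ^ k / (fact j * fact k)) *s h j k \<tau>)"
      by (simp add: cm_param_def cpoly_hcoef cvec_simps)
    then show ?thesis using M[OF that] by simp
  qed
  then show ?thesis using that by blast
qed

lemma vcnj_hcoef: "vcnj (hcoef v h \<tau> j k) = hcoef v h \<tau> k j"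
  using h_cnj[of j k \<tau>] h_cnj[of k j \<tau>] by (auto simp: hcoef_def vcnj_simps add.commute)

abbreviation shift2 :: "(nat \<Rightarrow> nat \<Rightarrow> complex^'n) \<Rightarrow> nat \<Rightarrow> nat \<Rightarrow> complex^'n" where
  "shift2 X \<equiv> shift (shift_cnj X)"

lemma uexp_shift2:
  assumes "uexp 5 {\<tau>} (\<lambda>_. f) (\<lambda>_. X)"
  shows "uexp 5 {\<tau>} (\<lambda>_ \<xi>. complex_of_real (norm \<xi> ^ 2) *s f \<xi>) (\<lambda>_. shift2 X)"
  by (rule uexp_cong[OF uexp_shift[OF uexp_shift_cnj[OF assms]] zero_less_one])
    (simp_all only: complex_norm_square vec.scale_scale)

lemma DH_bounded: "\<exists>K\<ge>0. \<forall>\<xi>. norm \<xi> \<le> \<delta> / 2 \<longrightarrow> norm (DH w \<tau> \<xi>) \<le> K"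
proof -
  have "continuous_on (UNIV \<times> ball 0 \<delta>) (\<lambda>(\<tau>, \<xi>). DH w \<tau> \<xi>)" by (rule Ck_on_continuous[OF DH_Ck])
  then have "continuous_on ({\<tau>} \<times> cball 0 (\<delta> / 2)) (\<lambda>(\<tau>, \<xi>). DH w \<tau> \<xi>)"
    by (rule continuous_on_subset) (use \<delta> in auto)
  then have "bounded ((\<lambda>(\<tau>, \<xi>). DH w \<tau> \<xi>) ` ({\<tau>} \<times> cball 0 (\<delta> / 2)))"
    by (intro compact_imp_bounded compact_continuous_image compact_Times) auto
  then obtain K where "\<forall>\<xi>\<in>cball 0 (\<delta> / 2). norm (DH w \<tau> \<xi>) \<le> K" unfolding bounded_iff by auto
  then have "\<And>\<xi>. norm \<xi> \<le> \<delta> / 2 \<Longrightarrow> norm (DH w \<tau> \<xi>) \<le> K" by simp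
  then show ?thesis by (intro exI[of _ "max 0 K"]) (auto simp: le_max_iff_disj)
qed

text \<open>Up to the remainder, \<xi>' is (\<omega> + c |\<xi>|^2 + Im e |\<xi>|^4) times \<i>
  \<xi> plus Re e |\<xi>|^4 times \<xi>. The weights \<i> (j - k) and j + k are the action of the
  angular and the radial field on coefficients, and each factor |\<xi>|^2 is one
  \<open>shift2\<close>.\<close>

definition homological_coeff :: "real \<Rightarrow> nat \<Rightarrow> nat \<Rightarrow> complex^'n" where
  "homological_coeff \<tau> J K =
    dU \<tau> J K + complex_of_real \<alpha>1 *s shift2 (dU \<tau>) J K + complex_of_real \<alpha>2 *s shift2 (shift2 (dU \<tau>)) J K
      + (complex_of_real \<omega> *s ((\<i> * (of_nat J - of_nat K)) *s U \<tau> J K)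
      + complex_of_real c *s shift2 (\<lambda>j k. (\<i> * (of_nat j - of_nat k)) *s U \<tau> j k) J K
      + complex_of_real (Im e) *s shift2 (shift2 (\<lambda>j k. (\<i> * (of_nat j - of_nat k)) *s U \<tau> j k)) J K)
      + complex_of_real (Re e) *s shift2 (shift2 (\<lambda>j k. of_nat (j + k) *s U \<tau> j k)) J K"

text \<open>Both sides are coefficients of the same function, F along the parametrization: on the
  left through Taylor expansion of F, on the right through the homological equation.\<close>

lemma coefficient_identity:
  assumes \<tau>: "\<tau> \<in> {0..T}" and JK: "J + K \<le> 5"
  shows "(\<Sum>m\<le>5. (1 / fact m) *s faa (hcoef v h \<tau>) m (cderiv F (u0 \<tau>)) J K) = homological_coeff \<tau> J K"
proof -
  define V where "V = (\<lambda>j k. (\<i> * (of_nat j - of_nat k)) *s U \<tau> j k)"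
  define R where "R = (\<lambda>j k. of_nat (j + k) *s U \<tau> j k)"
  obtain p :: "real \<Rightarrow> complex \<Rightarrow> real" and q :: "real \<Rightarrow> complex \<Rightarrow> complex" and M where
    p: "Ck_on 1 (\<lambda>(\<tau>, \<xi>). p \<tau> \<xi>) (UNIV \<times> ball 0 \<delta>)" and
    q: "Ck_on 1 (\<lambda>(\<tau>, \<xi>). q \<tau> \<xi>) (UNIV \<times> ball 0 \<delta>)" and
    M: "\<forall>\<tau>. \<forall>\<xi>\<in>ball 0 \<delta>. \<bar>p \<tau> \<xi>\<bar> \<le> M * norm \<xi> ^ 6 \<and> norm (q \<tau> \<xi>) \<le> M * norm \<xi> ^ 6" and
    sol: "\<forall>a b (\<tau> :: real \<Rightarrow> real) (\<xi> :: real \<Rightarrow> complex).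
           (\<forall>t\<in>{a<..<b}.
              \<xi> t \<in> ball 0 \<delta> \<and>
              (\<tau> has_real_derivative
                 1 + \<alpha>1 * norm (\<xi> t) ^ 2 + \<alpha>2 * norm (\<xi> t) ^ 4 + p (\<tau> t) (\<xi> t)) (at t) \<and>
              (\<xi> has_vector_derivative
                 \<i> * \<omega> * \<xi> t + \<i> * c * \<xi> t * norm (\<xi> t) ^ 2 + e * \<xi> t * norm (\<xi> t) ^ 4
                 + q (\<tau> t) (\<xi> t)) (at t))
           \<longrightarrow> (\<forall>t\<in>{a<..<b}.
              ((\<lambda>s. cm_param u0 v H (\<tau> s) (\<xi> s)) has_vector_derivative
                 F (cm_param u0 v H (\<tau> t) (\<xi> t))) (at t))"
    using normal_form unfolding CH_normal_form_def by blast
  \<comment> \<open>Everything caused by the remainders p and q of the restricted system;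
    \<open>main\<close> keeps the terms with \<alpha>1, \<alpha>2, \<omega>, c and e.\<close>
  define rest where "rest \<xi> = complex_of_real (p \<tau> \<xi>) *s E0 \<tau> \<xi>
     + (q \<tau> \<xi> *s v \<tau> + cnj (q \<tau> \<xi>) *s vcnj (v \<tau>)) + cvec (DH (0, q \<tau> \<xi>) \<tau> \<xi>)" for \<xi>
  define main where "main \<xi> = E0 \<tau> \<xi> + complex_of_real \<alpha>1 *s (complex_of_real (norm \<xi> ^ 2) *s E0 \<tau> \<xi>)
     + complex_of_real \<alpha>2 *s (complex_of_real (norm \<xi> ^ 2) *s (complex_of_real (norm \<xi> ^ 2) *s E0 \<tau> \<xi>))
     + (complex_of_real \<omega> *s EL \<i> \<tau> \<xi> + complex_of_real c *s (complex_of_real (norm \<xi> ^ 2) *s EL \<i> \<tau> \<xi>)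
     + complex_of_real (Im e) *s (complex_of_real (norm \<xi> ^ 2) *s (complex_of_real (norm \<xi> ^ 2) *s EL \<i> \<tau> \<xi>)))
     + complex_of_real (Re e) *s (complex_of_real (norm \<xi> ^ 2) *s (complex_of_real (norm \<xi> ^ 2) *s EL 1 \<tau> \<xi>))" for \<xi>
  have eq: "cvec (F (cm_param u0 v H \<tau> \<xi>)) = main \<xi> + rest \<xi>" if \<xi>: "norm \<xi> < \<delta>" for \<xi>
  proof -
    define a where "a = 1 + \<alpha>1 * norm \<xi> ^ 2 + \<alpha>2 * norm \<xi> ^ 4 + p \<tau> \<xi>"
    define z where "z = \<i> * \<omega> * \<xi> + \<i> * c * \<xi> * norm \<xi> ^ 2 + e * \<xi> * norm \<xi> ^ 4 + q \<tau> \<xi>"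
    define s where "s = norm \<xi> ^ 2"
    have s4: "norm \<xi> ^ 4 = s * s" by (simp add: s_def power_def eval_nat_numeral)
    have h0: "F (cm_param u0 v H \<tau> \<xi>) = a *\<^sub>R (F (u0 \<tau>) + vRe (\<xi> *s dv \<tau> + cnj \<xi> *s vcnj (dv \<tau>)))
       + vRe (z *s v \<tau> + cnj z *s vcnj (v \<tau>)) + frechet_derivative (\<lambda>(\<tau>, \<xi>). H \<tau> \<xi>) (at (\<tau>, \<xi>)) (a, z)"
      by (rule homological_equation[OF p q _ H_differentiable[OF \<xi>] u0 v_derivative[OF \<tau>] \<xi> a_def z_def, where F = F])
        (erule sol[THEN spec, THEN spec, THEN spec, THEN spec, THEN mp])
    have lin: "linear (\<lambda>w. DH w \<tau> \<xi>)" unfolding DH_def by (rule linear_frechet_derivative[OF H_differentiable[OF \<xi>]])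
    \<comment> \<open>The direction is split with real factors only, so that real linearity of the
      derivative of \<open>H\<close> suffices.\<close>
    have zeq: "(a, z) = a *\<^sub>R (1, 0) + ((\<omega> + c * s + Im e * s * s) *\<^sub>R (0, \<i> * \<xi>) + (Re e * s * s) *\<^sub>R (0, 1 * \<xi>) + (0, q \<tau> \<xi>))"
      unfolding z_def s4 unfolding s_def
      by (simp add: complex_eq_iff algebra_simps)
    have D: "DH (a, z) \<tau> \<xi> = a *\<^sub>R DH (1, 0) \<tau> \<xi>
       + ((\<omega> + c * s + Im e * s * s) *\<^sub>R DH (0, \<i> * \<xi>) \<tau> \<xi> + (Re e * s * s) *\<^sub>R DH (0, 1 * \<xi>) \<tau> \<xi> + DH (0, q \<tau> \<xi>) \<tau> \<xi>)"
      unfolding zeq linear_add[OF lin] linear_scale[OF lin] ..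
    have r: "cvec (vRe (w *s x + cnj w *s vcnj x)) = w *s x + cnj w *s vcnj x" for w and x :: "complex^'n"
      by (rule cvec_vRe) (simp add: vcnj_simps vcnj_smult)
    have zz: "z = (\<omega> + c * s + Im e * s * s) * (\<i> * \<xi>) + (Re e * s * s) * \<xi> + q \<tau> \<xi>"
      unfolding z_def s4 unfolding s_def by (simp add: complex_eq_iff algebra_simps)
    have "cvec (F (cm_param u0 v H \<tau> \<xi>)) = complex_of_real a *s (cvec (F (u0 \<tau>)) + (\<xi> *s dv \<tau> + cnj \<xi> *s vcnj (dv \<tau>)))
       + (z *s v \<tau> + cnj z *s vcnj (v \<tau>)) + (complex_of_real a *s cvec (DH (1, 0) \<tau> \<xi>)
       + (complex_of_real (\<omega> + c * s + Im e * s * s) *s cvec (DH (0, \<i> * \<xi>) \<tau> \<xi>)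
         + complex_of_real (Re e * s * s) *s cvec (DH (0, 1 * \<xi>) \<tau> \<xi>) + cvec (DH (0, q \<tau> \<xi>) \<tau> \<xi>)))"
      unfolding h0 DH_def[symmetric] D by (simp only: cvec_simps scaleR_eq_smult r)
    also have "\<dots> = main \<xi> + rest \<xi>"
      unfolding main_def rest_def E0_def EL_def zz a_def s4 s_def[symmetric]
      by (simp add: vec_eq_iff algebra_simps)
    finally show ?thesis .
  qed
  have E0u: "uexp 5 {\<tau>} (\<lambda>_. E0 \<tau>) (\<lambda>_. dU \<tau>)" by (rule E0_uexp[OF \<tau>])
  have EiU: "uexp 5 {\<tau>} (\<lambda>_. EL \<i> \<tau>) (\<lambda>_. V)"
    by (rule uexp_cong[OF EL_uexp[of \<tau> \<i>] zero_less_one]) (auto simp: V_def algebra_simps)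
  have E1U: "uexp 5 {\<tau>} (\<lambda>_. EL 1 \<tau>) (\<lambda>_. R)"
    by (rule uexp_cong[OF EL_uexp[of \<tau> 1] zero_less_one]) (auto simp: R_def)
  have mainu: "uexp 5 {\<tau>} (\<lambda>_. main) (\<lambda>_ J K. dU \<tau> J K + complex_of_real \<alpha>1 *s shift2 (dU \<tau>) J K + complex_of_real \<alpha>2 *s shift2 (shift2 (dU \<tau>)) J K
      + (complex_of_real \<omega> *s V J K + complex_of_real c *s shift2 V J K + complex_of_real (Im e) *s shift2 (shift2 V) J K)
      + complex_of_real (Re e) *s shift2 (shift2 R) J K)"
    unfolding main_def[abs_def]
    by (intro uexp_add uexp_smult uexp_shift2 E0u EiU E1U)
  \<comment> \<open>Crude bounds near \<xi> = 0 are enough, because p and q already supply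
    |\<xi>|^6.\<close>
  obtain K0 where K0: "K0 \<ge> 0" "\<And>\<xi>. norm \<xi> \<le> \<delta> / 2 \<Longrightarrow> norm (DH (1, 0) \<tau> \<xi>) \<le> K0"
    using DH_bounded[of "(1, 0)" \<tau>] by blast
  obtain K1 where K1: "K1 \<ge> 0" "\<And>\<xi>. norm \<xi> \<le> \<delta> / 2 \<Longrightarrow> norm (DH (0, 1) \<tau> \<xi>) \<le> K1"
    using DH_bounded[of "(0, 1)" \<tau>] by blast
  obtain K2 where K2: "K2 \<ge> 0" "\<And>\<xi>. norm \<xi> \<le> \<delta> / 2 \<Longrightarrow> norm (DH (0, \<i>) \<tau> \<xi>) \<le> K2"
    using DH_bounded[of "(0, \<i>)" \<tau>] by blast
  define r0 where "r0 = min 1 (\<delta> / 2)"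
  have r0: "r0 > 0" using \<delta> by (simp add: r0_def)
  have restu: "uexp 5 {\<tau>} (\<lambda>_. rest) (\<lambda>_ _ _. 0)"
  proof (rule uexp_small[OF _ r0])
    fix \<xi> :: complex assume "norm \<xi> < r0"
    then have \<xi>: "norm \<xi> < \<delta>" "norm \<xi> \<le> \<delta> / 2" "norm \<xi> \<le> 1" using \<delta> by (auto simp: r0_def)
    define N where "N = \<bar>M\<bar> * norm \<xi> ^ Suc 5"
    have pq: "\<bar>p \<tau> \<xi>\<bar> \<le> N" "norm (q \<tau> \<xi>) \<le> N"
    proof -
      have "M * norm \<xi> ^ 6 \<le> N" unfolding N_def by (auto intro!: mult_right_mono)
      moreover have "\<bar>p \<tau> \<xi>\<bar> \<le> M * norm \<xi> ^ 6 \<and> norm (q \<tau> \<xi>) \<le> M * norm \<xi> ^ 6"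
        using M \<xi>(1) by simp
      ultimately show "\<bar>p \<tau> \<xi>\<bar> \<le> N" "norm (q \<tau> \<xi>) \<le> N" by linarith+
    qed
    have N0: "N \<ge> 0" by (simp add: N_def)
    have e0: "norm (E0 \<tau> \<xi>) \<le> norm (F (u0 \<tau>)) + (norm (dv \<tau>) + norm (dv \<tau>)) + K0"
      unfolding E0_def
      using \<xi>(3) K0(2)[OF \<xi>(2)]
      by (intro norm_triangle_le add_mono) (auto simp: norm_smult_complex mult_left_le_one_le)
    have dq: "norm (DH (0, q \<tau> \<xi>) \<tau> \<xi>) \<le> N * (K1 + K2)"
    proof -
      have "DH (0, q \<tau> \<xi>) \<tau> \<xi> = Re (q \<tau> \<xi>) *\<^sub>R DH (0, 1) \<tau> \<xi> + Im (q \<tau> \<xi>) *\<^sub>R DH (0, \<i>) \<tau> \<xi>"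
        unfolding DH_def by (rule frechet_derivative_complex_split[OF H_differentiable[OF \<xi>(1)]])
      also have "norm \<dots> \<le> N * K1 + N * K2"
        using pq(2) abs_Re_le_cmod[of "q \<tau> \<xi>"] abs_Im_le_cmod[of "q \<tau> \<xi>"] K1(2)[OF \<xi>(2)] K2(2)[OF \<xi>(2)] N0
        by (intro norm_triangle_le add_mono) (auto intro!: mult_mono)
      finally show ?thesis by (simp add: distrib_left)
    qed
    have "norm (rest \<xi>) \<le> N * (norm (F (u0 \<tau>)) + (norm (dv \<tau>) + norm (dv \<tau>)) + K0)
        + (N * norm (v \<tau>) + N * norm (v \<tau>)) + N * (K1 + K2)"
      unfolding rest_def using e0 dq pq N0
      by (intro norm_triangle_le add_mono) (auto simp: norm_smult_complex intro!: mult_mono)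
    also have "\<dots> = (\<bar>M\<bar> * (norm (F (u0 \<tau>)) + (norm (dv \<tau>) + norm (dv \<tau>)) + K0 + (norm (v \<tau>) + norm (v \<tau>)) + (K1 + K2))) * norm \<xi> ^ Suc 5"
      unfolding N_def by (simp add: algebra_simps)
    finally show "norm (rest \<xi>) \<le> (\<bar>M\<bar> * (norm (F (u0 \<tau>)) + (norm (dv \<tau>) + norm (dv \<tau>)) + K0 + (norm (v \<tau>) + norm (v \<tau>)) + (K1 + K2))) * norm \<xi> ^ Suc 5" .
  qed
  obtain Mu where Mu: "\<And>\<tau> \<xi>. norm \<xi> < \<delta> \<Longrightarrow>
    norm (cvec (cm_param u0 v H \<tau> \<xi> - u0 \<tau>) - cpoly 5 (hcoef v h \<tau>) \<xi>) \<le> Mu * norm \<xi> ^ Suc 5"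
    using u_expansion by blast
  have "Ck_on (Suc 5) F UNIV" using smooth by (simp add: numeral_eq_Suc)
  then have Fu: "uexp 5 {\<tau>} (\<lambda>_ \<xi>. cvec (F (cm_param u0 v H \<tau> \<xi>)))
     (\<lambda>_ J K. \<Sum>m\<le>5. (1 / fact m) *s faa (hcoef v h \<tau>) m (cderiv F (u0 \<tau>)) J K)"
    by (rule uexp_vector_field[OF _ _ vcnj_hcoef Mu \<delta>]) auto
  have "uexp 5 {\<tau>} (\<lambda>_ \<xi>. cvec (F (cm_param u0 v H \<tau> \<xi>)))
     (\<lambda>_ J K. (dU \<tau> J K + complex_of_real \<alpha>1 *s shift2 (dU \<tau>) J K + complex_of_real \<alpha>2 *s shift2 (shift2 (dU \<tau>)) J K
      + (complex_of_real \<omega> *s V J K + complex_of_real c *s shift2 V J K + complex_of_real (Im e) *s shift2 (shift2 V) J K)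
      + complex_of_real (Re e) *s shift2 (shift2 R) J K) + 0)"
    by (rule uexp_cong[OF uexp_add[OF mainu restu] \<delta>]) (simp_all add: eq)
  from uexp_unique[OF Fu this, of \<tau> J K] JK show ?thesis
    by (simp add: homological_coeff_def V_def R_def)
qed

end

text \<open>This brings the first derivative into the form A, so that the one-argument terms of the
  expansion become A times \<open>h j k\<close>.\<close>

lemma cderiv_single:
  assumes "F differentiable at x"
  shows "cderiv F x [w] = cmat (jacobian F (at x)) *v w"
proof -
  have d: "(F has_derivative (\<lambda>h. jacobian F (at x) *v h)) (at x)"
    using assms jacobian_works by blast
  have "frechet_derivative F (at x) a = jacobian F (at x) *v a" for a
    using frechet_derivative_at[OF d] by (metis (no_types))
  then have "cderiv F x [w] = cmat (jacobian F (at x)) *v (cvec (vRe w) + \<i> *s cvec (vIm w))"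
    by (simp add: cderiv_def cvec_matvec matrix_vector_right_distrib vector_scalar_commute)
  then show ?thesis by (simp only: vRe_add_vIm)
qed

section \<open>The differential equations of the coefficients\<close>

context ch_data
begin

abbreviation "cF \<tau> \<equiv> cderiv F (u0 \<tau>)"

lemma cF_swap: "length pre + Suc (Suc (length ws)) \<le> 6 \<Longrightarrow> cF \<tau> (pre @ a # b # ws) = cF \<tau> (pre @ b # a # ws)"
  unfolding cderiv_def
  using msym_cmultilinear[OF msym_dir_deriv[OF smooth, of "length pre + Suc (Suc (length ws))" "u0 \<tau>"]]
  unfolding msym_def by blast

text \<open>The instances stand in the order of the symmetry assumptions \<open>s2\<close> to
  \<open>s5\<close> of the expansion lemmas, which \<open>OF cF_swaps\<close> then
  discharges.\<close>

lemmas cF_swaps = cF_swap[of "[]" "[]", simplified]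
  cF_swap[of "[]" "[_]", simplified] cF_swap[of "[_]" "[]", simplified]
  cF_swap[of "[]" "[_, _]", simplified] cF_swap[of "[_]" "[_]", simplified] cF_swap[of "[_, _]" "[]", simplified]
  cF_swap[of "[]" "[_, _, _]", simplified] cF_swap[of "[_]" "[_, _]", simplified]
  cF_swap[of "[_, _]" "[_]", simplified] cF_swap[of "[_, _, _]" "[]", simplified]

lemma cF_single: "cF \<tau> [w] = A \<tau> *v w"
proof -
  have "Ck_on (Suc 5) F UNIV" using smooth by (simp add: numeral_eq_Suc)
  then have "F differentiable at (u0 \<tau>)" unfolding Ck_on.simps by blast
  then show ?thesis by (rule cderiv_single)
qed

lemma hcoef_values [simp]:
  "hcoef v h \<tau> (Suc 0) 0 = v \<tau>" "hcoef v h \<tau> 0 (Suc 0) = vcnj (v \<tau>)"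
  "hcoef v h \<tau> (Suc 0) (Suc 0) = h 1 1 \<tau>" "hcoef v h \<tau> 2 0 = h 2 0 \<tau>" "hcoef v h \<tau> 0 2 = h 0 2 \<tau>"
  "hcoef v h \<tau> 2 (Suc 0) = h 2 1 \<tau>" "hcoef v h \<tau> (Suc 0) 2 = h 1 2 \<tau>" "hcoef v h \<tau> 3 0 = h 3 0 \<tau>"
  "hcoef v h \<tau> 3 (Suc 0) = h 3 1 \<tau>" "hcoef v h \<tau> 2 2 = h 2 2 \<tau>" "hcoef v h \<tau> 3 2 = h 3 2 \<tau>"
  by (simp_all add: hcoef_def)

context
  fixes \<tau> :: real assumes \<tau>: "\<tau> \<in> {0..T}"
begin

text \<open>The coefficient identity, cleared of the factor 1 / (J! K!) and solved for the
  derivative; in a component i it is an identity of complex numbers. In the equations below each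
  factor |\<xi>|^2 of the restricted system lowers both indices by 1.\<close>

lemma equation_2_0: "h' 2 0 \<tau> = A \<tau> *v h 2 0 \<tau> - (2 * \<i> * \<omega>) *s h 2 0 \<tau> + cF \<tau> [v \<tau>, v \<tau>]"
proof -
  have eq: "\<forall>i. (\<Sum>m\<le>5. (1 / fact m) *s faa (hcoef v h \<tau>) m (cF \<tau>) 2 0) $ i = homological_coeff \<tau> 2 0 $ i"
    using coefficient_identity[OF \<tau>, of 2 0] by simp
  show ?thesis
    unfolding vec_eq_iff
  proof
    fix i
    show "h' 2 0 \<tau> $ i = (A \<tau> *v h 2 0 \<tau> - (2 * \<i> * \<omega>) *s h 2 0 \<tau> + cF \<tau> [v \<tau>, v \<tau>]) $ i"
      using eq[rule_format, of i] unfolding faa_2_0[where g = "hcoef v h \<tau>" and N = "cF \<tau>", OF cF_swaps]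
      by (simp add: homological_coeff_def dU_def U_def shift_def shift_cnj_def cF_single field_simps fact_numeral; algebra)
  qed
qed

text \<open>The factor |\<xi>|^2 at \<alpha>1 leads from (1, 1) back to the constant term F(u0). The
  angular weight j - k is 0, so \<omega> is absent.\<close>

lemma equation_1_1: "h' 1 1 \<tau> = A \<tau> *v h 1 1 \<tau> + cF \<tau> [v \<tau>, vcnj (v \<tau>)] - complex_of_real \<alpha>1 *s cvec (F (u0 \<tau>))"
proof -
  have eq: "\<forall>i. (\<Sum>m\<le>5. (1 / fact m) *s faa (hcoef v h \<tau>) m (cF \<tau>) 1 1) $ i = homological_coeff \<tau> 1 1 $ i"
    using coefficient_identity[OF \<tau>, of 1 1] by simp
  show ?thesis
    unfolding vec_eq_iff
  proof
    fix i
    show "h' 1 1 \<tau> $ i = (A \<tau> *v h 1 1 \<tau> + cF \<tau> [v \<tau>, vcnj (v \<tau>)] - complex_of_real \<alpha>1 *s cvec (F (u0 \<tau>))) $ i"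
      using eq[rule_format, of i] unfolding faa_1_1[where g = "hcoef v h \<tau>" and N = "cF \<tau>", OF cF_swaps]
      by (simp add: homological_coeff_def dU_def U_def shift_def shift_cnj_def cF_single field_simps fact_numeral; algebra)
  qed
qed

lemma equation_2_1: "h' 2 1 \<tau> = A \<tau> *v h 2 1 \<tau> - (\<i> * \<omega>) *s h 2 1 \<tau> + cF \<tau> [v \<tau>, v \<tau>, vcnj (v \<tau>)] + 2 *s cF \<tau> [v \<tau>, h 1 1 \<tau>] + cF \<tau> [vcnj (v \<tau>), h 2 0 \<tau>] - (2 * \<i> * c) *s v \<tau> - (2 * \<alpha>1) *s dv \<tau>"
proof -
  have eq: "\<forall>i. (\<Sum>m\<le>5. (1 / fact m) *s faa (hcoef v h \<tau>) m (cF \<tau>) 2 1) $ i = homological_coeff \<tau> 2 1 $ i"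
    using coefficient_identity[OF \<tau>, of 2 1] by simp
  show ?thesis
    unfolding vec_eq_iff
  proof
    fix i
    show "h' 2 1 \<tau> $ i = (A \<tau> *v h 2 1 \<tau> - (\<i> * \<omega>) *s h 2 1 \<tau> + cF \<tau> [v \<tau>, v \<tau>, vcnj (v \<tau>)] + 2 *s cF \<tau> [v \<tau>, h 1 1 \<tau>] + cF \<tau> [vcnj (v \<tau>), h 2 0 \<tau>] - (2 * \<i> * c) *s v \<tau> - (2 * \<alpha>1) *s dv \<tau>) $ i"
      using eq[rule_format, of i] unfolding faa_2_1[where g = "hcoef v h \<tau>" and N = "cF \<tau>", OF cF_swaps]
      by (simp add: homological_coeff_def dU_def U_def shift_def shift_cnj_def cF_single field_simps fact_numeral; algebra)
  qed
qed

lemma equation_3_0: "h' 3 0 \<tau> = A \<tau> *v h 3 0 \<tau> - (3 * \<i> * \<omega>) *s h 3 0 \<tau> + cF \<tau> [v \<tau>, v \<tau>, v \<tau>] + 3 *s cF \<tau> [v \<tau>, h 2 0 \<tau>]"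
proof -
  have eq: "\<forall>i. (\<Sum>m\<le>5. (1 / fact m) *s faa (hcoef v h \<tau>) m (cF \<tau>) 3 0) $ i = homological_coeff \<tau> 3 0 $ i"
    using coefficient_identity[OF \<tau>, of 3 0] by simp
  show ?thesis
    unfolding vec_eq_iff
  proof
    fix i
    show "h' 3 0 \<tau> $ i = (A \<tau> *v h 3 0 \<tau> - (3 * \<i> * \<omega>) *s h 3 0 \<tau> + cF \<tau> [v \<tau>, v \<tau>, v \<tau>] + 3 *s cF \<tau> [v \<tau>, h 2 0 \<tau>]) $ i"
      using eq[rule_format, of i] unfolding faa_3_0[where g = "hcoef v h \<tau>" and N = "cF \<tau>", OF cF_swaps]
      by (simp add: homological_coeff_def dU_def U_def shift_def shift_cnj_def cF_single field_simps fact_numeral; algebra)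
  qed
qed

text \<open>The derivative of \<open>h 2 0\<close> comes from \<alpha>1 |\<xi>|^2 in the speed of
  \<tau>; it is replaced by means of \<open>equation_2_0\<close> later.\<close>

lemma equation_3_1: "h' 3 1 \<tau> = A \<tau> *v h 3 1 \<tau> - (2 * \<i> * \<omega>) *s h 3 1 \<tau> + cF \<tau> [v \<tau>, v \<tau>, v \<tau>, vcnj (v \<tau>)] + 3 *s cF \<tau> [v \<tau>, v \<tau>, h 1 1 \<tau>] + 3 *s cF \<tau> [v \<tau>, vcnj (v \<tau>), h 2 0 \<tau>] + 3 *s cF \<tau> [h 1 1 \<tau>, h 2 0 \<tau>] + 3 *s cF \<tau> [v \<tau>, h 2 1 \<tau>] + cF \<tau> [vcnj (v \<tau>), h 3 0 \<tau>] - (6 * \<i> * c) *s h 2 0 \<tau> - (3 * \<alpha>1) *s h' 2 0 \<tau>"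
proof -
  have eq: "\<forall>i. (\<Sum>m\<le>5. (1 / fact m) *s faa (hcoef v h \<tau>) m (cF \<tau>) 3 1) $ i = homological_coeff \<tau> 3 1 $ i"
    using coefficient_identity[OF \<tau>, of 3 1] by simp
  show ?thesis
    unfolding vec_eq_iff
  proof
    fix i
    show "h' 3 1 \<tau> $ i = (A \<tau> *v h 3 1 \<tau> - (2 * \<i> * \<omega>) *s h 3 1 \<tau> + cF \<tau> [v \<tau>, v \<tau>, v \<tau>, vcnj (v \<tau>)] + 3 *s cF \<tau> [v \<tau>, v \<tau>, h 1 1 \<tau>] + 3 *s cF \<tau> [v \<tau>, vcnj (v \<tau>), h 2 0 \<tau>] + 3 *s cF \<tau> [h 1 1 \<tau>, h 2 0 \<tau>] + 3 *s cF \<tau> [v \<tau>, h 2 1 \<tau>] + cF \<tau> [vcnj (v \<tau>), h 3 0 \<tau>] - (6 * \<i> * c) *s h 2 0 \<tau> - (3 * \<alpha>1) *s h' 2 0 \<tau>) $ i"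
      using eq[rule_format, of i] unfolding faa_3_1[where g = "hcoef v h \<tau>" and N = "cF \<tau>", OF cF_swaps]
      by (simp add: homological_coeff_def dU_def U_def shift_def shift_cnj_def cF_single field_simps fact_numeral; algebra)
  qed
qed

text \<open>Neither \<omega> nor c occurs: their angular weights are 2 - 2 and 1 - 1.\<close>

lemma equation_2_2: "h' 2 2 \<tau> = A \<tau> *v h 2 2 \<tau> + cF \<tau> [v \<tau>, v \<tau>, vcnj (v \<tau>), vcnj (v \<tau>)] + cF \<tau> [v \<tau>, v \<tau>, h 0 2 \<tau>] + 4 *s cF \<tau> [v \<tau>, vcnj (v \<tau>), h 1 1 \<tau>] + cF \<tau> [vcnj (v \<tau>), vcnj (v \<tau>), h 2 0 \<tau>] + 2 *s cF \<tau> [h 1 1 \<tau>, h 1 1 \<tau>] + 2 *s cF \<tau> [v \<tau>, h 1 2 \<tau>] + cF \<tau> [h 0 2 \<tau>, h 2 0 \<tau>] + 2 *s cF \<tau> [vcnj (v \<tau>), h 2 1 \<tau>] - (4 * \<alpha>1) *s h' 1 1 \<tau> - (4 * \<alpha>2) *s cvec (F (u0 \<tau>))"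
proof -
  have eq: "\<forall>i. (\<Sum>m\<le>5. (1 / fact m) *s faa (hcoef v h \<tau>) m (cF \<tau>) 2 2) $ i = homological_coeff \<tau> 2 2 $ i"
    using coefficient_identity[OF \<tau>, of 2 2] by simp
  show ?thesis
    unfolding vec_eq_iff
  proof
    fix i
    show "h' 2 2 \<tau> $ i = (A \<tau> *v h 2 2 \<tau> + cF \<tau> [v \<tau>, v \<tau>, vcnj (v \<tau>), vcnj (v \<tau>)] + cF \<tau> [v \<tau>, v \<tau>, h 0 2 \<tau>] + 4 *s cF \<tau> [v \<tau>, vcnj (v \<tau>), h 1 1 \<tau>] + cF \<tau> [vcnj (v \<tau>), vcnj (v \<tau>), h 2 0 \<tau>] + 2 *s cF \<tau> [h 1 1 \<tau>, h 1 1 \<tau>] + 2 *s cF \<tau> [v \<tau>, h 1 2 \<tau>] + cF \<tau> [h 0 2 \<tau>, h 2 0 \<tau>] + 2 *s cF \<tau> [vcnj (v \<tau>), h 2 1 \<tau>] - (4 * \<alpha>1) *s h' 1 1 \<tau> - (4 * \<alpha>2) *s cvec (F (u0 \<tau>))) $ i"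
      using eq[rule_format, of i] unfolding faa_2_2[where g = "hcoef v h \<tau>" and N = "cF \<tau>", OF cF_swaps]
      by (simp add: homological_coeff_def dU_def U_def shift_def shift_cnj_def cF_single field_simps fact_numeral; algebra)
  qed
qed

text \<open>The first equation that contains e, as |\<xi>|^4 leads from (3, 2) back to the
  coefficient \<open>v\<close> at (1, 0). The common factor is 12 = 3! 2!.\<close>

lemma equation_3_2: "h' 3 2 \<tau> = A \<tau> *v h 3 2 \<tau> - (\<i> * \<omega>) *s h 3 2 \<tau> + cF \<tau> [v \<tau>, v \<tau>, v \<tau>, vcnj (v \<tau>), vcnj (v \<tau>)] + cF \<tau> [v \<tau>, v \<tau>, v \<tau>, h 0 2 \<tau>] + 6 *s cF \<tau> [v \<tau>, v \<tau>, vcnj (v \<tau>), h 1 1 \<tau>] + 3 *s cF \<tau> [v \<tau>, vcnj (v \<tau>), vcnj (v \<tau>), h 2 0 \<tau>] + 6 *s cF \<tau> [v \<tau>, h 1 1 \<tau>, h 1 1 \<tau>] + 3 *s cF \<tau> [v \<tau>, v \<tau>, h 1 2 \<tau>] + 3 *s cF \<tau> [v \<tau>, h 0 2 \<tau>, h 2 0 \<tau>] + 6 *s cF \<tau> [vcnj (v \<tau>), h 1 1 \<tau>, h 2 0 \<tau>] + 6 *s cF \<tau> [v \<tau>, vcnj (v \<tau>), h 2 1 \<tau>] + cF \<tau> [vcnj (v \<tau>), vcnj (v \<tau>), h 3 0 \<tau>] + 3 *s cF \<tau> [h 1 2 \<tau>, h 2 0 \<tau>] + 6 *s cF \<tau>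 [h 1 1 \<tau>, h 2 1 \<tau>] + 3 *s cF \<tau> [v \<tau>, h 2 2 \<tau>] + cF \<tau> [h 0 2 \<tau>, h 3 0 \<tau>] + 2 *s cF \<tau> [vcnj (v \<tau>), h 3 1 \<tau>] - (12 * e) *s v \<tau> - (12 * \<alpha>2) *s dv \<tau> - (6 * \<alpha>1) *s h' 2 1 \<tau> - (6 * \<i> * c) *s h 2 1 \<tau>"
proof -
  have eq: "\<forall>i. (\<Sum>m\<le>5. (1 / fact m) *s faa (hcoef v h \<tau>) m (cF \<tau>) 3 2) $ i = homological_coeff \<tau> 3 2 $ i"
    using coefficient_identity[OF \<tau>, of 3 2] by simp
  show ?thesis
    unfolding vec_eq_iff
  proof
    fix i
    show "h' 3 2 \<tau> $ i = (A \<tau> *v h 3 2 \<tau> - (\<i> * \<omega>) *s h 3 2 \<tau> + cF \<tau> [v \<tau>, v \<tau>, v \<tau>, vcnj (v \<tau>), vcnj (v \<tau>)] + cF \<tau> [v \<tau>, v \<tau>, v \<tau>, h 0 2 \<tau>] + 6 *s cF \<tau> [v \<tau>, v \<tau>, vcnj (v \<tau>), h 1 1 \<tau>] + 3 *s cF \<tau> [v \<tau>, vcnj (v \<tau>), vcnj (v \<tau>), h 2 0 \<tau>] + 6 *s cF \<tau> [v \<tau>, h 1 1 \<tau>, h 1 1 \<tau>] + 3 *s cF \<tau> [v \<tau>, v \<tau>, h 1 2 \<tau>] + 3 *s cF \<tau> [v \<tau>, h 0 2 \<tau>, h 2 0 \<tau>] + 6 *s cF \<tau> [vcnj (v \<tau>),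 h 1 1 \<tau>, h 2 0 \<tau>] + 6 *s cF \<tau> [v \<tau>, vcnj (v \<tau>), h 2 1 \<tau>] + cF \<tau> [vcnj (v \<tau>), vcnj (v \<tau>), h 3 0 \<tau>] + 3 *s cF \<tau> [h 1 2 \<tau>, h 2 0 \<tau>] + 6 *s cF \<tau> [h 1 1 \<tau>, h 2 1 \<tau>] + 3 *s cF \<tau> [v \<tau>, h 2 2 \<tau>] + cF \<tau> [h 0 2 \<tau>, h 3 0 \<tau>] + 2 *s cF \<tau> [vcnj (v \<tau>), h 3 1 \<tau>] - (12 * e) *s v \<tau> - (12 * \<alpha>2) *s dv \<tau> - (6 * \<alpha>1) *s h' 2 1 \<tau> - (6 * \<i> * c) *s h 2 1 \<tau>) $ i"
      \<comment> \<open>At (1, 0) the angular weight is \<i> and the radial weight is 1, so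
        \<open>Im e\<close> and \<open>Re e\<close> recombine to e.\<close>
      using eq[rule_format, of i] complex_eq[of e] unfolding faa_3_2[where g = "hcoef v h \<tau>" and N = "cF \<tau>", OF cF_swaps]
      by (simp add: homological_coeff_def dU_def U_def shift_def shift_cnj_def cF_single field_simps fact_numeral; algebra)
  qed
qed

end

end

section \<open>Solvability and uniqueness\<close>

lemma solves_cong:
  "(\<And>t d x. t \<in> {0..T} \<Longrightarrow> R t d x = R' t d x) \<Longrightarrow> solves T R h = solves T R' h"
  unfolding solves_def by (metis (no_types, lifting))

lemma solves_continuous: "solves T R h \<Longrightarrow> continuous_on {0..T} h"
  unfolding solves_def
  by (auto simp: continuous_on_eq_continuous_within intro: has_vector_derivative_continuous)

lemma solves_diff:
  assumes "solves T (\<lambda>t d x. d - M t *v x + k *s x - r t) (f :: real \<Rightarrow> complex^'n)"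
    and "solves T (\<lambda>t d x. d - M t *v x + k *s x - r t) g"
  shows "solves T (\<lambda>t d x. d - M t *v x + k *s x) (\<lambda>t. f t - g t)"
  unfolding solves_def
proof (intro conjI ballI)
  fix t assume t: "t \<in> {0..T}"
  obtain d where d: "(f has_vector_derivative d) (at t within {0..T})" "d - M t *v f t + k *s f t - r t = 0"
    using assms(1) t unfolding solves_def by blast
  obtain d' where d': "(g has_vector_derivative d') (at t within {0..T})" "d' - M t *v g t + k *s g t - r t = 0"
    using assms(2) t unfolding solves_def by blast
  have "(d - d') - M t *v (f t - g t) + k *s (f t - g t)
     = (d - M t *v f t + k *s f t - r t) - (d' - M t *v g t + k *s g t - r t)"
    by (simp add: matrix_vector_mult_diff_distrib vec.scale_right_diff_distrib)
  also have "\<dots> = 0" unfolding d(2) d'(2) by simp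
  finally show "\<exists>d. ((\<lambda>t. f t - g t) has_vector_derivative d) (at t within {0..T}) \<and>
     d - M t *v (f t - g t) + k *s (f t - g t) = 0"
    using has_vector_derivative_diff[OF d(1) d'(1)] by blast
qed (use assms in \<open>simp add: solves_def\<close>)

lemma herm_integrable:
  assumes "continuous_on {0..T} z" "continuous_on {0..T} f"
  shows "(\<lambda>t. \<langle>z t, f t\<rangle>) integrable_on {0..T :: real}"
  by (intro integrable_continuous_interval bounded_bilinear.continuous_on[OF bounded_bilinear_herm] assms)

context floquet
begin

lemma unique_nonresonant:
  assumes "solves T (\<lambda>t d x. d - cmat (A t) *v x + k *s x - r t) f"
    and "\<not> eigenvalue_of (cmat (Y T)) (exp (k * T))"
  shows "unique_solution T (\<lambda>t d x. d - cmat (A t) *v x + k *s x - r t) (\<lambda>_. True) f"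
  unfolding unique_solution_def
proof (intro conjI allI impI ballI)
  fix g t assume "solves T (\<lambda>t d x. d - cmat (A t) *v x + k *s x - r t) g \<and> True" and t: "t \<in> {0..T}"
  then have "g t - f t = 0"
    using periodic_zero[OF solves_diff[OF _ assms(1)] assms(2) t] by blast
  then show "g t = f t" by simp
qed (use assms in auto)

text \<open>Two solutions differ by a multiple \<kappa> of y, and pairing with z reads off \<kappa>,
  since z is normalized against y.\<close>

lemma unique_resonant:
  assumes f: "solves T (\<lambda>t d x. d - cmat (A t) *v x + k *s x - r t) f"
    and y: "solves T (\<lambda>t d x. d - cmat (A t) *v x + k *s x) y"
    and ord: "order (exp (k * T)) (charpoly (cmat (Y T))) = 1"
    and z: "continuous_on {0..T} z"
    and zy: "integral {0..T} (\<lambda>t. \<langle>z t, y t\<rangle>) = 1"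
    and zf: "integral {0..T} (\<lambda>t. \<langle>z t, f t\<rangle>) = 0"
  shows "unique_solution T (\<lambda>t d x. d - cmat (A t) *v x + k *s x - r t)
     (\<lambda>g. integral {0..T} (\<lambda>t. \<langle>z t, g t\<rangle>) = 0) f"
  unfolding unique_solution_def
proof (intro conjI allI impI ballI f zf)
  fix g t assume "solves T (\<lambda>t d x. d - cmat (A t) *v x + k *s x - r t) g \<and> integral {0..T} (\<lambda>t. \<langle>z t, g t\<rangle>) = 0"
    and t: "t \<in> {0..T}"
  then have g: "solves T (\<lambda>t d x. d - cmat (A t) *v x + k *s x - r t) g"
    and zg: "integral {0..T} (\<lambda>t. \<langle>z t, g t\<rangle>) = 0" by auto
  \<comment> \<open>A solution with y 0 = 0 vanishes identically, against the normalization; hence y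
    0 is an eigenvector.\<close>
  have "y 0 \<noteq> 0"
  proof
    assume "y 0 = 0"
    then have "y t = 0" if "t \<in> {0..T}" for t using homogeneous_solution[OF y that] by simp
    then have "integral {0..T} (\<lambda>t. \<langle>z t, y t\<rangle>) = integral {0..T} (\<lambda>t. 0 :: complex)"
      by (intro integral_cong) (simp add: herm_zero_right)
    then show False using zy by simp
  qed
  then obtain \<kappa> where \<kappa>: "\<And>t. t \<in> {0..T} \<Longrightarrow> g t - f t = \<kappa> *s y t"
    using periodic_proportional[OF solves_diff[OF g f] y ord] by blast
  have "integral {0..T} (\<lambda>t. \<langle>z t, g t\<rangle>) - integral {0..T} (\<lambda>t. \<langle>z t, f t\<rangle>)
     = integral {0..T} (\<lambda>t. \<langle>z t, g t\<rangle> - \<langle>z t, f t\<rangle>)"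
    by (intro integral_diff[symmetric] herm_integrable z solves_continuous[OF f] solves_continuous[OF g])
  also have "\<dots> = integral {0..T} (\<lambda>t. \<kappa> * \<langle>z t, y t\<rangle>)"
    by (rule integral_cong) (simp add: \<kappa> herm_diff_right[symmetric] herm_smult_right)
  also have "\<dots> = \<kappa>" using zy by simp
  finally have "\<kappa> = 0" using zf zg by simp
  then show "g t = f t" using \<kappa>[OF t] by simp
qed

end

section \<open>The multiplier conditions and the formulas for the coefficients\<close>

locale ch_full = ch_data F u0 T \<omega> \<delta> \<alpha>1 \<alpha>2 c e v vs \<phi>s H h
  for F :: "real^'n \<Rightarrow> real^'n" and u0 T \<omega> \<delta> \<alpha>1 \<alpha>2 c e v vs \<phi>s H h +
  fixes Y :: "real \<Rightarrow> real^'n^'n" and \<theta> :: real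
  assumes Y: "fundamental_matrix F u0 T Y" and CH: "CH_multipliers (Y T) \<theta>" and \<omega>: "\<omega> = \<theta> / T"
begin

lemma continuous_jacobian: "continuous_on {0..T} (\<lambda>\<tau>. jacobian F (at (u0 \<tau>)))"
proof -
  have c: "continuous_on UNIV (\<lambda>x. frechet_derivative F (at x) w)" for w
  proof -
    have "Ck_on (Suc 5) F UNIV" using smooth by (simp add: numeral_eq_Suc)
    then show ?thesis using Ck_on_continuous[of 5] unfolding Ck_on.simps by blast
  qed
  have "continuous_on {0..T} u0"
    using u0 by (intro continuous_at_imp_continuous_on ballI has_vector_derivative_continuous)
  then have "continuous_on {0..T} (\<lambda>\<tau>. frechet_derivative F (at (u0 \<tau>)) w)" for w
    by (rule continuous_on_compose2[OF c]) auto
  then show ?thesis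
    unfolding jacobian_def matrix_def by (intro continuous_on_vec_lambda continuous_on_component)
qed

sublocale floquet "\<lambda>\<tau>. jacobian F (at (u0 \<tau>))" Y T
  using Y T continuous_jacobian by unfold_locales (auto simp: fundamental_matrix_def)

lemma exp_multiple: "exp (\<i> * \<omega> * T) = cis \<theta>" "exp (2 * \<i> * \<omega> * T) = cis (2 * \<theta>)" "exp (3 * \<i> * \<omega> * T) = cis (3 * \<theta>)"
  using T by (simp_all add: \<omega> cis_conv_exp mult_ac)

text \<open>Because 0 < \<theta> < \<pi>, the number m \<theta> lies strictly between 0 and m \<pi>.
  For m \<le> 4 the only multiple of 2 \<pi> possible there is 2 \<pi> itself, which would give an
  excluded angle.\<close>

lemma cis_multiple_neq_1:
  assumes "m \<in> {1..4 :: nat}"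
  shows "cis (real m * \<theta>) \<noteq> 1"
proof
  assume "cis (real m * \<theta>) = 1"
  then have "cos (real m * \<theta>) = 1" by (simp add: complex_eq_iff)
  then obtain n :: int where n: "real m * \<theta> = of_int n * 2 * pi" using cos_one_2pi_int by blast
  have th: "0 < \<theta>" "\<theta> < pi" and ne: "\<And>j. j \<in> {1..6::nat} \<Longrightarrow> \<theta> \<noteq> 2 * pi / real j"
    using CH by (auto simp: CH_multipliers_def)
  have "0 < of_int n * 2 * pi" using n th assms by (metis atLeastAtMost_iff mult_pos_pos of_nat_0_less_iff zero_less_one less_le_trans)
  then have n0: "0 < n" by (simp add: zero_less_mult_iff)
  have "of_int n * 2 * pi < real m * pi" unfolding n[symmetric] using th assms by simp
  then have "of_int n * 2 < real m" by simp
  then have "n * 2 < int m" by linarith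
  with n0 assms have "n = 1" by auto
  then have "\<theta> = 2 * pi / real m" using n assms by (simp add: field_simps)
  then show False using ne[of m] assms by auto
qed

text \<open>A multiplier of modulus 1 must be one of the three critical ones; coincidence with 1,
  cis \<theta> or cis (- \<theta>) would make cis of m, m - 1 or m + 1 times \<theta> equal to 1.
  The case m = 2 serves \<open>h 2 0\<close> and \<open>h 3 1\<close>, the case m = 3 serves
  \<open>h 3 0\<close>.\<close>

lemma nonresonant:
  assumes "m \<in> {2, 3 :: nat}"
  shows "\<not> eigenvalue_of (cmat (Y T)) (cis (real m * \<theta>))"
proof
  assume "eigenvalue_of (cmat (Y T)) (cis (real m * \<theta>))"
  then have "cis (real m * \<theta>) \<in> {1, cis \<theta>, cis (- \<theta>)}"
    using CH by (simp add: CH_multipliers_def)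
  moreover have "cis (real m * \<theta>) = cis \<theta> * cis (real (m - 1) * \<theta>)"
    using assms by (auto simp: cis_mult algebra_simps)
  then have "cis (real m * \<theta>) = cis \<theta> \<Longrightarrow> cis (real (m - 1) * \<theta>) = 1"
    by simp
  moreover have "cis (real m * \<theta>) = cis (- \<theta>) \<Longrightarrow> cis (real (m + 1) * \<theta>) = 1"
  proof -
    assume "cis (real m * \<theta>) = cis (- \<theta>)"
    then have "cis (real m * \<theta>) * cis \<theta> = 1" by (simp add: cis_mult)
    then show ?thesis by (simp add: cis_mult algebra_simps)
  qed
  ultimately show False
    using cis_multiple_neq_1[of m] cis_multiple_neq_1[of "m - 1"] cis_multiple_neq_1[of "m + 1"] assms by auto
qed

lemma simple_multipliers:
  "order (exp (\<i> * \<omega> * T)) (charpoly (cmat (Y T))) = 1" "order (exp (0 * complex_of_real T)) (charpoly (cmat (Y T))) = 1"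
  using CH by (simp_all add: exp_multiple CH_multipliers_def simple_eigenvalue_of_def)

lemma v_solves: "solves T (\<lambda>\<tau> d x. d - A \<tau> *v x + (\<i> * \<omega>) *s x) v"
  and vs_solves: "solves T (\<lambda>\<tau> d x. d + cmat (transpose (jacobian F (at (u0 \<tau>)))) *v x + (\<i> * complex_of_real \<omega>) *s x) vs"
  and integral_vs_v: "integral {0..T} (\<lambda>\<tau>. \<langle>vs \<tau>, v \<tau>\<rangle>) = 1"
  and integral_phi_F: "integral {0..T} (\<lambda>\<tau>. \<langle>cvec (\<phi>s \<tau>), cvec (F (u0 \<tau>))\<rangle>) = 1"
  using eigenfunctions by (simp_all add: critical_eigenfunctions_def)

text \<open>The real adjoint function in the complex form with \<nu> = 0, so that the same lemmas
  serve \<open>\<phi>s\<close> and \<open>vs\<close>.\<close>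

lemma phi_solves: "solves T (\<lambda>\<tau> d x. d + cmat (transpose (jacobian F (at (u0 \<tau>)))) *v x + (\<i> * complex_of_real 0) *s x) (\<lambda>\<tau>. cvec (\<phi>s \<tau>))"
  unfolding solves_def
proof (intro conjI ballI)
  have phi: "solves T (\<lambda>\<tau> d x. d + transpose (jacobian F (at (u0 \<tau>))) *v x) \<phi>s"
    using eigenfunctions by (simp add: critical_eigenfunctions_def)
  then show "cvec (\<phi>s T) = cvec (\<phi>s 0)" by (simp add: solves_def)
  fix t assume "t \<in> {0..T}"
  then obtain d where d: "(\<phi>s has_vector_derivative d) (at t within {0..T})" "d + transpose (jacobian F (at (u0 t))) *v \<phi>s t = 0"
    using phi unfolding solves_def by blast
  have "cvec d + cmat (transpose (jacobian F (at (u0 t)))) *v cvec (\<phi>s t) = 0"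
    unfolding cvec_matvec[symmetric] cvec_simps(1)[symmetric] d(2) by (simp add: cvec_simps)
  then show "\<exists>d. ((\<lambda>\<tau>. cvec (\<phi>s \<tau>)) has_vector_derivative d) (at t within {0..T}) \<and>
     d + cmat (transpose (jacobian F (at (u0 t)))) *v cvec (\<phi>s t) + (\<i> * complex_of_real 0) *s cvec (\<phi>s t) = 0"
    using bounded_linear.has_vector_derivative[OF bounded_linear_cvec d(1)] by (intro exI[of _ "cvec d"]) simp
qed

text \<open>Differentiating u0' = F(u0) shows that the velocity of the cycle solves the variational
  equation; it is the homogeneous solution belonging to the multiplier 1.\<close>

lemma F_solves: "solves T (\<lambda>\<tau> d x. d - A \<tau> *v x + 0 *s x) (\<lambda>\<tau>. cvec (F (u0 \<tau>)))"
  unfolding solves_def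
proof (intro conjI ballI)
  show "cvec (F (u0 T)) = cvec (F (u0 0))" using u0_periodic[of 0] by simp
  fix t
  have "Ck_on (Suc 5) F UNIV" using smooth by (simp add: numeral_eq_Suc)
  then have "F differentiable at (u0 t)" unfolding Ck_on.simps by blast
  then have "(F has_derivative (\<lambda>h. jacobian F (at (u0 t)) *v h)) (at (u0 t))" using jacobian_works by blast
  then have "((\<lambda>t. F (u0 t)) has_vector_derivative jacobian F (at (u0 t)) *v F (u0 t)) (at t within {0..T})"
    using diff_chain_within[OF u0[of t, THEN has_vector_derivative_at_within, unfolded has_vector_derivative_def] has_derivative_at_withinI]
    unfolding has_vector_derivative_def o_def by (force simp: matrix_vector_mult_scaleR scaleR_matrix_vector_assoc)
  from bounded_linear.has_vector_derivative[OF bounded_linear_cvec this]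
  show "\<exists>d. ((\<lambda>\<tau>. cvec (F (u0 \<tau>))) has_vector_derivative d) (at t within {0..T}) \<and>
     d - A t *v cvec (F (u0 t)) + 0 *s cvec (F (u0 t)) = 0"
    by (auto simp: cvec_matvec)
qed

lemma h_solves:
  assumes "2 \<le> j + k" "j + k \<le> 5"
    and "\<And>\<tau>. \<tau> \<in> {0..T} \<Longrightarrow> R \<tau> (h' j k \<tau>) (h j k \<tau>) = 0"
  shows "solves T R (h j k)"
  unfolding solves_def
  using h_derivative[OF _ assms(1,2)] h_periodic[OF assms(1,2)] assms(3) by blast

lemma integral_h:
  "integral {0..T} (\<lambda>\<tau>. \<langle>cvec (\<phi>s \<tau>), h 1 1 \<tau>\<rangle>) = 0"
  "integral {0..T} (\<lambda>\<tau>. \<langle>vs \<tau>, h 2 1 \<tau>\<rangle>) = 0"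
  "integral {0..T} (\<lambda>\<tau>. \<langle>cvec (\<phi>s \<tau>), h 2 2 \<tau>\<rangle>) = 0"
  by (rule manifold[unfolded cm_expansion_def, THEN conjunct2, THEN conjunct2, THEN conjunct2, THEN conjunct2, THEN conjunct1]
      manifold[unfolded cm_expansion_def, THEN conjunct2, THEN conjunct2, THEN conjunct2, THEN conjunct2, THEN conjunct2, THEN conjunct1]
      manifold[unfolded cm_expansion_def, THEN conjunct2, THEN conjunct2, THEN conjunct2, THEN conjunct2, THEN conjunct2, THEN conjunct2])+

lemma vs_v_has_integral: "((\<lambda>\<tau>. \<langle>vs \<tau>, v \<tau>\<rangle>) has_integral 1) {0..T}"
  using integrable_integral[OF herm_integrable[OF solves_continuous[OF vs_solves] solves_continuous[OF v_solves]]]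
  by (simp add: integral_vs_v)

lemma phi_F_has_integral: "((\<lambda>\<tau>. \<langle>cvec (\<phi>s \<tau>), cvec (F (u0 \<tau>))\<rangle>) has_integral 1) {0..T}"
  using integrable_integral[OF herm_integrable[OF solves_continuous[OF phi_solves] solves_continuous[OF F_solves]]]
  by (simp add: integral_phi_F)

abbreviation "vb \<tau> \<equiv> vcnj (v \<tau>)"

abbreviation "N21 \<tau> \<equiv> cF \<tau> [v \<tau>, v \<tau>, vb \<tau>] + 2 *s cF \<tau> [v \<tau>, h 1 1 \<tau>] + cF \<tau> [vb \<tau>, h 2 0 \<tau>]"

abbreviation "N22 \<tau> \<equiv> cF \<tau> [v \<tau>, v \<tau>, vb \<tau>, vb \<tau>] + cF \<tau> [v \<tau>, v \<tau>, h 0 2 \<tau>]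
         + 4 *s cF \<tau> [v \<tau>, vb \<tau>, h 1 1 \<tau>] + cF \<tau> [vb \<tau>, vb \<tau>, h 2 0 \<tau>]
         + 2 *s cF \<tau> [h 1 1 \<tau>, h 1 1 \<tau>] + 2 *s cF \<tau> [v \<tau>, h 1 2 \<tau>]
         + cF \<tau> [h 0 2 \<tau>, h 2 0 \<tau>] + 2 *s cF \<tau> [vb \<tau>, h 2 1 \<tau>]"

abbreviation "N32 \<tau> \<equiv> cF \<tau> [v \<tau>, v \<tau>, v \<tau>, vb \<tau>, vb \<tau>] + cF \<tau> [v \<tau>, v \<tau>, v \<tau>, h 0 2 \<tau>]
         + 6 *s cF \<tau> [v \<tau>, v \<tau>, vb \<tau>, h 1 1 \<tau>]
         + 3 *s cF \<tau> [v \<tau>, vb \<tau>, vb \<tau>, h 2 0 \<tau>]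
         + 6 *s cF \<tau> [v \<tau>, h 1 1 \<tau>, h 1 1 \<tau>] + 3 *s cF \<tau> [v \<tau>, v \<tau>, h 1 2 \<tau>]
         + 3 *s cF \<tau> [v \<tau>, h 0 2 \<tau>, h 2 0 \<tau>] + 6 *s cF \<tau> [vb \<tau>, h 1 1 \<tau>, h 2 0 \<tau>]
         + 6 *s cF \<tau> [v \<tau>, vb \<tau>, h 2 1 \<tau>] + cF \<tau> [vb \<tau>, vb \<tau>, h 3 0 \<tau>]
         + 3 *s cF \<tau> [h 1 2 \<tau>, h 2 0 \<tau>] + 6 *s cF \<tau> [h 1 1 \<tau>, h 2 1 \<tau>]
         + 3 *s cF \<tau> [v \<tau>, h 2 2 \<tau>] + cF \<tau> [h 0 2 \<tau>, h 3 0 \<tau>]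
         + 2 *s cF \<tau> [vb \<tau>, h 3 1 \<tau>]"

lemma unique_h20: "unique_solution T
       (\<lambda>\<tau> d x. d - A \<tau> *v x + (2 * \<i> * \<omega>) *s x - cF \<tau> [v \<tau>, v \<tau>]) (\<lambda>_. True) (h 2 0)"
  by (rule unique_nonresonant[OF h_solves])
    (use nonresonant[of 2] in \<open>simp_all add: equation_2_0 exp_multiple\<close>)

lemma unique_h30: "unique_solution T
       (\<lambda>\<tau> d x. d - A \<tau> *v x + (3 * \<i> * \<omega>) *s x - cF \<tau> [v \<tau>, v \<tau>, v \<tau>] - 3 *s cF \<tau> [v \<tau>, h 2 0 \<tau>])
       (\<lambda>_. True) (h 3 0)"
proof -
  have eq: "(\<lambda>\<tau> d x. d - A \<tau> *v x + (3 * \<i> * \<omega>) *s x - cF \<tau> [v \<tau>, v \<tau>, v \<tau>] - 3 *s cF \<tau> [v \<tau>, h 2 0 \<tau>])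
    = (\<lambda>\<tau> d x. d - A \<tau> *v x + (3 * \<i> * \<omega>) *s x - (cF \<tau> [v \<tau>, v \<tau>, v \<tau>] + 3 *s cF \<tau> [v \<tau>, h 2 0 \<tau>]))"
    by (simp add: fun_eq_iff algebra_simps)
  show ?thesis unfolding eq
    by (rule unique_nonresonant[OF h_solves])
      (use nonresonant[of 3] in \<open>simp_all add: equation_3_0 exp_multiple diff_diff_eq\<close>)
qed

lemma unique_h31: "unique_solution T
       (\<lambda>\<tau> d x. d - A \<tau> *v x + (2 * \<i> * \<omega>) *s x - cF \<tau> [v \<tau>, v \<tau>, v \<tau>, vb \<tau>]
          - 3 *s cF \<tau> [v \<tau>, v \<tau>, h 1 1 \<tau>] - 3 *s cF \<tau> [v \<tau>, vb \<tau>, h 2 0 \<tau>]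
          - 3 *s cF \<tau> [h 1 1 \<tau>, h 2 0 \<tau>] - 3 *s cF \<tau> [v \<tau>, h 2 1 \<tau>]
          - cF \<tau> [vb \<tau>, h 3 0 \<tau>] + (6 * \<i> * c) *s h 2 0 \<tau>
          + (3 * \<alpha>1) *s (A \<tau> *v h 2 0 \<tau> - (2 * \<i> * \<omega>) *s h 2 0 \<tau> + cF \<tau> [v \<tau>, v \<tau>]))
       (\<lambda>_. True) (h 3 1)" (is "unique_solution T ?R _ _")
proof -
  have eq: "?R
    = (\<lambda>\<tau> d x. d - A \<tau> *v x + (2 * \<i> * \<omega>) *s x - (cF \<tau> [v \<tau>, v \<tau>, v \<tau>, vb \<tau>]
          + 3 *s cF \<tau> [v \<tau>, v \<tau>, h 1 1 \<tau>] + 3 *s cF \<tau> [v \<tau>, vb \<tau>, h 2 0 \<tau>]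
          + 3 *s cF \<tau> [h 1 1 \<tau>, h 2 0 \<tau>] + 3 *s cF \<tau> [v \<tau>, h 2 1 \<tau>]
          + cF \<tau> [vb \<tau>, h 3 0 \<tau>] - (6 * \<i> * c) *s h 2 0 \<tau>
          - (3 * \<alpha>1) *s (A \<tau> *v h 2 0 \<tau> - (2 * \<i> * \<omega>) *s h 2 0 \<tau> + cF \<tau> [v \<tau>, v \<tau>])))"
    by (simp add: fun_eq_iff)
  show ?thesis unfolding eq
    by (rule unique_nonresonant[OF h_solves])
      (use nonresonant[of 2] in \<open>simp_all add: equation_3_1 equation_2_0 exp_multiple del: One_nat_def\<close>)
qed

text \<open>The summand \<open>0 *s x\<close> puts the equation into the general form with k =
  0.\<close>

lemma h11_solves: "solves T (\<lambda>\<tau> d x. d - A \<tau> *v x + 0 *s x - (cF \<tau> [v \<tau>, vb \<tau>] - \<alpha>1 *s cvec (F (u0 \<tau>)))) (h 1 1)"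
  by (rule h_solves) (simp_all add: equation_1_1 del: One_nat_def)

lemma unique_h11: "unique_solution T
       (\<lambda>\<tau> d x. d - A \<tau> *v x - cF \<tau> [v \<tau>, vb \<tau>] + \<alpha>1 *s cvec (vector_derivative u0 (at \<tau>)))
       (\<lambda>g. integral {0..T} (\<lambda>\<tau>. \<langle>cvec (\<phi>s \<tau>), g \<tau>\<rangle>) = 0) (h 1 1)"
proof -
  have u': "vector_derivative u0 (at \<tau>) = F (u0 \<tau>)" for \<tau> by (rule vector_derivative_at[OF u0])
  have eq: "(\<lambda>\<tau> d x. d - A \<tau> *v x - cF \<tau> [v \<tau>, vb \<tau>] + \<alpha>1 *s cvec (vector_derivative u0 (at \<tau>)))
    = (\<lambda>\<tau> d x. d - A \<tau> *v x + 0 *s x - (cF \<tau> [v \<tau>, vb \<tau>] - \<alpha>1 *s cvec (F (u0 \<tau>))))"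
    by (simp add: fun_eq_iff u')
  show ?thesis unfolding eq
    by (rule unique_resonant[OF h11_solves F_solves simple_multipliers(2) solves_continuous[OF phi_solves] integral_phi_F integral_h(1)])
qed

lemma alpha1_formula: "\<alpha>1 = integral {0..T} (\<lambda>\<tau>. \<langle>cvec (\<phi>s \<tau>), cF \<tau> [v \<tau>, vb \<tau>]\<rangle>)"
proof -
  have "((\<lambda>\<tau>. \<langle>cvec (\<phi>s \<tau>), cF \<tau> [v \<tau>, vb \<tau>] - \<alpha>1 *s cvec (F (u0 \<tau>))\<rangle>) has_integral 0) {0..T}"
    by (rule fredholm[OF phi_solves]) (use h11_solves in simp)
  \<comment> \<open>Adding \<alpha>1 times the normalization integral cancels the term with F(u0);
    integrability of what remains comes along.\<close>
  from has_integral_add[OF this has_integral_mult_right[OF phi_F_has_integral, of "complex_of_real \<alpha>1"]]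
  have "((\<lambda>\<tau>. \<langle>cvec (\<phi>s \<tau>), cF \<tau> [v \<tau>, vb \<tau>]\<rangle>) has_integral \<alpha>1) {0..T}"
    by (simp add: herm_diff_right herm_smult_right)
  then show ?thesis by (simp add: integral_unique)
qed

lemma h21_solves: "solves T (\<lambda>\<tau> d x. d - A \<tau> *v x + (\<i> * \<omega>) *s x - (N21 \<tau> - (2 * \<i> * c) *s v \<tau>
          - (2 * \<alpha>1) *s (A \<tau> *v v \<tau> - (\<i> * \<omega>) *s v \<tau>))) (h 2 1)"
  by (rule h_solves) (simp_all add: equation_2_1 dv_def del: One_nat_def)

lemma unique_h21: "unique_solution T
       (\<lambda>\<tau> d x. d - A \<tau> *v x + (\<i> * \<omega>) *s x - cF \<tau> [v \<tau>, v \<tau>, vb \<tau>]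
          - 2 *s cF \<tau> [v \<tau>, h 1 1 \<tau>] - cF \<tau> [vb \<tau>, h 2 0 \<tau>] + (2 * \<i> * c) *s v \<tau>
          + (2 * \<alpha>1) *s (A \<tau> *v v \<tau> - (\<i> * \<omega>) *s v \<tau>))
       (\<lambda>g. integral {0..T} (\<lambda>\<tau>. \<langle>vs \<tau>, g \<tau>\<rangle>) = 0) (h 2 1)" (is "unique_solution T ?R _ _")
proof -
  have eq: "?R = (\<lambda>\<tau> d x. d - A \<tau> *v x + (\<i> * \<omega>) *s x - (N21 \<tau> - (2 * \<i> * c) *s v \<tau>
          - (2 * \<alpha>1) *s (A \<tau> *v v \<tau> - (\<i> * \<omega>) *s v \<tau>)))"
    by (simp add: fun_eq_iff)
  show ?thesis unfolding eq
    by (rule unique_resonant[OF h21_solves v_solves simple_multipliers(1) solves_continuous[OF vs_solves] integral_vs_v integral_h(2)])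
qed

lemma c_formula: "c = - (\<i> / 2) * integral {0..T} (\<lambda>\<tau>. \<langle>vs \<tau>, N21 \<tau> - (2 * \<alpha>1) *s (A \<tau> *v v \<tau>)\<rangle>) + \<alpha>1 * \<omega>"
proof -
  have "((\<lambda>\<tau>. \<langle>vs \<tau>, N21 \<tau> - (2 * \<i> * c) *s v \<tau> - (2 * \<alpha>1) *s (A \<tau> *v v \<tau> - (\<i> * \<omega>) *s v \<tau>)\<rangle>) has_integral 0) {0..T}"
    by (rule fredholm[OF vs_solves h21_solves])
  \<comment> \<open>The factor collects the multiples of \<open>v\<close> that stem from c and from
    -\<i> \<omega> \<open>v\<close> in the derivative of \<open>v\<close>; only A \<open>v\<close>
    is left under the integral.\<close>
  from has_integral_add[OF this has_integral_mult_right[OF vs_v_has_integral, of "2 * \<i> * c - 2 * \<alpha>1 * (\<i> * \<omega>)"]]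
  have "((\<lambda>\<tau>. \<langle>vs \<tau>, N21 \<tau> - (2 * \<alpha>1) *s (A \<tau> *v v \<tau>)\<rangle>) has_integral (2 * \<i> * c - 2 * \<alpha>1 * (\<i> * \<omega>))) {0..T}"
    by (simp add: herm_diff_right herm_add_right herm_smult_right algebra_simps)
  then have "integral {0..T} (\<lambda>\<tau>. \<langle>vs \<tau>, N21 \<tau> - (2 * \<alpha>1) *s (A \<tau> *v v \<tau>)\<rangle>) = 2 * \<i> * c - 2 * \<alpha>1 * (\<i> * \<omega>)"
    by (rule integral_unique)
  then show ?thesis by (simp add: complex_eq_iff field_simps)
qed

text \<open>The derivative of \<open>h 1 1\<close> has been replaced by its own equation, which
  brings in a second factor \<alpha>1 in front of F(u0).\<close>

lemma h22_solves: "solves T (\<lambda>\<tau> d x. d - A \<tau> *v x + 0 *s x - (N22 \<tau>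
          - (4 * \<alpha>1) *s (A \<tau> *v h 1 1 \<tau> + cF \<tau> [v \<tau>, vb \<tau>] - \<alpha>1 *s cvec (F (u0 \<tau>)))
          - (4 * \<alpha>2) *s cvec (F (u0 \<tau>)))) (h 2 2)"
  by (rule h_solves) (simp_all add: equation_2_2 equation_1_1 del: One_nat_def)

lemma unique_h22: "unique_solution T
       (\<lambda>\<tau> d x. d - A \<tau> *v x - cF \<tau> [v \<tau>, v \<tau>, vb \<tau>, vb \<tau>]
          - cF \<tau> [v \<tau>, v \<tau>, h 0 2 \<tau>] - 4 *s cF \<tau> [v \<tau>, vb \<tau>, h 1 1 \<tau>]
          - cF \<tau> [vb \<tau>, vb \<tau>, h 2 0 \<tau>] - 2 *s cF \<tau> [h 1 1 \<tau>, h 1 1 \<tau>]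
          - 2 *s cF \<tau> [v \<tau>, h 1 2 \<tau>] - cF \<tau> [h 0 2 \<tau>, h 2 0 \<tau>]
          - 2 *s cF \<tau> [vb \<tau>, h 2 1 \<tau>]
          + (4 * \<alpha>1) *s (A \<tau> *v h 1 1 \<tau> + cF \<tau> [v \<tau>, vb \<tau>] - \<alpha>1 *s cvec (F (u0 \<tau>)))
          + (4 * \<alpha>2) *s cvec (F (u0 \<tau>)))
       (\<lambda>g. integral {0..T} (\<lambda>\<tau>. \<langle>cvec (\<phi>s \<tau>), g \<tau>\<rangle>) = 0) (h 2 2)" (is "unique_solution T ?R _ _")
proof -
  have eq: "?R = (\<lambda>\<tau> d x. d - A \<tau> *v x + 0 *s x - (N22 \<tau>
          - (4 * \<alpha>1) *s (A \<tau> *v h 1 1 \<tau> + cF \<tau> [v \<tau>, vb \<tau>] - \<alpha>1 *s cvec (F (u0 \<tau>)))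
          - (4 * \<alpha>2) *s cvec (F (u0 \<tau>))))"
    by (simp add: fun_eq_iff)
  show ?thesis unfolding eq
    by (rule unique_resonant[OF h22_solves F_solves simple_multipliers(2) solves_continuous[OF phi_solves] integral_phi_F integral_h(3)])
qed

lemma alpha2_formula: "\<alpha>2 = 1 / 4 * integral {0..T} (\<lambda>\<tau>. \<langle>cvec (\<phi>s \<tau>),
         N22 \<tau> - (4 * \<alpha>1) *s (A \<tau> *v h 1 1 \<tau> + cF \<tau> [v \<tau>, vb \<tau>])\<rangle>) + \<alpha>1 ^ 2"
proof -
  have "((\<lambda>\<tau>. \<langle>cvec (\<phi>s \<tau>), N22 \<tau>
          - (4 * \<alpha>1) *s (A \<tau> *v h 1 1 \<tau> + cF \<tau> [v \<tau>, vb \<tau>] - \<alpha>1 *s cvec (F (u0 \<tau>)))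
          - (4 * \<alpha>2) *s cvec (F (u0 \<tau>))\<rangle>) has_integral 0) {0..T}"
    by (rule fredholm[OF phi_solves]) (use h22_solves in simp)
  \<comment> \<open>The total multiple of F(u0) is 4 \<alpha>1^2 - 4 \<alpha>2; the square is the
    origin of \<alpha>1^2 in the formula.\<close>
  from has_integral_add[OF this has_integral_mult_right[OF phi_F_has_integral, of "complex_of_real (4 * \<alpha>2 - 4 * \<alpha>1 ^ 2)"]]
  have "((\<lambda>\<tau>. \<langle>cvec (\<phi>s \<tau>), N22 \<tau> - (4 * \<alpha>1) *s (A \<tau> *v h 1 1 \<tau> + cF \<tau> [v \<tau>, vb \<tau>])\<rangle>)
     has_integral complex_of_real (4 * \<alpha>2 - 4 * \<alpha>1 ^ 2)) {0..T}"
    by (simp add: herm_diff_right herm_add_right herm_smult_right algebra_simps power2_eq_square)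
  then have "integral {0..T} (\<lambda>\<tau>. \<langle>cvec (\<phi>s \<tau>), N22 \<tau> - (4 * \<alpha>1) *s (A \<tau> *v h 1 1 \<tau> + cF \<tau> [v \<tau>, vb \<tau>])\<rangle>)
     = complex_of_real (4 * \<alpha>2 - 4 * \<alpha>1 ^ 2)"
    by (rule integral_unique)
  then show ?thesis by (simp add: field_simps)
qed

text \<open>Used for its solvability condition, which determines e; the derivative of
  \<open>h 2 1\<close> is kept and eliminated there.\<close>

lemma h32_solves: "solves T (\<lambda>\<tau> d x. d - A \<tau> *v x + (\<i> * \<omega>) *s x - (N32 \<tau> - (12 * e) *s v \<tau>
      - (12 * \<alpha>2) *s dv \<tau> - (6 * \<alpha>1) *s h' 2 1 \<tau> - (6 * \<i> * c) *s h 2 1 \<tau>)) (h 3 2)"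
  by (rule h_solves) (simp_all add: equation_3_2)

lemma e_formula: "e = 1 / 12 * integral {0..T} (\<lambda>\<tau>. \<langle>vs \<tau>, N32 \<tau> - (12 * \<alpha>2) *s (A \<tau> *v v \<tau>)
         - (6 * \<alpha>1) *s (A \<tau> *v h 2 1 \<tau> + 2 *s cF \<tau> [v \<tau>, h 1 1 \<tau>]
              + cF \<tau> [v \<tau>, v \<tau>, vb \<tau>] + cF \<tau> [vb \<tau>, h 2 0 \<tau>]
              - (2 * \<alpha>1) *s (A \<tau> *v v \<tau>))\<rangle>)
         + \<i> * \<omega> * \<alpha>2 + \<i> * c * \<alpha>1 - \<i> * \<omega> * \<alpha>1 ^ 2" (is "_ = 1 / 12 * integral _ (\<lambda>\<tau>. \<langle>_, ?Q \<tau>\<rangle>) + _ + _ - _")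
proof -
  have h21: "((\<lambda>\<tau>. \<langle>vs \<tau>, h 2 1 \<tau>\<rangle>) has_integral 0) {0..T}"
    using integrable_integral[OF herm_integrable[OF solves_continuous[OF vs_solves] solves_continuous[OF h21_solves]]]
    by (simp add: integral_h(2) del: One_nat_def)
  \<comment> \<open>Minus the total multiple of \<open>v\<close> after the derivatives of
    \<open>v\<close> and \<open>h 2 1\<close> are inserted: the derivative of \<open>h 2 1\<close>
    contributes the terms with c \<alpha>1 and \<alpha>1^2. The multiples of \<open>h 2 1\<close>
    itself integrate to 0 by its normalization.\<close>
  define k where "k = 12 * e - 12 * \<i> * \<omega> * \<alpha>2 - 12 * \<i> * c * \<alpha>1 + 12 * \<i> * \<omega> * \<alpha>1 ^ 2"
  have "((\<lambda>\<tau>. \<langle>vs \<tau>, N32 \<tau> - (12 * e) *s v \<tau>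
      - (12 * \<alpha>2) *s dv \<tau> - (6 * \<alpha>1) *s h' 2 1 \<tau> - (6 * \<i> * c) *s h 2 1 \<tau>\<rangle>) has_integral 0) {0..T}"
    by (rule fredholm[OF vs_solves h32_solves])
  from has_integral_add[OF has_integral_add[OF this has_integral_mult_right[OF vs_v_has_integral, of k]]
      has_integral_mult_right[OF h21, of "6 * \<i> * c - 6 * \<alpha>1 * (\<i> * \<omega>)"]]
  have "((\<lambda>\<tau>. \<langle>vs \<tau>, N32 \<tau> - (12 * e) *s v \<tau>
      - (12 * \<alpha>2) *s dv \<tau> - (6 * \<alpha>1) *s h' 2 1 \<tau> - (6 * \<i> * c) *s h 2 1 \<tau>\<rangle> + k * \<langle>vs \<tau>, v \<tau>\<rangle>
      + (6 * \<i> * c - 6 * \<alpha>1 * (\<i> * \<omega>)) * \<langle>vs \<tau>, h 2 1 \<tau>\<rangle>) has_integral k) {0..T}"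
    by simp
  then have "((\<lambda>\<tau>. \<langle>vs \<tau>, ?Q \<tau>\<rangle>) has_integral k) {0..T}"
  proof (rule has_integral_eq[rotated])
    fix \<tau> assume \<tau>: "\<tau> \<in> {0..T}"
    have "N32 \<tau> - (12 * e) *s v \<tau> - (12 * \<alpha>2) *s dv \<tau> - (6 * \<alpha>1) *s h' 2 1 \<tau> - (6 * \<i> * c) *s h 2 1 \<tau>
       + k *s v \<tau> + (6 * \<i> * c - 6 * \<alpha>1 * (\<i> * \<omega>)) *s h 2 1 \<tau> = ?Q \<tau>"
      unfolding equation_2_1[OF \<tau>] dv_def k_def
      by (simp add: vec_eq_iff algebra_simps power2_eq_square)
    then show "\<langle>vs \<tau>, N32 \<tau> - (12 * e) *s v \<tau>
      - (12 * \<alpha>2) *s dv \<tau> - (6 * \<alpha>1) *s h' 2 1 \<tau> - (6 * \<i> * c) *s h 2 1 \<tau>\<rangle> + k * \<langle>vs \<tau>, v \<tau>\<rangle>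
      + (6 * \<i> * c - 6 * \<alpha>1 * (\<i> * \<omega>)) * \<langle>vs \<tau>, h 2 1 \<tau>\<rangle> = \<langle>vs \<tau>, ?Q \<tau>\<rangle>"
      by (simp only: herm_add_right[symmetric] herm_smult_right[symmetric])
  qed
  then have "integral {0..T} (\<lambda>\<tau>. \<langle>vs \<tau>, ?Q \<tau>\<rangle>) = k" by (rule integral_unique)
  then show ?thesis by (simp add: k_def field_simps)
qed

end

section \<open>Uniqueness of the coefficients and the phase shift\<close>

text \<open>The factor between two adjoint solutions is 1, as both are normalized against the same
  y.\<close>

lemma (in floquet) adjoint_unique:
  assumes z: "solves T (\<lambda>t d z. d + cmat (transpose (A t)) *v z + (\<i> * complex_of_real \<nu>) *s z) z"
    and w: "solves T (\<lambda>t d z. d + cmat (transpose (A t)) *v z + (\<i> * complex_of_real \<nu>) *s z) w"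
    and ord: "order (exp (\<i> * \<nu> * T)) (charpoly (cmat (Y T))) = 1"
    and zy: "integral {0..T} (\<lambda>t. \<langle>z t, y t\<rangle>) = 1" and wy: "integral {0..T} (\<lambda>t. \<langle>w t, y t\<rangle>) = 1"
    and t: "t \<in> {0..T}"
  shows "z t = w t"
proof -
  have "w 0 \<noteq> 0"
  proof
    assume "w 0 = 0"
    then have "integral {0..T} (\<lambda>t. \<langle>w t, y t\<rangle>) = integral {0..T} (\<lambda>t. 0 :: complex)"
      by (intro integral_cong) (simp add: adjoint_zero[OF w] herm_zero_left)
    then show False using wy by simp
  qed
  then obtain \<kappa> where \<kappa>: "\<And>t. t \<in> {0..T} \<Longrightarrow> z t = \<kappa> *s w t"
    using adjoint_proportional[OF z w ord] by blast
  have "integral {0..T} (\<lambda>t. \<langle>z t, y t\<rangle>) = integral {0..T} (\<lambda>t. cnj \<kappa> * \<langle>w t, y t\<rangle>)"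
    by (rule integral_cong) (simp add: \<kappa> herm_smult_left)
  then have "cnj \<kappa> = 1" using zy wy by simp
  then have "\<kappa> = 1" by simp
  then show ?thesis using \<kappa>[OF t] by simp
qed

text \<open>Two sets of data are only known to agree on the period interval, so the two equations
  are compared there and nowhere else.\<close>

lemma unique_solutionD:
  assumes "unique_solution T R P h" "unique_solution T R' P' g"
    and "\<And>t d x. t \<in> {0..T} \<Longrightarrow> R' t d x = R t d x" and "P' g \<Longrightarrow> P g" and "t \<in> {0..T}"
  shows "g t = h t"
  using assms solves_cong[of T R' R g] unfolding unique_solution_def by blast

text \<open>Every formula and every equation refers only to quantities already settled, in the order
  \<open>h 2 0\<close>, \<alpha>1, \<open>h 1 1\<close>, c, \<open>h 2 1\<close>,
  \<open>h 3 0\<close>, \<open>h 3 1\<close>, \<alpha>2, \<open>h 2 2\<close>, e. The adjoint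
  functions are settled beforehand by \<open>adjoint_unique\<close>, and entries with exchanged
  indices by conjugation.\<close>

lemma coefficients_unique:
  fixes F :: "real^'n \<Rightarrow> real^'n"
  assumes D1: "ch_full F u0 T \<omega> \<delta> \<alpha>1 \<alpha>2 c e v vs \<phi>s H h Y \<theta>"
    and D2: "ch_full F u0 T \<omega> \<delta>2 a1 a2 c2 e2 v vs2 \<phi>s2 H2 h2 Y \<theta>"
  shows "a1 = \<alpha>1 \<and> a2 = \<alpha>2 \<and> c2 = c \<and> e2 = e"
proof -
  interpret D1: ch_full F u0 T \<omega> \<delta> \<alpha>1 \<alpha>2 c e v vs \<phi>s H h Y \<theta> by (rule D1)
  interpret D2: ch_full F u0 T \<omega> \<delta>2 a1 a2 c2 e2 v vs2 \<phi>s2 H2 h2 Y \<theta> by (rule D2)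
  have vs: "vs2 \<tau> = vs \<tau>" if "\<tau> \<in> {0..T}" for \<tau>
    by (rule D1.adjoint_unique[OF D2.vs_solves D1.vs_solves D1.simple_multipliers(1) D2.integral_vs_v D1.integral_vs_v that])
  have ord0: "order (exp (\<i> * complex_of_real 0 * complex_of_real T)) (charpoly (cmat (Y T))) = 1"
    using D1.simple_multipliers(2) by simp
  have phi: "cvec (\<phi>s2 \<tau>) = cvec (\<phi>s \<tau>)" if "\<tau> \<in> {0..T}" for \<tau>
    by (rule D1.adjoint_unique[OF D2.phi_solves D1.phi_solves ord0 D2.integral_phi_F D1.integral_phi_F that])
  have phi_int: "integral {0..T} (\<lambda>\<tau>. \<langle>cvec (\<phi>s2 \<tau>), g \<tau>\<rangle>) = integral {0..T} (\<lambda>\<tau>. \<langle>cvec (\<phi>s \<tau>), g \<tau>\<rangle>)" for g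
    by (rule integral_cong) (simp add: phi)
  have vs_int: "integral {0..T} (\<lambda>\<tau>. \<langle>vs2 \<tau>, g \<tau>\<rangle>) = integral {0..T} (\<lambda>\<tau>. \<langle>vs \<tau>, g \<tau>\<rangle>)" for g
    by (rule integral_cong) (simp add: vs)
  have h20: "h2 2 0 \<tau> = h 2 0 \<tau>" if "\<tau> \<in> {0..T}" for \<tau>
    by (rule unique_solutionD[OF D1.unique_h20 D2.unique_h20 _ _ that]) auto
  have h02: "h2 0 2 \<tau> = h 0 2 \<tau>" if "\<tau> \<in> {0..T}" for \<tau>
    using h20[OF that] D1.h_cnj[of 0 2 \<tau>] D2.h_cnj[of 0 2 \<tau>] by simp
  have "complex_of_real a1 = complex_of_real \<alpha>1"
    unfolding D1.alpha1_formula D2.alpha1_formula by (rule phi_int)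
  then have a1: "a1 = \<alpha>1" by simp
  have h11: "h2 1 1 \<tau> = h 1 1 \<tau>" if "\<tau> \<in> {0..T}" for \<tau>
    by (rule unique_solutionD[OF D1.unique_h11 D2.unique_h11 _ _ that]) (simp_all add: a1 phi_int)
  have "complex_of_real c2 = complex_of_real c"
    unfolding D1.c_formula D2.c_formula vs_int a1
    by (intro arg_cong2[where f = "(+)"] arg_cong2[where f = "(*)"] refl integral_cong) (simp only: h11 h20)
  then have c: "c2 = c" by simp
  have h21: "h2 2 1 \<tau> = h 2 1 \<tau>" if "\<tau> \<in> {0..T}" for \<tau>
    by (rule unique_solutionD[OF D1.unique_h21 D2.unique_h21 _ _ that]) (simp_all only: a1 c vs_int h11 h20)
  have h12: "h2 1 2 \<tau> = h 1 2 \<tau>" if "\<tau> \<in> {0..T}" for \<tau>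
    using h21[OF that] D1.h_cnj[of 1 2 \<tau>] D2.h_cnj[of 1 2 \<tau>] by simp
  have h30: "h2 3 0 \<tau> = h 3 0 \<tau>" if "\<tau> \<in> {0..T}" for \<tau>
    by (rule unique_solutionD[OF D1.unique_h30 D2.unique_h30 _ _ that]) (simp_all only: h20)
  have h31: "h2 3 1 \<tau> = h 3 1 \<tau>" if "\<tau> \<in> {0..T}" for \<tau>
    by (rule unique_solutionD[OF D1.unique_h31 D2.unique_h31 _ _ that]) (simp_all only: a1 c h11 h20 h21 h30)
  have "complex_of_real a2 = complex_of_real \<alpha>2"
    unfolding D1.alpha2_formula D2.alpha2_formula phi_int a1
    by (intro arg_cong2[where f = "(+)"] arg_cong2[where f = "(*)"] refl integral_cong) (simp only: h11 h20 h02 h12 h21)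
  then have a2: "a2 = \<alpha>2" by simp
  have h22: "h2 2 2 \<tau> = h 2 2 \<tau>" if "\<tau> \<in> {0..T}" for \<tau>
    by (rule unique_solutionD[OF D1.unique_h22 D2.unique_h22 _ _ that])
      (simp_all only: a1 a2 phi_int h11 h20 h02 h12 h21)
  have "e2 = e"
    by (subst D1.e_formula, subst D2.e_formula, unfold vs_int a1 a2 c)
      (intro arg_cong2[where f = "(+)"] arg_cong2[where f = "(-)"] arg_cong2[where f = "(*)"] refl integral_cong,
       simp only: h11 h20 h02 h12 h21 h30 h31 h22)
  with a1 a2 c show ?thesis by simp
qed

section \<open>Rotation of the phase\<close>

lemma solves_smult:
  fixes f :: "real \<Rightarrow> complex^'n"
  assumes "solves T R f" "\<And>t d x. R t (\<gamma> *s d) (\<gamma> *s x) = \<gamma> *s R t d x"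
  shows "solves T R (\<lambda>t. \<gamma> *s f t)"
  unfolding solves_def
proof (intro conjI ballI)
  fix t assume "t \<in> {0..T}"
  then obtain d where "(f has_vector_derivative d) (at t within {0..T})" "R t d (f t) = 0"
    using assms(1) unfolding solves_def by blast
  then show "\<exists>d. ((\<lambda>t. \<gamma> *s f t) has_vector_derivative d) (at t within {0..T}) \<and> R t d (\<gamma> *s f t) = 0"
    by (intro exI[of _ "\<gamma> *s d"] conjI
        bounded_linear.has_vector_derivative[OF bounded_bilinear.bounded_linear_right[OF bounded_bilinear_smult]])
      (simp_all add: assms(2))
qed (use assms in \<open>simp add: solves_def\<close>)

lemma Ck_on_rotate:
  fixes f :: "real \<Rightarrow> complex \<Rightarrow> 'b::real_normed_vector" and L :: "'b \<Rightarrow> 'd::real_normed_vector"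
  assumes f: "Ck_on k (\<lambda>(\<tau>, \<xi>). f \<tau> \<xi>) (UNIV \<times> ball 0 \<delta>)" and \<gamma>: "cmod \<gamma> = 1" and L: "bounded_linear L"
  shows "Ck_on k (\<lambda>(\<tau>, \<xi>). L (f \<tau> (\<gamma> * \<xi>))) (UNIV \<times> ball 0 \<delta>)"
proof -
  define M where "M x = (fst x, \<gamma> * snd x)" for x :: "real \<times> complex"
  have M: "bounded_linear M"
    unfolding M_def by (intro bounded_linear_Pair bounded_linear_fst bounded_linear_compose[OF bounded_linear_mult_right bounded_linear_snd])
  have "open (UNIV \<times> ball 0 \<delta> :: (real \<times> complex) set)" by (intro open_Times) auto
  from Ck_on_linear_compose[OF this L M f]
  have "Ck_on k (\<lambda>x. L ((\<lambda>(\<tau>, \<xi>). f \<tau> \<xi>) (M x))) (M -` (UNIV \<times> ball 0 \<delta>))" .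
  moreover have "M -` (UNIV \<times> ball 0 \<delta>) = UNIV \<times> ball 0 \<delta>"
    using \<gamma> by (auto simp: M_def norm_mult)
  ultimately show ?thesis by (simp add: M_def split_def)
qed

text \<open>The pairing is conjugate-linear in its first argument, so \<open>vs\<close> has to be
  turned by the same \<gamma> as \<open>v\<close> to keep the normalization.\<close>

lemma critical_eigenfunctions_rotate:
  assumes \<gamma>: "cmod \<gamma> = 1" and E: "critical_eigenfunctions F u0 T \<omega> v \<phi>s vs"
  shows "critical_eigenfunctions F u0 T \<omega> (\<lambda>\<tau>. \<gamma> *s v \<tau>) \<phi>s (\<lambda>\<tau>. \<gamma> *s vs \<tau>)"
proof -
  have \<gamma>1: "cnj \<gamma> * (\<gamma> * x) = x" for x
    using complex_norm_square[of \<gamma>] \<gamma> by (simp add: mult.assoc[symmetric] mult.commute)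
  show ?thesis
    using E unfolding critical_eigenfunctions_def
    by (auto simp: herm_smult_left herm_smult_right \<gamma>1 mult.left_commute[of \<gamma> "cnj \<gamma>"] vector_scalar_commute
        vec.scale_right_distrib vec.scale_right_diff_distrib mult.commute intro!: solves_smult)
qed

text \<open>With \<gamma> \<open>v\<close> in place of \<open>v\<close> the same manifold is
  parametrized by \<xi> at the point that formerly belonged to \<gamma> \<xi>, which multiplies
  \<open>h j k\<close> by the (j, k) monomial in \<gamma>.\<close>

lemma cm_expansion_rotate:
  assumes \<gamma>: "cmod \<gamma> = 1" and H: "cm_expansion \<delta> T \<phi>s vs H h"
  shows "cm_expansion \<delta> T \<phi>s (\<lambda>\<tau>. \<gamma> *s vs \<tau>) (\<lambda>\<tau> \<xi>. H \<tau> (\<gamma> * \<xi>)) (\<lambda>j k \<tau>. (\<gamma> ^ j * cnj \<gamma> ^ k) *s h j k \<tau>)"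
proof -
  have \<gamma>1: "cnj \<gamma> * (\<gamma> * x) = x" for x
    using complex_norm_square[of \<gamma>] \<gamma> by (simp add: mult.assoc[symmetric] mult.commute)
  note H = H[unfolded cm_expansion_def]
  obtain M where M: "\<forall>\<tau>. \<forall>\<xi>\<in>ball 0 \<delta>.
        norm (cvec (H \<tau> \<xi>) -
              (\<Sum>(j, k) \<in> {(j, k). 2 \<le> j + k \<and> j + k \<le> 5}.
                 (\<xi> ^ j * cnj \<xi> ^ k / (fact j * fact k)) *s h j k \<tau>))
        \<le> M * norm \<xi> ^ 6"
    using H[THEN conjunct2, THEN conjunct2, THEN conjunct1] ..
  show ?thesis
    unfolding cm_expansion_def
  proof (intro conjI)
    show "Ck_on 6 (\<lambda>(\<tau>, \<xi>). H \<tau> (\<gamma> * \<xi>)) (UNIV \<times> ball 0 \<delta>)"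
      using Ck_on_rotate[OF H[THEN conjunct1] \<gamma> bounded_linear_ident] .
    show "\<forall>\<tau>. \<forall>\<xi>\<in>ball 0 \<delta>. H (\<tau> + T) (\<gamma> * \<xi>) = H \<tau> (\<gamma> * \<xi>)"
      using H[THEN conjunct2, THEN conjunct1] \<gamma> by (simp add: norm_mult)
    show "\<exists>M. \<forall>\<tau>. \<forall>\<xi>\<in>ball 0 \<delta>.
        norm (cvec (H \<tau> (\<gamma> * \<xi>)) -
              (\<Sum>(j, k) \<in> {(j, k). 2 \<le> j + k \<and> j + k \<le> 5}.
                 (\<xi> ^ j * cnj \<xi> ^ k / (fact j * fact k)) *s ((\<gamma> ^ j * cnj \<gamma> ^ k) *s h j k \<tau>)))
        \<le> M * norm \<xi> ^ 6"
    proof (intro exI[of _ M] allI ballI)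
      fix \<tau> and \<xi> :: complex assume "\<xi> \<in> ball 0 \<delta>"
      then have "\<gamma> * \<xi> \<in> ball 0 \<delta>" using \<gamma> by (simp add: norm_mult)
      moreover have "(\<Sum>(j, k) \<in> {(j, k). 2 \<le> j + k \<and> j + k \<le> 5}.
                 (\<xi> ^ j * cnj \<xi> ^ k / (fact j * fact k)) *s ((\<gamma> ^ j * cnj \<gamma> ^ k) *s h j k \<tau>))
         = (\<Sum>(j, k) \<in> {(j, k). 2 \<le> j + k \<and> j + k \<le> 5}.
                 ((\<gamma> * \<xi>) ^ j * cnj (\<gamma> * \<xi>) ^ k / (fact j * fact k)) *s h j k \<tau>)"
        by (rule sum.cong) (auto simp: power_mult_distrib mult_ac)
      ultimately show "norm (cvec (H \<tau> (\<gamma> * \<xi>)) -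
              (\<Sum>(j, k) \<in> {(j, k). 2 \<le> j + k \<and> j + k \<le> 5}.
                 (\<xi> ^ j * cnj \<xi> ^ k / (fact j * fact k)) *s ((\<gamma> ^ j * cnj \<gamma> ^ k) *s h j k \<tau>)))
        \<le> M * norm \<xi> ^ 6"
        using M[rule_format, of "\<gamma> * \<xi>" \<tau>] \<gamma> by (simp add: norm_mult)
    qed
    show "\<forall>j k. 2 \<le> j + k \<and> j + k \<le> 5 \<longrightarrow>
        (\<gamma> ^ j * cnj \<gamma> ^ k) *s h j k T = (\<gamma> ^ j * cnj \<gamma> ^ k) *s h j k 0 \<and>
        (\<forall>\<tau>. (\<gamma> ^ j * cnj \<gamma> ^ k) *s h j k \<tau> = vcnj ((\<gamma> ^ k * cnj \<gamma> ^ j) *s h k j \<tau>))"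
    proof (intro allI impI)
      fix j k :: nat assume "2 \<le> j + k \<and> j + k \<le> 5"
      then have h: "h j k T = h j k 0" "\<And>\<tau>. h j k \<tau> = vcnj (h k j \<tau>)"
        using H[THEN conjunct2, THEN conjunct2, THEN conjunct2, THEN conjunct1] by blast+
      show "(\<gamma> ^ j * cnj \<gamma> ^ k) *s h j k T = (\<gamma> ^ j * cnj \<gamma> ^ k) *s h j k 0 \<and>
        (\<forall>\<tau>. (\<gamma> ^ j * cnj \<gamma> ^ k) *s h j k \<tau> = vcnj ((\<gamma> ^ k * cnj \<gamma> ^ j) *s h k j \<tau>))"
        unfolding h(1) h(2)[symmetric] vcnj_smult by (simp add: mult.commute)
    qed
    \<comment> \<open>The factors at \<open>h 1 1\<close> and \<open>h 2 2\<close> are 1. The factor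
      at \<open>h 2 1\<close> is \<gamma> and cancels against that of \<open>vs\<close>, so all
      three normalizations persist.\<close>
    have \<gamma>2: "\<gamma> ^ 1 * cnj \<gamma> ^ 1 = 1" "\<gamma> ^ 2 * cnj \<gamma> ^ 2 = 1" "\<gamma> ^ 2 * cnj \<gamma> ^ 1 = \<gamma>"
      using \<gamma>1[of 1] \<gamma>1[of \<gamma>] \<gamma>1[of "cnj \<gamma> * \<gamma>"] by (simp_all add: power2_eq_square mult_ac)
    show "integral {0..T} (\<lambda>\<tau>. \<langle>cvec (\<phi>s \<tau>), (\<gamma> ^ 1 * cnj \<gamma> ^ 1) *s h 1 1 \<tau>\<rangle>) = 0"
      using H[THEN conjunct2, THEN conjunct2, THEN conjunct2, THEN conjunct2, THEN conjunct1]
      unfolding \<gamma>2 vec.scale_one .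
    show "integral {0..T} (\<lambda>\<tau>. \<langle>\<gamma> *s vs \<tau>, (\<gamma> ^ 2 * cnj \<gamma> ^ 1) *s h 2 1 \<tau>\<rangle>) = 0"
      using H[THEN conjunct2, THEN conjunct2, THEN conjunct2, THEN conjunct2, THEN conjunct2, THEN conjunct1]
      unfolding \<gamma>2 herm_smult_left herm_smult_right mult.left_commute[of \<gamma> "cnj \<gamma>"] \<gamma>1 .
    show "integral {0..T} (\<lambda>\<tau>. \<langle>cvec (\<phi>s \<tau>), (\<gamma> ^ 2 * cnj \<gamma> ^ 2) *s h 2 2 \<tau>\<rangle>) = 0"
      using H[THEN conjunct2, THEN conjunct2, THEN conjunct2, THEN conjunct2, THEN conjunct2, THEN conjunct2]
      unfolding \<gamma>2 vec.scale_one .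
  qed
qed

text \<open>The truncated restricted system is equivariant under rotations of \<xi>, so the
  coefficients stay the same; only the remainders change, q to cnj \<gamma> times q at \<gamma>
  \<xi>.\<close>

lemma CH_normal_form_rotate:
  assumes \<gamma>: "cmod \<gamma> = 1" and N: "CH_normal_form \<delta> F u0 T \<omega> v H \<alpha>1 \<alpha>2 c e"
  shows "CH_normal_form \<delta> F u0 T \<omega> (\<lambda>\<tau>. \<gamma> *s v \<tau>) (\<lambda>\<tau> \<xi>. H \<tau> (\<gamma> * \<xi>)) \<alpha>1 \<alpha>2 c e"
proof -
  have \<gamma>1: "\<gamma> * (cnj \<gamma> * x) = x" for x
    using complex_norm_square[of \<gamma>] \<gamma> by (simp add: mult.assoc[symmetric])
  obtain p :: "real \<Rightarrow> complex \<Rightarrow> real" and q :: "real \<Rightarrow> complex \<Rightarrow> complex" and M where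
    p: "Ck_on 1 (\<lambda>(\<tau>, \<xi>). p \<tau> \<xi>) (UNIV \<times> ball 0 \<delta>)" and
    q: "Ck_on 1 (\<lambda>(\<tau>, \<xi>). q \<tau> \<xi>) (UNIV \<times> ball 0 \<delta>)" and
    per: "\<forall>\<tau>. \<forall>\<xi>\<in>ball 0 \<delta>. p (\<tau> + T) \<xi> = p \<tau> \<xi> \<and> q (\<tau> + T) \<xi> = q \<tau> \<xi>" and
    M: "\<forall>\<tau>. \<forall>\<xi>\<in>ball 0 \<delta>. \<bar>p \<tau> \<xi>\<bar> \<le> M * norm \<xi> ^ 6 \<and> norm (q \<tau> \<xi>) \<le> M * norm \<xi> ^ 6" and
    sol: "\<forall>a b (\<tau> :: real \<Rightarrow> real) (\<xi> :: real \<Rightarrow> complex).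
           (\<forall>t\<in>{a<..<b}.
              \<xi> t \<in> ball 0 \<delta> \<and>
              (\<tau> has_real_derivative
                 1 + \<alpha>1 * norm (\<xi> t) ^ 2 + \<alpha>2 * norm (\<xi> t) ^ 4 + p (\<tau> t) (\<xi> t)) (at t) \<and>
              (\<xi> has_vector_derivative
                 \<i> * \<omega> * \<xi> t + \<i> * c * \<xi> t * norm (\<xi> t) ^ 2 + e * \<xi> t * norm (\<xi> t) ^ 4
                 + q (\<tau> t) (\<xi> t)) (at t))
           \<longrightarrow> (\<forall>t\<in>{a<..<b}.
              ((\<lambda>s. cm_param u0 v H (\<tau> s) (\<xi> s)) has_vector_derivative
                 F (cm_param u0 v H (\<tau> t) (\<xi> t))) (at t))"
    using N unfolding CH_normal_form_def by blast
  have param: "cm_param u0 (\<lambda>\<tau>. \<gamma> *s v \<tau>) (\<lambda>\<tau> \<xi>. H \<tau> (\<gamma> * \<xi>)) \<tau> \<xi> = cm_param u0 v H \<tau> (\<gamma> * \<xi>)" for \<tau> \<xi>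
    by (simp add: cm_param_def vcnj_smult mult.commute)
  show ?thesis
    unfolding CH_normal_form_def
  proof (intro exI conjI allI impI)
    show "Ck_on 1 (\<lambda>(\<tau>, \<xi>). p \<tau> (\<gamma> * \<xi>)) (UNIV \<times> ball 0 \<delta>)"
      by (rule Ck_on_rotate[OF p \<gamma> bounded_linear_ident])
    show "Ck_on 1 (\<lambda>(\<tau>, \<xi>). cnj \<gamma> * q \<tau> (\<gamma> * \<xi>)) (UNIV \<times> ball 0 \<delta>)"
      by (rule Ck_on_rotate[OF q \<gamma> bounded_linear_mult_right])
    show "\<forall>\<xi>\<in>ball 0 \<delta>. p (\<tau> + T) (\<gamma> * \<xi>) = p \<tau> (\<gamma> * \<xi>) \<and> cnj \<gamma> * q (\<tau> + T) (\<gamma> * \<xi>) = cnj \<gamma> * q \<tau> (\<gamma> * \<xi>)" for \<tau>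
      using per \<gamma> by (simp add: norm_mult)
    show "\<forall>\<xi>\<in>ball 0 \<delta>. \<bar>p \<tau> (\<gamma> * \<xi>)\<bar> \<le> M * norm \<xi> ^ 6 \<and> norm (cnj \<gamma> * q \<tau> (\<gamma> * \<xi>)) \<le> M * norm \<xi> ^ 6" for \<tau>
    proof
      fix \<xi> :: complex assume "\<xi> \<in> ball 0 \<delta>"
      then have "\<gamma> * \<xi> \<in> ball 0 \<delta>" using \<gamma> by (simp add: norm_mult)
      then show "\<bar>p \<tau> (\<gamma> * \<xi>)\<bar> \<le> M * norm \<xi> ^ 6 \<and> norm (cnj \<gamma> * q \<tau> (\<gamma> * \<xi>)) \<le> M * norm \<xi> ^ 6"
        using M[rule_format, of "\<gamma> * \<xi>" \<tau>] \<gamma> by (simp add: norm_mult)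
    qed
    fix a b and \<tau> :: "real \<Rightarrow> real" and \<xi> :: "real \<Rightarrow> complex"
    assume *: "\<forall>t\<in>{a<..<b}.
              \<xi> t \<in> ball 0 \<delta> \<and>
              (\<tau> has_real_derivative
                 1 + \<alpha>1 * norm (\<xi> t) ^ 2 + \<alpha>2 * norm (\<xi> t) ^ 4 + p (\<tau> t) (\<gamma> * \<xi> t)) (at t) \<and>
              (\<xi> has_vector_derivative
                 \<i> * \<omega> * \<xi> t + \<i> * c * \<xi> t * norm (\<xi> t) ^ 2 + e * \<xi> t * norm (\<xi> t) ^ 4
                 + cnj \<gamma> * q (\<tau> t) (\<gamma> * \<xi> t)) (at t)"
    show "\<forall>t\<in>{a<..<b}.
              ((\<lambda>s. cm_param u0 (\<lambda>\<tau>. \<gamma> *s v \<tau>) (\<lambda>\<tau> \<xi>. H \<tau> (\<gamma> * \<xi>)) (\<tau> s) (\<xi> s)) has_vector_derivative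
                 F (cm_param u0 (\<lambda>\<tau>. \<gamma> *s v \<tau>) (\<lambda>\<tau> \<xi>. H \<tau> (\<gamma> * \<xi>)) (\<tau> t) (\<xi> t))) (at t)"
      unfolding param
    proof (rule sol[THEN spec, THEN spec, THEN spec, THEN spec, THEN mp, of a b "\<lambda>t. \<gamma> * \<xi> t" \<tau>], intro ballI conjI)
      fix t assume "t \<in> {a<..<b}"
      note t = bspec[OF * this]
      show "\<gamma> * \<xi> t \<in> ball 0 \<delta>" using t \<gamma> by (simp add: norm_mult)
      show "(\<tau> has_real_derivative 1 + \<alpha>1 * norm (\<gamma> * \<xi> t) ^ 2 + \<alpha>2 * norm (\<gamma> * \<xi> t) ^ 4 + p (\<tau> t) (\<gamma> * \<xi> t)) (at t)"
        using t \<gamma> by (simp add: norm_mult)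
      have "((\<lambda>t. \<gamma> * \<xi> t) has_vector_derivative \<gamma> * (\<i> * \<omega> * \<xi> t + \<i> * c * \<xi> t * norm (\<xi> t) ^ 2 + e * \<xi> t * norm (\<xi> t) ^ 4
                 + cnj \<gamma> * q (\<tau> t) (\<gamma> * \<xi> t))) (at t)"
        by (rule has_vector_derivative_mult_right) (use t in blast)
      then show "((\<lambda>t. \<gamma> * \<xi> t) has_vector_derivative
         \<i> * \<omega> * (\<gamma> * \<xi> t) + \<i> * c * (\<gamma> * \<xi> t) * norm (\<gamma> * \<xi> t) ^ 2 + e * (\<gamma> * \<xi> t) * norm (\<gamma> * \<xi> t) ^ 4
                 + q (\<tau> t) (\<gamma> * \<xi> t)) (at t)"
        using \<gamma> by (simp add: norm_mult distrib_left \<gamma>1 mult_ac)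
    qed
  qed
qed

lemma CH_coefficients_rotate:
  assumes "cmod \<gamma> = 1" "CH_coefficients F u0 T \<omega> v \<alpha>1 \<alpha>2 c e"
  shows "CH_coefficients F u0 T \<omega> (\<lambda>\<tau>. \<gamma> *s v \<tau>) \<alpha>1 \<alpha>2 c e"
proof -
  obtain \<phi>s vs \<delta> H h where d: "critical_eigenfunctions F u0 T \<omega> v \<phi>s vs" "\<delta> > 0"
      "cm_expansion \<delta> T \<phi>s vs H h" "CH_normal_form \<delta> F u0 T \<omega> v H \<alpha>1 \<alpha>2 c e"
    using assms(2) unfolding CH_coefficients_def by blast
  show ?thesis
    unfolding CH_coefficients_def
    using critical_eigenfunctions_rotate[OF assms(1) d(1)] d(2)
      cm_expansion_rotate[OF assms(1) d(3)] CH_normal_form_rotate[OF assms(1) d(4)] by blast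
qed

text \<open>Independence of the phase is expressed by the set of admissible coefficients for
  \<gamma> \<open>v\<close>: it consists exactly of the given quadruple. For \<gamma> = 1 this
  includes that the coefficients are determined by \<open>v\<close>.\<close>

theorem mainTheorem3:
  fixes F :: "real^'n \<Rightarrow> real^'n"
    and u0 :: "real \<Rightarrow> real^'n"
    and Y :: "real \<Rightarrow> real^'n^'n"
    and T \<theta> \<omega> \<delta> \<alpha>1 \<alpha>2 c :: real
    and e :: complex
    and v vs :: "real \<Rightarrow> complex^'n"
    and \<phi>s :: "real \<Rightarrow> real^'n"
    and H :: "real \<Rightarrow> complex \<Rightarrow> real^'n"
    and h :: "nat \<Rightarrow> nat \<Rightarrow> real \<Rightarrow> complex^'n"
    and A :: "real \<Rightarrow> complex^'n^'n"
    and B :: "real \<Rightarrow> complex^'n \<Rightarrow> complex^'n \<Rightarrow> complex^'n"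
    and C :: "real \<Rightarrow> complex^'n \<Rightarrow> complex^'n \<Rightarrow> complex^'n \<Rightarrow> complex^'n"
    and D :: "real \<Rightarrow> complex^'n \<Rightarrow> complex^'n \<Rightarrow> complex^'n \<Rightarrow> complex^'n \<Rightarrow> complex^'n"
    and E :: "real \<Rightarrow> complex^'n \<Rightarrow> complex^'n \<Rightarrow> complex^'n \<Rightarrow> complex^'n \<Rightarrow> complex^'n \<Rightarrow> complex^'n"
    and vb :: "real \<Rightarrow> complex^'n"
  assumes smooth: "Ck_on 6 F UNIV"
    and cycle: "limit_cycle F u0 T"
    and Y: "fundamental_matrix F u0 T Y"
    and CH: "CH_multipliers (Y T) \<theta>"
    and \<omega>: "\<omega> = \<theta> / T"
    and eigenfunctions: "critical_eigenfunctions F u0 T \<omega> v \<phi>s vs"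
    and \<delta>: "\<delta> > 0"
    and manifold: "cm_expansion \<delta> T \<phi>s vs H h"
    and normal_form: "CH_normal_form \<delta> F u0 T \<omega> v H \<alpha>1 \<alpha>2 c e"
    and A: "A = (\<lambda>\<tau>. cmat (jacobian F (at (u0 \<tau>))))"
    and B: "B = (\<lambda>\<tau> w1 w2. cderiv F (u0 \<tau>) [w1, w2])"
    and C: "C = (\<lambda>\<tau> w1 w2 w3. cderiv F (u0 \<tau>) [w1, w2, w3])"
    and D: "D = (\<lambda>\<tau> w1 w2 w3 w4. cderiv F (u0 \<tau>) [w1, w2, w3, w4])"
    and E: "E = (\<lambda>\<tau> w1 w2 w3 w4 w5. cderiv F (u0 \<tau>) [w1, w2, w3, w4, w5])"
    and vb: "vb = (\<lambda>\<tau>. vcnj (v \<tau>))"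
  shows
    "unique_solution T
       (\<lambda>\<tau> d x. d - A \<tau> *v x + (2 * \<i> * \<omega>) *s x - B \<tau> (v \<tau>) (v \<tau>))
       (\<lambda>_. True) (h 2 0) \<and>
     (\<alpha>1 = integral {0..T} (\<lambda>\<tau>. \<langle>cvec (\<phi>s \<tau>), B \<tau> (v \<tau>) (vb \<tau>)\<rangle>)) \<and>
     unique_solution T
       (\<lambda>\<tau> d x. d - A \<tau> *v x - B \<tau> (v \<tau>) (vb \<tau>)
          + \<alpha>1 *s cvec (vector_derivative u0 (at \<tau>)))
       (\<lambda>g. integral {0..T} (\<lambda>\<tau>. \<langle>cvec (\<phi>s \<tau>), g \<tau>\<rangle>) = 0) (h 1 1) \<and>
     (c = - (\<i> / 2) * integral {0..T} (\<lambda>\<tau>. \<langle>vs \<tau>,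
         C \<tau> (v \<tau>) (v \<tau>) (vb \<tau>) + 2 *s B \<tau> (v \<tau>) (h 1 1 \<tau>)
         + B \<tau> (vb \<tau>) (h 2 0 \<tau>) - (2 * \<alpha>1) *s (A \<tau> *v v \<tau>)\<rangle>) + \<alpha>1 * \<omega>) \<and>
     unique_solution T
       (\<lambda>\<tau> d x. d - A \<tau> *v x + (\<i> * \<omega>) *s x - C \<tau> (v \<tau>) (v \<tau>) (vb \<tau>)
          - 2 *s B \<tau> (v \<tau>) (h 1 1 \<tau>) - B \<tau> (vb \<tau>) (h 2 0 \<tau>) + (2 * \<i> * c) *s v \<tau>
          + (2 * \<alpha>1) *s (A \<tau> *v v \<tau> - (\<i> * \<omega>) *s v \<tau>))
       (\<lambda>g. integral {0..T} (\<lambda>\<tau>. \<langle>vs \<tau>, g \<tau>\<rangle>) = 0) (h 2 1) \<and>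
     unique_solution T
       (\<lambda>\<tau> d x. d - A \<tau> *v x + (3 * \<i> * \<omega>) *s x - C \<tau> (v \<tau>) (v \<tau>) (v \<tau>)
          - 3 *s B \<tau> (v \<tau>) (h 2 0 \<tau>))
       (\<lambda>_. True) (h 3 0) \<and>
     unique_solution T
       (\<lambda>\<tau> d x. d - A \<tau> *v x + (2 * \<i> * \<omega>) *s x - D \<tau> (v \<tau>) (v \<tau>) (v \<tau>) (vb \<tau>)
          - 3 *s C \<tau> (v \<tau>) (v \<tau>) (h 1 1 \<tau>) - 3 *s C \<tau> (v \<tau>) (vb \<tau>) (h 2 0 \<tau>)
          - 3 *s B \<tau> (h 1 1 \<tau>) (h 2 0 \<tau>) - 3 *s B \<tau> (v \<tau>) (h 2 1 \<tau>)
          - B \<tau> (vb \<tau>) (h 3 0 \<tau>) + (6 * \<i> * c) *s h 2 0 \<tau>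
          + (3 * \<alpha>1) *s (A \<tau> *v h 2 0 \<tau> - (2 * \<i> * \<omega>) *s h 2 0 \<tau> + B \<tau> (v \<tau>) (v \<tau>)))
       (\<lambda>_. True) (h 3 1) \<and>
     (\<alpha>2 = 1 / 4 * integral {0..T} (\<lambda>\<tau>. \<langle>cvec (\<phi>s \<tau>),
         D \<tau> (v \<tau>) (v \<tau>) (vb \<tau>) (vb \<tau>) + C \<tau> (v \<tau>) (v \<tau>) (h 0 2 \<tau>)
         + 4 *s C \<tau> (v \<tau>) (vb \<tau>) (h 1 1 \<tau>) + C \<tau> (vb \<tau>) (vb \<tau>) (h 2 0 \<tau>)
         + 2 *s B \<tau> (h 1 1 \<tau>) (h 1 1 \<tau>) + 2 *s B \<tau> (v \<tau>) (h 1 2 \<tau>)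
         + B \<tau> (h 0 2 \<tau>) (h 2 0 \<tau>) + 2 *s B \<tau> (vb \<tau>) (h 2 1 \<tau>)
         - (4 * \<alpha>1) *s (A \<tau> *v h 1 1 \<tau> + B \<tau> (v \<tau>) (vb \<tau>))\<rangle>) + \<alpha>1 ^ 2) \<and>
     unique_solution T
       (\<lambda>\<tau> d x. d - A \<tau> *v x - D \<tau> (v \<tau>) (v \<tau>) (vb \<tau>) (vb \<tau>)
          - C \<tau> (v \<tau>) (v \<tau>) (h 0 2 \<tau>) - 4 *s C \<tau> (v \<tau>) (vb \<tau>) (h 1 1 \<tau>)
          - C \<tau> (vb \<tau>) (vb \<tau>) (h 2 0 \<tau>) - 2 *s B \<tau> (h 1 1 \<tau>) (h 1 1 \<tau>)
          - 2 *s B \<tau> (v \<tau>) (h 1 2 \<tau>) - B \<tau> (h 0 2 \<tau>) (h 2 0 \<tau>)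
          - 2 *s B \<tau> (vb \<tau>) (h 2 1 \<tau>)
          + (4 * \<alpha>1) *s (A \<tau> *v h 1 1 \<tau> + B \<tau> (v \<tau>) (vb \<tau>) - \<alpha>1 *s cvec (F (u0 \<tau>)))
          + (4 * \<alpha>2) *s cvec (F (u0 \<tau>)))
       (\<lambda>g. integral {0..T} (\<lambda>\<tau>. \<langle>cvec (\<phi>s \<tau>), g \<tau>\<rangle>) = 0) (h 2 2) \<and>
     (e = 1 / 12 * integral {0..T} (\<lambda>\<tau>. \<langle>vs \<tau>,
         E \<tau> (v \<tau>) (v \<tau>) (v \<tau>) (vb \<tau>) (vb \<tau>) + D \<tau> (v \<tau>) (v \<tau>) (v \<tau>) (h 0 2 \<tau>)
         + 6 *s D \<tau> (v \<tau>) (v \<tau>) (vb \<tau>) (h 1 1 \<tau>)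
         + 3 *s D \<tau> (v \<tau>) (vb \<tau>) (vb \<tau>) (h 2 0 \<tau>)
         + 6 *s C \<tau> (v \<tau>) (h 1 1 \<tau>) (h 1 1 \<tau>) + 3 *s C \<tau> (v \<tau>) (v \<tau>) (h 1 2 \<tau>)
         + 3 *s C \<tau> (v \<tau>) (h 0 2 \<tau>) (h 2 0 \<tau>) + 6 *s C \<tau> (vb \<tau>) (h 1 1 \<tau>) (h 2 0 \<tau>)
         + 6 *s C \<tau> (v \<tau>) (vb \<tau>) (h 2 1 \<tau>) + C \<tau> (vb \<tau>) (vb \<tau>) (h 3 0 \<tau>)
         + 3 *s B \<tau> (h 1 2 \<tau>) (h 2 0 \<tau>) + 6 *s B \<tau> (h 1 1 \<tau>) (h 2 1 \<tau>)
         + 3 *s B \<tau> (v \<tau>) (h 2 2 \<tau>) + B \<tau> (h 0 2 \<tau>) (h 3 0 \<tau>)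
         + 2 *s B \<tau> (vb \<tau>) (h 3 1 \<tau>) - (12 * \<alpha>2) *s (A \<tau> *v v \<tau>)
         - (6 * \<alpha>1) *s (A \<tau> *v h 2 1 \<tau> + 2 *s B \<tau> (v \<tau>) (h 1 1 \<tau>)
              + C \<tau> (v \<tau>) (v \<tau>) (vb \<tau>) + B \<tau> (vb \<tau>) (h 2 0 \<tau>)
              - (2 * \<alpha>1) *s (A \<tau> *v v \<tau>))\<rangle>)
         + \<i> * \<omega> * \<alpha>2 + \<i> * c * \<alpha>1 - \<i> * \<omega> * \<alpha>1 ^ 2) \<and>
     (\<forall>\<gamma>. cmod \<gamma> = 1 \<longrightarrow>
         (\<forall>\<alpha>1' \<alpha>2' c' e'. CH_coefficients F u0 T \<omega> (\<lambda>\<tau>. \<gamma> *s v \<tau>) \<alpha>1' \<alpha>2' c' e' \<longleftrightarrow>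
            \<alpha>1' = \<alpha>1 \<and> \<alpha>2' = \<alpha>2 \<and> c' = c \<and> e' = e))"
proof -
  have full: "ch_full F u0 T \<omega> \<delta> \<alpha>1 \<alpha>2 c e v vs \<phi>s H h Y \<theta>"
    by unfold_locales (fact smooth cycle eigenfunctions \<delta> manifold normal_form Y CH \<omega>)+
  interpret ch_full F u0 T \<omega> \<delta> \<alpha>1 \<alpha>2 c e v vs \<phi>s H h Y \<theta> by (rule full)
  have coeffs: "CH_coefficients F u0 T \<omega> v \<alpha>1 \<alpha>2 c e"
    unfolding CH_coefficients_def using eigenfunctions \<delta> manifold normal_form by blast
  have rotation: "CH_coefficients F u0 T \<omega> (\<lambda>\<tau>. \<gamma> *s v \<tau>) \<alpha>1' \<alpha>2' c' e' \<longleftrightarrow>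
      \<alpha>1' = \<alpha>1 \<and> \<alpha>2' = \<alpha>2 \<and> c' = c \<and> e' = e" if \<gamma>: "cmod \<gamma> = 1" for \<gamma> \<alpha>1' \<alpha>2' c' e'
  proof
    assume "CH_coefficients F u0 T \<omega> (\<lambda>\<tau>. \<gamma> *s v \<tau>) \<alpha>1' \<alpha>2' c' e'"
    \<comment> \<open>Turning back by cnj \<gamma> leads to data for \<open>v\<close> itself, to
      which \<open>coefficients_unique\<close> applies.\<close>
    then have "CH_coefficients F u0 T \<omega> (\<lambda>\<tau>. cnj \<gamma> *s (\<gamma> *s v \<tau>)) \<alpha>1' \<alpha>2' c' e'"
      by (rule CH_coefficients_rotate[rotated]) (simp add: \<gamma>)
    moreover have "cnj \<gamma> * \<gamma> = 1"
      using complex_norm_square[of \<gamma>] \<gamma> by (simp add: mult.commute)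
    ultimately have "CH_coefficients F u0 T \<omega> v \<alpha>1' \<alpha>2' c' e'" by simp
    then obtain \<phi>s2 vs2 \<delta>2 H2 h2 where d: "critical_eigenfunctions F u0 T \<omega> v \<phi>s2 vs2" "\<delta>2 > 0"
      "cm_expansion \<delta>2 T \<phi>s2 vs2 H2 h2" "CH_normal_form \<delta>2 F u0 T \<omega> v H2 \<alpha>1' \<alpha>2' c' e'"
      unfolding CH_coefficients_def by blast
    have "ch_full F u0 T \<omega> \<delta>2 \<alpha>1' \<alpha>2' c' e' v vs2 \<phi>s2 H2 h2 Y \<theta>"
      by unfold_locales (fact smooth cycle d Y CH \<omega>)+
    then show "\<alpha>1' = \<alpha>1 \<and> \<alpha>2' = \<alpha>2 \<and> c' = c \<and> e' = e"
      by (rule coefficients_unique[OF full])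
  qed (use CH_coefficients_rotate[OF \<gamma> coeffs] in blast)
  show ?thesis
    unfolding A B C D E vb
    by (intro conjI allI impI unique_h20 alpha1_formula unique_h11 c_formula unique_h21 unique_h30
        unique_h31 alpha2_formula unique_h22 e_formula rotation)
qed

end
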